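(* Fix $p\ge2$ and $\boldsymbol\theta_0\in\mathcal S^{p-1}$. Let $(\mathbf V_{0n})$ be a sequence of shape matrices of the form $\mathbf V_{0n}=\lambda_{n1}\boldsymbol\theta_0\boldsymbol\theta_0'+\sum_{j=2}^p\lambda_{nj}\boldsymbol\theta_{nj}\boldsymbol\theta_{nj}'$, where $\boldsymbol\theta_{n2},\dots,\boldsymbol\theta_{np}$ form an orthonormal basis of the orthogonal complement of $\boldsymbol\theta_0$ and $\lambda_{n1}>\lambda_{n2}\ge\dots\ge\lambda_{np}>0$. Assume there exists $\eta>0$ such that $\lambda_{n1}/\lambda_{n2}\ge1+\eta$ for all $n$ large enough. Then, under $\mathrm P^{(n)}_{\mathbf V_{0n}}$, $T_n(\tilde{\mathbf V}_{0n})=L_n+o_{\mathrm P}(1)$ as $n\to\infty$, where $$L_n:=\frac{np}{p+2}\big(\hat\lambda_{n1}\boldsymbol\theta_0'\hat{\mathbf V}_n^{-1}\boldsymbol\theta_0+\hat\lambda_{n1}^{-1}\boldsymbol\theta_0'\hat{\mathbf V}_n\boldsymbol\theta_0-2\big).$$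
   Context: $\mathcal S^{p-1}$ is the unit sphere of $\mathbb R^p$. A shape matrix is a symmetric positive definite $p\times p$ matrix with trace $p$. $\mathrm P^{(n)}_{\mathbf V}$ denotes the hypothesis under which $\mathbf U_{n1},\dots,\mathbf U_{nn}$ are i.i.d. with the angular Gaussian density $\mathbf u\mapsto \frac{\Gamma(p/2)}{2\pi^{p/2}(\det\mathbf V)^{1/2}}(\mathbf u'\mathbf V^{-1}\mathbf u)^{-p/2}$ on $\mathcal S^{p-1}$. $\mathbf S_n(\mathbf V):=\frac1n\sum_{i=1}^n\frac{\mathbf V^{-1/2}\mathbf U_{ni}\mathbf U_{ni}'\mathbf V^{-1/2}}{\|\mathbf V^{-1/2}\mathbf U_{ni}\|^2}$ and $T_n(\mathbf V):=np(p+2)\|(\mathbf I_p-\boldsymbol\theta_0\boldsymbol\theta_0')\mathbf S_n(\mathbf V)\boldsymbol\theta_0\|^2$. Tyler's M-estimator $\hat{\mathbf V}_n$ is the shape matrix satisfying $\mathbf S_n(\hat{\mathbf V}_n)=\frac1p\mathbf I_p$, with spectral decomposition $\hat{\mathbf V}_n=\sum_{j=1}^p\hat\lambda_{nj}\hat{\boldsymbol\theta}_{nj}\hat{\boldsymbol\theta}_{nj}'$, $\hat\lambda_{n1}\ge\dots\ge\hat\lambda_{np}$. For $j=2,\dots,p$, $\tilde{\boldsymbol\theta}_{nj}$ is obtained recursively by Gram–Schmidt: $\tilde{\boldsymbol\theta}_{nj}:=\frac{(\mathbf I_p-\boldsymbol\theta_0\boldsymbol\theta_0'-\sum_{k=2}^{j-1}\tilde{\boldsymbol\theta}_{nk}\tilde{\boldsymbol\theta}_{nk}')\hat{\boldsymbol\theta}_{nj}}{\|(\mathbf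 I_p-\boldsymbol\theta_0\boldsymbol\theta_0'-\sum_{k=2}^{j-1}\tilde{\boldsymbol\theta}_{nk}\tilde{\boldsymbol\theta}_{nk}')\hat{\boldsymbol\theta}_{nj}\|}$, and $\tilde{\mathbf V}_{0n}:=\hat\lambda_{n1}\boldsymbol\theta_0\boldsymbol\theta_0'+\sum_{j=2}^p\hat\lambda_{nj}\tilde{\boldsymbol\theta}_{nj}\tilde{\boldsymbol\theta}_{nj}'$. *)

theory Defs
  imports "HOL-Analysis.Analysis"
begin

definition outer :: "real^'n \<Rightarrow> real^'n \<Rightarrow> real^'n^'n" where
  "outer u v = (\<chi> i j. u $ i * v $ j)"

definition sym_mat :: "real^'n^'n \<Rightarrow> bool" where
  "sym_mat A \<longleftrightarrow> transpose A = A"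

definition posdef :: "real^'n^'n \<Rightarrow> bool" where
  "posdef A \<longleftrightarrow> (\<forall>x. x \<noteq> 0 \<longrightarrow> x \<bullet> (A *v x) > 0)"

definition shape :: "real^'n^'n \<Rightarrow> bool" where
  "shape A \<longleftrightarrow> sym_mat A \<and> posdef A \<and> trace A = real CARD('n)"

definition mat_sqrt :: "real^'n^'n \<Rightarrow> real^'n^'n" where
  "mat_sqrt A = (THE R. sym_mat R \<and> posdef R \<and> R ** R = A)"

definition mat_isqrt :: "real^'n^'n \<Rightarrow> real^'n^'n" where
  "mat_isqrt A = matrix_inv (mat_sqrt A)"

text \<open>Surface (cone) measure on the unit sphere of R^p:
  sigma(A) = p * Lebesgue({t x : x in A, 0 < t <= 1}), realised as the image of
  p times Lebesgue measure on the unit ball under radial projection.\<close>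
definition sphere_measure :: "(real^'n) measure" where
  "sphere_measure = distr (density lborel (\<lambda>x. ennreal (real CARD('n)) * indicator (ball 0 1) x))
                          borel (\<lambda>x. x /\<^sub>R norm x)"

definition ang_gauss_dens :: "real^'n^'n \<Rightarrow> real^'n \<Rightarrow> real" where
  "ang_gauss_dens V u =
     Gamma (real CARD('n) / 2) / (2 * pi powr (real CARD('n) / 2) * sqrt (det V))
     * (u \<bullet> (matrix_inv V *v u)) powr (- real CARD('n) / 2)"

definition ang_gauss :: "real^'n^'n \<Rightarrow> (real^'n) measure" where
  "ang_gauss V = density sphere_measure (\<lambda>u. ennreal (ang_gauss_dens V u))"

definition sample_law :: "nat \<Rightarrow> real^'n^'n \<Rightarrow> (nat \<Rightarrow> real^'n) measure" where
  "sample_law n V = PiM {..<n} (\<lambda>_. ang_gauss V)"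

definition S_n :: "nat \<Rightarrow> (nat \<Rightarrow> real^'n) \<Rightarrow> real^'n^'n \<Rightarrow> real^'n^'n" where
  "S_n n U V = (1 / real n) *\<^sub>R (\<Sum>i<n.
      (1 / (norm (mat_isqrt V *v U i))\<^sup>2) *\<^sub>R (mat_isqrt V ** outer (U i) (U i) ** mat_isqrt V))"

definition T_n :: "real^'n \<Rightarrow> nat \<Rightarrow> (nat \<Rightarrow> real^'n) \<Rightarrow> real^'n^'n \<Rightarrow> real" where
  "T_n t0 n U V = real n * real CARD('n) * (real CARD('n) + 2)
      * (norm ((mat 1 - outer t0 t0) *v (S_n n U V *v t0)))\<^sup>2"

definition tyler_ok :: "nat \<Rightarrow> (nat \<Rightarrow> real^'n) \<Rightarrow> bool" where
  "tyler_ok n U \<longleftrightarrow> (\<exists>!V. shape V \<and> S_n n U V = (1 / real CARD('n)) *\<^sub>R mat 1)"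

definition tyler :: "nat \<Rightarrow> (nat \<Rightarrow> real^'n) \<Rightarrow> real^'n^'n" where
  "tyler n U = (THE V. shape V \<and> S_n n U V = (1 / real CARD('n)) *\<^sub>R mat 1)"

text \<open>Gram-Schmidt: gs t0 th m k, for 2 <= k < m, is tilde-theta_k computed
  from t0 and th 2, th 3, ... ; tilde-theta_j = gs t0 th (Suc j) j.\<close>
primrec gs :: "real^'n \<Rightarrow> (nat \<Rightarrow> real^'n) \<Rightarrow> nat \<Rightarrow> nat \<Rightarrow> real^'n" where
  "gs t0 th 0 = (\<lambda>k. 0)"
| "gs t0 th (Suc m) =
     (let f = gs t0 th m;
          v = (mat 1 - outer t0 t0 - (\<Sum>k\<in>{2..<m}. outer (f k) (f k))) *v th m
      in f(m := v /\<^sub>R norm v))"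

definition theta_tilde :: "real^'n \<Rightarrow> (nat \<Rightarrow> real^'n) \<Rightarrow> nat \<Rightarrow> real^'n" where
  "theta_tilde t0 th j = gs t0 th (Suc j) j"

definition V_tilde :: "real^'n \<Rightarrow> (nat \<Rightarrow> real) \<Rightarrow> (nat \<Rightarrow> real^'n) \<Rightarrow> real^'n^'n" where
  "V_tilde t0 lh th = lh 1 *\<^sub>R outer t0 t0
      + (\<Sum>j\<in>{2..CARD('n)}. lh j *\<^sub>R outer (theta_tilde t0 th j) (theta_tilde t0 th j))"

definition L_n :: "real^'n \<Rightarrow> nat \<Rightarrow> real^'n^'n \<Rightarrow> real \<Rightarrow> real" where
  "L_n t0 n Vh l1 = real n * real CARD('n) / (real CARD('n) + 2)
      * (l1 * (t0 \<bullet> (matrix_inv Vh *v t0)) + (1 / l1) * (t0 \<bullet> (Vh *v t0)) - 2)"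

text \<open>X_n - Y_n = o_P(1) under measures M n (outer-probability form, so that no
  measurability of X_n, Y_n needs to be assumed).\<close>
definition oP1 :: "(nat \<Rightarrow> 'a measure) \<Rightarrow> (nat \<Rightarrow> 'a \<Rightarrow> real) \<Rightarrow> bool" where
  "oP1 M X \<longleftrightarrow> (\<forall>\<epsilon>>0. \<forall>\<delta>>0. \<forall>\<^sub>F n in sequentially.
      \<exists>A\<in>sets (M n). {\<omega>\<in>space (M n). \<bar>X n \<omega>\<bar> > \<epsilon>} \<subseteq> A \<and> emeasure (M n) A < ennreal \<delta>)"

end

theory Submission
  imports Defs "HOL-Probability.Probability"
begin

text \<open>
  Under \<open>P_V\<close> the directions \<open>w i\<close> of \<open>V^(-1/2) U i\<close> are i.i.d. uniform on the sphere,
  so by Hoeffding's inequality their empirical fourth moments are within \<open>\<delta> = O(1 / sqrt n)\<close> of those of the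
  uniform law, up to small probability. The rest is deterministic. Brouwer's theorem yields a
  symmetric \<open>B\<close> with \<open>B - I = O(\<delta>)\<close> for which the directions of \<open>B w\<close> are exactly isotropic; hence Tyler's
  estimator exists, and it is unique because the sample does not split between two proper subspaces.
  The eigenvalue gap gives \<open>t0 \<bullet> \<theta>_j = O(\<delta> sqrt (\<lambda>_j / \<lambda>_1))\<close> for the estimated eigenvectors,
  uniformly in the spectrum, and the order of the Gram--Schmidt steps preserves this grading: in the
  coordinates that make the sample isotropic, passing to the constrained estimator is multiplication by \<open>I + O(\<delta>)\<close>. Expanding
  \<open>S_n\<close> to first order with the uniform fourth moments gives
  \<open>\<bar>T_n - L_n\<bar> = O(n \<delta>^3)\<close>.
\<close>

text \<open>Eigenvalue ratios may diverge, so norm bounds on differences of shape matrices would not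
  control forms in their inverses. Errors are therefore measured after standardisation, where the
  law of the sample no longer depends on \<open>V0 n\<close>. Both statistics have size n
  \<delta>^2, which stays bounded, so each entry has to be followed to first order with an error
  O(\<delta>^2). Their common leading term is built from a_j = (t0 . \<theta>_j) (sqrt (\<lambda>_j
  / \<lambda>_1) - sqrt (\<lambda>_1 / \<lambda>_j)), j >= 2. For \<open>L_n\<close> this is exact
  algebra; for \<open>T_n\<close>, a_j / (p + 2) is the linear response of entry (j, 1) of the
  scatter. The factor 1 / (p + 2) is 1 / p minus the part 2 / (p (p + 2)) removed by normalising to
  the sphere, and p (p + 2) / (p + 2)^2 = p / (p + 2) reconciles the constants of the two
  statistics. Existence of the estimator is derived by a fixed point because the size of B - I and
  the explicit form of the solution are needed as well.\<close>

declare One_nat_def [simp del]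

section \<open>Spectral decomposition and matrix square roots\<close>

lemma outer_mult_vec: "outer u v *v x = (v \<bullet> x) *\<^sub>R u"
  by (simp add: vec_eq_iff outer_def matrix_vector_mult_def inner_vec_def sum_distrib_right
      sum_distrib_left mult_ac)

lemma matrix_sum_mult_vec: "(\<Sum>j\<in>I. M j) *v x = (\<Sum>j\<in>I. (M j :: real^'n^'m) *v x)"
  by (induction I rule: infinite_finite_induct) (auto simp: matrix_vector_mult_add_rdistrib)

lemma matrix_scaleR_mult_vec: "(c *\<^sub>R M) *v x = c *\<^sub>R ((M :: real^'n^'m) *v x)"
  by (simp add: scaleR_matrix_vector_assoc)

lemma sym_mat_inner: "sym_mat (A :: real^'n^'n) \<Longrightarrow> x \<bullet> (A *v y) = (A *v x) \<bullet> y"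
  by (metis dot_lmul_matrix sym_mat_def transpose_matrix_vector)

lemma transpose_mult_inner: "(transpose (A :: real^'n^'m) *v x) \<bullet> y = x \<bullet> (A *v y)"
  by (simp add: dot_lmul_matrix)

lemma sym_matI:
  assumes "\<And>x y. x \<bullet> ((A :: real^'n^'n) *v y) = (A *v x) \<bullet> y"
  shows "sym_mat A"
proof -
  have "transpose A *v x = A *v x" for x
    by (metis assms transpose_mult_inner vector_eq_rdot)
  then show ?thesis
    by (simp add: sym_mat_def matrix_eq)
qed

lemma matrix_eq_inner:
  "A = B \<longleftrightarrow> (\<forall>x y. x \<bullet> ((A :: real^'n^'m) *v y) = x \<bullet> (B *v y))"
  by (metis matrix_eq vector_eq_ldot)

text \<open>Numbered by \<open>1..CARD('n)\<close> instead of the index type, because eigenvectors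
  are ordered by eigenvalue and Gram-Schmidt runs along that order. Values at other indices are
  unconstrained.\<close>

definition onb :: "(nat \<Rightarrow> real^'n) \<Rightarrow> bool" where
  "onb e \<longleftrightarrow> (\<forall>j\<in>{1..CARD('n)}. \<forall>k\<in>{1..CARD('n)}. e j \<bullet> e k = (if j = k then 1 else 0))"

lemma onb_inner:
  "onb (e :: nat \<Rightarrow> real^'n) \<Longrightarrow> j \<in> {1..CARD('n)} \<Longrightarrow> k \<in> {1..CARD('n)} \<Longrightarrow>
    e j \<bullet> e k = (if j = k then 1 else 0)"
  by (simp add: onb_def)

lemma onb_norm: "onb (e :: nat \<Rightarrow> real^'n) \<Longrightarrow> j \<in> {1..CARD('n)} \<Longrightarrow> norm (e j) = 1"
  by (simp add: onb_inner norm_eq_1)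

text \<open>Orthonormal vectors are independent, and p of them span the space. This completeness
  reduces later identities of vectors and matrices to comparing coordinates along
  \<open>e\<close>.\<close>

lemma onb_orthogonal_imp_0:
  assumes e: "onb (e :: nat \<Rightarrow> real^'n)" and x: "\<And>j. j \<in> {1..CARD('n)} \<Longrightarrow> e j \<bullet> x = 0"
  shows "x = 0"
proof -
  let ?B = "e ` {1..CARD('n)}"
  have inj: "inj_on e {1..CARD('n)}"
  proof (rule inj_onI)
    fix j k assume jk: "j \<in> {1..CARD('n)}" "k \<in> {1..CARD('n)}" "e j = e k"
    then have "e j \<bullet> e k = 1"
      using onb_inner[OF e jk(2) jk(2)] by simp
    then show "j = k"
      using onb_inner[OF e jk(1,2)] by (auto split: if_splits)
  qed
  have "pairwise orthogonal ?B"
    unfolding pairwise_def orthogonal_def using e by (auto simp: onb_inner)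
  moreover have "0 \<notin> ?B"
    using onb_norm[OF e] by force
  ultimately have "independent ?B"
    by (rule pairwise_orthogonal_independent)
  moreover have "card ?B = DIM(real^'n)"
    by (simp add: card_image inj)
  ultimately have "span ?B = UNIV"
    using card_eq_dim[of ?B UNIV] by auto
  then have "orthogonal x x"
    using x by (intro orthogonal_to_span[of x ?B x]) (auto simp: orthogonal_def inner_commute[of x])
  then show ?thesis
    by (simp add: orthogonal_def)
qed

lemma onb_inner_sum:
  assumes "onb (e :: nat \<Rightarrow> real^'n)" "k \<in> {1..CARD('n)}"
  shows "e k \<bullet> (\<Sum>j\<in>{1..CARD('n)}. c j *\<^sub>R e j) = c k"
proof -
  have "e k \<bullet> (\<Sum>j\<in>{1..CARD('n)}. c j *\<^sub>R e j) = (\<Sum>j\<in>{1..CARD('n)}. if j = k then c j else 0)"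
    unfolding inner_sum_right by (intro sum.cong refl) (use assms in \<open>auto simp: onb_inner\<close>)
  then show ?thesis
    using assms(2) by simp
qed

lemma onb_expansion:
  assumes e: "onb (e :: nat \<Rightarrow> real^'n)"
  shows "x = (\<Sum>j\<in>{1..CARD('n)}. (e j \<bullet> x) *\<^sub>R e j)"
proof -
  have "x - (\<Sum>j\<in>{1..CARD('n)}. (e j \<bullet> x) *\<^sub>R e j) = 0"
    by (intro onb_orthogonal_imp_0[OF e])
       (subst inner_diff_right, subst onb_inner_sum[OF e], auto)
  then show ?thesis
    by simp
qed

lemma onb_parseval:
  assumes e: "onb (e :: nat \<Rightarrow> real^'n)"
  shows "x \<bullet> y = (\<Sum>j\<in>{1..CARD('n)}. (e j \<bullet> x) * (e j \<bullet> y))"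
  by (subst onb_expansion[OF e, of x]) (simp add: inner_sum_left)

lemma onb_norm2:
  assumes e: "onb (e :: nat \<Rightarrow> real^'n)"
  shows "(norm x)\<^sup>2 = (\<Sum>j\<in>{1..CARD('n)}. (e j \<bullet> x)\<^sup>2)"
  unfolding power2_norm_eq_inner by (subst onb_parseval[OF e]) (simp add: power2_eq_square)

lemma onb_eqI:
  assumes e: "onb (e :: nat \<Rightarrow> real^'n)" and "\<And>j. j \<in> {1..CARD('n)} \<Longrightarrow> e j \<bullet> x = e j \<bullet> y"
  shows "x = y"
  using onb_orthogonal_imp_0[OF e, of "x - y"] assms(2) by (simp add: inner_diff_right)

text \<open>Functional calculus takes place in the second argument: square root, inverse and inverse
  square root keep \<open>e\<close> and change \<mu> only.\<close>

definition spec_mat :: "(nat \<Rightarrow> real^'n) \<Rightarrow> (nat \<Rightarrow> real) \<Rightarrow> real^'n^'n" where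
  "spec_mat e \<mu> = (\<Sum>j\<in>{1..CARD('n)}. \<mu> j *\<^sub>R outer (e j) (e j))"

lemma spec_mat_mult_vec:
  "spec_mat e \<mu> *v (x :: real^'n) = (\<Sum>j\<in>{1..CARD('n)}. (\<mu> j * (e j \<bullet> x)) *\<^sub>R e j)"
  by (simp add: spec_mat_def matrix_sum_mult_vec matrix_scaleR_mult_vec outer_mult_vec)

lemma sym_spec_mat: "sym_mat (spec_mat e \<mu> :: real^'n^'n)"
  by (rule sym_matI)
     (simp add: spec_mat_mult_vec inner_sum_left inner_sum_right inner_commute mult_ac)

lemma spec_mat_quad: "x \<bullet> (spec_mat e \<mu> *v (x :: real^'n)) = (\<Sum>j\<in>{1..CARD('n)}. \<mu> j * (e j \<bullet> x)\<^sup>2)"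
  by (simp add: spec_mat_mult_vec inner_sum_right power2_eq_square inner_commute mult_ac)

lemma inner_spec_mat:
  assumes "onb (e :: nat \<Rightarrow> real^'n)" "k \<in> {1..CARD('n)}"
  shows "e k \<bullet> (spec_mat e \<mu> *v x) = \<mu> k * (e k \<bullet> x)"
  using onb_inner_sum[OF assms, of "\<lambda>j. \<mu> j * (e j \<bullet> x)"] by (simp add: spec_mat_mult_vec)

lemma spec_mat_eigen:
  assumes "onb (e :: nat \<Rightarrow> real^'n)" "k \<in> {1..CARD('n)}"
  shows "spec_mat e \<mu> *v e k = \<mu> k *\<^sub>R e k"
  by (rule onb_eqI[OF assms(1)]) (use assms in \<open>simp add: inner_spec_mat onb_inner\<close>)

lemma spec_mat_mult:
  assumes "onb (e :: nat \<Rightarrow> real^'n)"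
  shows "spec_mat e \<mu> ** spec_mat e \<nu> = spec_mat e (\<lambda>j. \<mu> j * \<nu> j)"
  unfolding matrix_eq
  by (intro allI onb_eqI[OF assms]) (simp add: inner_spec_mat assms flip: matrix_vector_mul_assoc)

lemma spec_mat_one:
  assumes "onb (e :: nat \<Rightarrow> real^'n)" "\<And>j. j \<in> {1..CARD('n)} \<Longrightarrow> \<mu> j = 1"
  shows "spec_mat e \<mu> = mat 1"
  unfolding matrix_eq
  by (intro allI onb_eqI[OF assms(1)]) (simp add: inner_spec_mat assms)

lemma spec_mat_cong:
  "(\<And>j. j \<in> {1..CARD('n)} \<Longrightarrow> \<mu> j = \<nu> j) \<Longrightarrow> (spec_mat e \<mu> :: real^'n^'n) = spec_mat e \<nu>"
  by (simp add: spec_mat_def)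

lemma posdef_spec_mat:
  assumes e: "onb (e :: nat \<Rightarrow> real^'n)"
  shows "posdef (spec_mat e \<mu>) \<longleftrightarrow> (\<forall>j\<in>{1..CARD('n)}. \<mu> j > 0)"
proof safe
  fix j assume "posdef (spec_mat e \<mu>)" and j: "j \<in> {1..CARD('n)}"
  moreover have "e j \<noteq> 0"
    using onb_norm[OF e j] by auto
  ultimately have "e j \<bullet> (spec_mat e \<mu> *v e j) > 0"
    by (simp add: posdef_def)
  then show "\<mu> j > 0"
    using e j by (simp add: inner_spec_mat onb_inner)
next
  assume \<mu>: "\<forall>j\<in>{1..CARD('n)}. \<mu> j > 0"
  show "posdef (spec_mat e \<mu>)"
    unfolding posdef_def
  proof safe
    fix x :: "real^'n" assume "x \<noteq> 0"
    then obtain j where "j \<in> {1..CARD('n)}" "e j \<bullet> x \<noteq> 0"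
      using onb_orthogonal_imp_0[OF e] by blast
    then show "x \<bullet> (spec_mat e \<mu> *v x) > 0"
      unfolding spec_mat_quad using \<mu> by (intro sum_pos2[of _ j]) (auto simp: less_imp_le)
  qed
qed

lemma matrix_inv_unique: "A ** B = mat 1 \<Longrightarrow> matrix_inv (A :: real^'n^'n) = B"
  unfolding matrix_inv_def
  by (rule some_equality) (metis matrix_left_right_inverse matrix_mul_assoc matrix_mul_lid)+

lemma matrix_inv_spec_mat:
  assumes "onb (e :: nat \<Rightarrow> real^'n)" "\<And>j. j \<in> {1..CARD('n)} \<Longrightarrow> \<mu> j \<noteq> 0"
  shows "matrix_inv (spec_mat e \<mu>) = spec_mat e (\<lambda>j. 1 / \<mu> j)"
  by (intro matrix_inv_unique, subst spec_mat_mult[OF assms(1)], rule spec_mat_one[OF assms(1)])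
    (simp add: assms(2))

text \<open>A maximiser \<open>x\<close> of the quadratic form on the unit sphere of
  \<open>S\<close> is an eigenvector: the residual \<open>z\<close> lies in \<open>S\<close> by
  invariance and is orthogonal to \<open>x\<close>, and moving along \<open>z\<close> would raise
  the Rayleigh quotient to first order unless \<open>z\<close> vanishes.\<close>

lemma spectral_eigenvector_step:
  fixes A :: "real^'n^'n"
  assumes A: "sym_mat A" and S: "subspace S" "S \<noteq> {0}" and inv: "\<And>x. x \<in> S \<Longrightarrow> A *v x \<in> S"
  shows "\<exists>x\<in>S. norm x = 1 \<and> (\<exists>\<mu>. A *v x = \<mu> *\<^sub>R x)"
proof -
  let ?K = "S \<inter> sphere 0 1"
  obtain y where y: "y \<in> S" "y \<noteq> 0"
    using S subspace_0 by blast
  then have "y /\<^sub>R norm y \<in> ?K"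
    using S by (simp add: subspace_mul)
  then have ne: "?K \<noteq> {}"
    by blast
  have "compact ?K"
    by (simp add: closed_Int_compact closed_subspace S)
  moreover have "continuous_on ?K (\<lambda>x. x \<bullet> (A *v x))"
    by (intro continuous_intros)
  ultimately obtain x where x: "x \<in> ?K" and max: "\<And>y. y \<in> ?K \<Longrightarrow> y \<bullet> (A *v y) \<le> x \<bullet> (A *v x)"
    using continuous_attains_sup[OF _ ne] by blast
  define \<mu> where "\<mu> = x \<bullet> (A *v x)"
  have x1: "x \<in> S" "norm x = 1"
    using x by auto
  have quad: "y \<bullet> (A *v y) \<le> \<mu> * (y \<bullet> y)" if "y \<in> S" for y
  proof (cases "y = 0")
    case False
    have "(y /\<^sub>R norm y) \<bullet> (A *v (y /\<^sub>R norm y)) \<le> \<mu>"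
      unfolding \<mu>_def using False that S by (intro max) (simp add: subspace_mul)
    then have "(y \<bullet> (A *v y)) / (norm y)\<^sup>2 \<le> \<mu>"
      by (simp add: matrix_vector_mult_scaleR power2_eq_square divide_simps)
    then show ?thesis
      using False by (simp add: power2_norm_eq_inner divide_simps)
  qed simp
  define z where "z = A *v x - \<mu> *\<^sub>R x"
  have zS: "z \<in> S"
    unfolding z_def using x1 inv S by (simp add: subspace_diff subspace_mul)
  have zx: "z \<bullet> x = 0"
    using x1 inner_commute[of "A *v x" x] by (simp add: z_def inner_diff_left \<mu>_def norm_eq_1)
  have "2 * t * (z \<bullet> z) \<le> t\<^sup>2 * (\<mu> * (z \<bullet> z) - z \<bullet> (A *v z))" for t
  proof -
    have le: "(x + t *\<^sub>R z) \<bullet> (A *v (x + t *\<^sub>R z)) \<le> \<mu> * ((x + t *\<^sub>R z) \<bullet> (x + t *\<^sub>R z))"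
      by (intro quad) (simp add: subspace_add subspace_mul S x1 zS)
    have zAx: "z \<bullet> (A *v x) = z \<bullet> z"
      using zx arg_cong[OF z_def, of "\<lambda>u. z \<bullet> u"] by (simp add: inner_diff_right)
    then have "x \<bullet> (A *v z) = z \<bullet> z"
      by (metis A inner_commute sym_mat_inner)
    then have eq1: "(x + t *\<^sub>R z) \<bullet> (A *v (x + t *\<^sub>R z)) = \<mu> + 2 * t * (z \<bullet> z) + t\<^sup>2 * (z \<bullet> (A *v z))"
      using zAx by (simp add: matrix_vector_right_distrib matrix_vector_mult_scaleR inner_add_left
          inner_add_right \<mu>_def power2_eq_square algebra_simps)
    have "x \<bullet> z = 0"
      using zx by (simp only: inner_commute)
    then have eq2: "(x + t *\<^sub>R z) \<bullet> (x + t *\<^sub>R z) = 1 + t\<^sup>2 * (z \<bullet> z)"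
      using x1(2) zx by (simp add: inner_add_left inner_add_right norm_eq_1 power2_eq_square)
    show ?thesis
      using le unfolding eq1 eq2 by (simp add: algebra_simps)
  qed
  note ineq = this
  have "z \<bullet> z = 0"
  proof (rule ccontr)
    assume nz: "z \<bullet> z \<noteq> 0"
    define c where "c = \<bar>\<mu> * (z \<bullet> z) - z \<bullet> (A *v z)\<bar> + 1"
    have c: "c > 0" "\<mu> * (z \<bullet> z) - z \<bullet> (A *v z) \<le> c"
      by (auto simp: c_def)
    have zz: "z \<bullet> z > 0"
      using nz by simp
    \<comment> \<open>Step length tuned to the bound \<open>c\<close> of the quadratic coefficient:
      the linear gain is twice the quadratic loss, against maximality.\<close>
    let ?t = "(z \<bullet> z) / c"
    have "2 * ?t * (z \<bullet> z) \<le> ?t\<^sup>2 * c"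
      by (rule order_trans[OF ineq]) (intro mult_left_mono c, simp)
    moreover have "(z \<bullet> z) * (z \<bullet> z) > 0"
      using zz by (rule mult_pos_pos) (rule zz)
    ultimately show False
      using c by (simp add: power2_eq_square divide_simps)
  qed
  then have "A *v x = \<mu> *\<^sub>R x"
    by (simp add: z_def)
  then show ?thesis
    using x1 by blast
qed

text \<open>Eigenvectors are split off one at a time: by symmetry the orthogonal complement of the
  first \<open>k\<close> is invariant, and it is nonzero while \<open>k\<close> is below the
  dimension.\<close>

lemma spectral_theorem:
  fixes A :: "real^'n^'n"
  assumes A: "sym_mat A"
  obtains e \<mu> where "onb e" "A = spec_mat e \<mu>"
proof -
  have "\<exists>e \<mu>. (\<forall>j\<in>{1..k}. \<forall>i\<in>{1..k}. e j \<bullet> e i = (if j = i then 1 else 0)) \<and>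
          (\<forall>j\<in>{1..k}. A *v e j = \<mu> j *\<^sub>R e j)" if "k \<le> CARD('n)" for k
    using that
  proof (induction k)
    case (Suc k)
    then obtain e \<mu> where e: "\<forall>j\<in>{1..k}. \<forall>i\<in>{1..k}. e j \<bullet> e i = (if j = i then 1 else 0)"
      and \<mu>: "\<forall>j\<in>{1..k}. A *v e j = \<mu> j *\<^sub>R e j"
      by auto
    let ?S = "{x. \<forall>j\<in>{1..k}. e j \<bullet> x = 0}"
    have sub: "subspace ?S"
      by (auto simp: subspace_def inner_simps)
    have "dim (e ` {1..k}) \<le> card (e ` {1..k})"
      by (rule dim_le_card') auto
    also have "\<dots> \<le> k"
      using card_image_le[of "{1..k}" e] by simp
    also have "\<dots> < DIM(real^'n)"
      using Suc.prems by simp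
    finally obtain x where x: "x \<noteq> 0" "\<And>y. y \<in> span (e ` {1..k}) \<Longrightarrow> orthogonal x y"
      by (rule orthogonal_to_subspace_exists) auto
    have "x \<in> ?S"
    proof safe
      fix j assume "j \<in> {1..k}"
      then have "orthogonal x (e j)"
        by (intro x(2) span_base imageI)
      then show "e j \<bullet> x = 0"
        by (simp add: orthogonal_def inner_commute)
    qed
    then have "?S \<noteq> {0}"
      using x(1) by blast
    moreover have "A *v x \<in> ?S" if "x \<in> ?S" for x
      using that \<mu> sym_mat_inner[OF A] by auto
    ultimately obtain y \<nu> where y: "y \<in> ?S" "norm y = 1" "A *v y = \<nu> *\<^sub>R y"
      using spectral_eigenvector_step[OF A sub] by blast
    have "{1..Suc k} = insert (Suc k) {1..k}"
      by auto
    then show ?case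
      using e \<mu> y
      by (intro exI[of _ "e(Suc k := y)"] exI[of _ "\<mu>(Suc k := \<nu>)"])
         (auto simp: inner_commute norm_eq_1)
  qed auto
  then obtain e \<mu> where e: "onb e" and \<mu>: "\<forall>j\<in>{1..CARD('n)}. A *v e j = \<mu> j *\<^sub>R e j"
    unfolding onb_def by blast
  have "A *v x = spec_mat e \<mu> *v x" for x
    by (rule onb_eqI[OF e]) (simp add: sym_mat_inner[OF A] inner_spec_mat[OF e] \<mu>)
  then have "A = spec_mat e \<mu>"
    by (simp add: matrix_eq)
  with e show thesis
    by (rule that)
qed

lemma mat_sqrt_spec_mat:
  assumes e: "onb (e :: nat \<Rightarrow> real^'n)" and \<mu>: "\<And>j. j \<in> {1..CARD('n)} \<Longrightarrow> \<mu> j > 0"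
  shows "mat_sqrt (spec_mat e \<mu>) = spec_mat e (\<lambda>j. sqrt (\<mu> j))"
  unfolding mat_sqrt_def
proof (rule the_equality)
  show "sym_mat (spec_mat e (\<lambda>j. sqrt (\<mu> j))) \<and> posdef (spec_mat e (\<lambda>j. sqrt (\<mu> j))) \<and>
    spec_mat e (\<lambda>j. sqrt (\<mu> j)) ** spec_mat e (\<lambda>j. sqrt (\<mu> j)) = spec_mat e \<mu>"
    unfolding spec_mat_mult[OF e] using \<mu>
    by (auto simp: sym_spec_mat posdef_spec_mat[OF e] less_imp_le intro!: spec_mat_cong)
next
  fix R assume R: "sym_mat R \<and> posdef R \<and> R ** R = spec_mat e \<mu>"
  have "R *v e j = sqrt (\<mu> j) *\<^sub>R e j" if j: "j \<in> {1..CARD('n)}" for j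
  proof (rule ccontr)
    \<comment> \<open>(R + sqrt \<mu>_j) (R - sqrt \<mu>_j) annihilates \<open>e j\<close>, so a
      nonzero \<open>?d\<close> would be an eigenvector of \<open>R\<close> with a negative
      eigenvalue.\<close>
    let ?d = "R *v e j - sqrt (\<mu> j) *\<^sub>R e j"
    assume "R *v e j \<noteq> sqrt (\<mu> j) *\<^sub>R e j"
    then have "?d \<bullet> (R *v ?d) > 0"
      using R by (simp add: posdef_def)
    moreover have "R *v (R *v e j) = \<mu> j *\<^sub>R e j"
      using R spec_mat_eigen[OF e j] by (simp add: matrix_vector_mul_assoc)
    then have "R *v ?d = - sqrt (\<mu> j) *\<^sub>R ?d"
      using \<mu>[OF j] by (simp add: matrix_vector_mult_diff_distrib matrix_vector_mult_scaleR
          scaleR_diff_right)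
    then have "?d \<bullet> (R *v ?d) = - sqrt (\<mu> j) * (?d \<bullet> ?d)"
      by simp
    ultimately show False
      using \<mu>[OF j] by (smt (verit) inner_ge_zero mult_nonneg_nonneg real_sqrt_ge_zero mult_minus_left)
  qed
  then have "R *v x = spec_mat e (\<lambda>j. sqrt (\<mu> j)) *v x" for x
    by (intro onb_eqI[OF e]) (use R in \<open>simp add: sym_mat_inner inner_spec_mat[OF e]\<close>)
  then show "R = spec_mat e (\<lambda>j. sqrt (\<mu> j))"
    by (simp add: matrix_eq)
qed

lemma mat_isqrt_spec_mat:
  assumes e: "onb (e :: nat \<Rightarrow> real^'n)" and \<mu>: "\<And>j. j \<in> {1..CARD('n)} \<Longrightarrow> \<mu> j > 0"
  shows "mat_isqrt (spec_mat e \<mu>) = spec_mat e (\<lambda>j. 1 / sqrt (\<mu> j))"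
  unfolding mat_isqrt_def
  by (subst mat_sqrt_spec_mat[OF e \<mu>]; (intro matrix_inv_spec_mat[OF e])?) (use \<mu> in force)+

definition avg :: "nat \<Rightarrow> (nat \<Rightarrow> real) \<Rightarrow> real" where
  "avg n f = (\<Sum>i<n. f i) / real n"

lemma outer_sandwich: "sym_mat (N :: real^'n^'n) \<Longrightarrow> N ** outer u u ** N = outer (N *v u) (N *v u)"
  unfolding matrix_eq
  by (simp add: outer_mult_vec sym_mat_inner matrix_vector_mult_scaleR flip: matrix_vector_mul_assoc)

lemma S_n_form:
  assumes N: "sym_mat (mat_isqrt (V :: real^'n^'n))"
  shows "x \<bullet> (S_n n U V *v y) =
    avg n (\<lambda>i. (x \<bullet> (mat_isqrt V *v U i)) * (y \<bullet> (mat_isqrt V *v U i)) / (norm (mat_isqrt V *v U i))\<^sup>2)"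
  unfolding S_n_def avg_def
  by (simp add: outer_sandwich[OF N] matrix_sum_mult_vec matrix_scaleR_mult_vec outer_mult_vec
      inner_sum_right inner_commute[of _ y] mult_ac sum_distrib_left sum_divide_distrib)

text \<open>Substituting along the bijection \<open>?R\<close> removes the inverse square root from
  the estimating equation and leaves the fixed-point form V = p avg (U U' / (U' V^-1 U)), which
  depends on the directions of the U_i only.\<close>

lemma S_n_isotropic_iff:
  fixes V :: "real^'n^'n"
  assumes V: "sym_mat V" "posdef V"
  shows "S_n n U V = (1 / real CARD('n)) *\<^sub>R mat 1 \<longleftrightarrow>
    (\<forall>x y. real CARD('n) * avg n (\<lambda>i. (x \<bullet> U i) * (y \<bullet> U i) / (U i \<bullet> (matrix_inv V *v U i)))
      = x \<bullet> (V *v y))"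
proof -
  obtain e \<mu> where e: "onb e" and Ve: "V = spec_mat e \<mu>"
    using spectral_theorem[OF V(1)] .
  have \<mu>: "\<mu> j > 0" if "j \<in> {1..CARD('n)}" for j
    using V(2) that unfolding Ve posdef_spec_mat[OF e] by blast
  let ?R = "spec_mat e (\<lambda>j. sqrt (\<mu> j))" and ?N = "spec_mat e (\<lambda>j. 1 / sqrt (\<mu> j))"
  have N: "mat_isqrt V = ?N"
    unfolding Ve by (rule mat_isqrt_spec_mat[OF e \<mu>])
  have inv: "matrix_inv V = ?N ** ?N"
    unfolding Ve spec_mat_mult[OF e] using \<mu>
    by (subst matrix_inv_spec_mat[OF e]) (force intro: spec_mat_cong)+
  have RN: "?R *v (?N *v x) = x" and NR: "?N *v (?R *v x) = x" for x
    using \<mu> unfolding matrix_vector_mul_assoc spec_mat_mult[OF e]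
    by (subst spec_mat_one[OF e]; force)+
  have RR: "?R *v (?R *v x) = V *v x" for x
    unfolding matrix_vector_mul_assoc spec_mat_mult[OF e] Ve
    by (rule arg_cong[of _ _ "\<lambda>A. A *v x"], rule spec_mat_cong) (use \<mu> in force)
  have q: "u \<bullet> (matrix_inv V *v u) = (norm (?N *v u))\<^sup>2" for u
    unfolding inv power2_norm_eq_inner
    by (simp add: sym_mat_inner[OF sym_spec_mat] flip: matrix_vector_mul_assoc)
  define F where "F x y = avg n (\<lambda>i. (x \<bullet> U i) * (y \<bullet> U i) / (norm (?N *v U i))\<^sup>2)" for x y
  have S: "x \<bullet> (S_n n U V *v y) = F (?N *v x) (?N *v y)" for x y
    unfolding F_def by (subst S_n_form) (simp_all add: N sym_spec_mat sym_mat_inner)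
  have "S_n n U V = (1 / real CARD('n)) *\<^sub>R mat 1 \<longleftrightarrow>
      (\<forall>x y. F (?N *v x) (?N *v y) = (x \<bullet> y) / real CARD('n))"
    by (simp add: matrix_eq_inner S matrix_scaleR_mult_vec)
  also have "\<dots> \<longleftrightarrow> (\<forall>x y. F x y = (?R *v x) \<bullet> (?R *v y) / real CARD('n))"
    by (metis RN NR)
  also have "\<dots> \<longleftrightarrow> (\<forall>x y. real CARD('n) * F x y = x \<bullet> (V *v y))"
    by (simp add: sym_mat_inner[OF sym_spec_mat, symmetric] RR field_simps)
  finally show ?thesis
    by (simp add: F_def q)
qed

section \<open>Empirical moments and the first-order expansion\<close>

lemma avg_add: "avg n (\<lambda>i. f i + g i) = avg n f + avg n g"
  by (simp add: avg_def sum.distrib add_divide_distrib)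

lemma avg_diff: "avg n (\<lambda>i. f i - g i) = avg n f - avg n g"
  by (simp add: avg_def sum_subtractf diff_divide_distrib)

lemma avg_mult_left: "avg n (\<lambda>i. c * f i) = c * avg n f"
  by (simp add: avg_def sum_distrib_left)

lemma avg_sum: "avg n (\<lambda>i. \<Sum>k\<in>K. f k i) = (\<Sum>k\<in>K. avg n (f k))"
  unfolding avg_def by (subst sum.swap) (simp add: sum_divide_distrib)

lemma avg_cong: "(\<And>i. i < n \<Longrightarrow> f i = g i) \<Longrightarrow> avg n f = avg n g"
  by (simp add: avg_def)

lemma avg_abs_le:
  assumes "\<And>i. i < n \<Longrightarrow> \<bar>f i\<bar> \<le> c" "0 \<le> c"
  shows "\<bar>avg n f\<bar> \<le> c"
proof (cases "n = 0")
  case False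
  have "\<bar>\<Sum>i<n. f i\<bar> \<le> (\<Sum>i<n. c)"
    by (rule order_trans[OF sum_abs], rule sum_mono) (simp add: assms)
  with False show ?thesis
    by (simp add: avg_def divide_simps mult.commute)
qed (simp add: avg_def assms)

text \<open>The fourth moments of the uniform distribution on the unit sphere.\<close>
definition iso4 :: "real^'n \<Rightarrow> real^'n \<Rightarrow> real^'n \<Rightarrow> real^'n \<Rightarrow> real" where
  "iso4 a b c d = ((a \<bullet> b) * (c \<bullet> d) + (a \<bullet> c) * (b \<bullet> d) + (a \<bullet> d) * (b \<bullet> c))
    / (real CARD('n) * (real CARD('n) + 2))"

text \<open>Stated for arbitrary vectors rather than coordinatewise, so that it can be used in any
  orthonormal basis. Second moments need no separate control: for unit vectors they are contractions
  of the fourth ones.\<close>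

definition near_iso4 :: "real \<Rightarrow> nat \<Rightarrow> (nat \<Rightarrow> real^'n) \<Rightarrow> bool" where
  "near_iso4 \<delta> n y \<longleftrightarrow> (\<forall>a b c d.
     \<bar>avg n (\<lambda>i. (a \<bullet> y i) * (b \<bullet> y i) * (c \<bullet> y i) * (d \<bullet> y i)) - iso4 a b c d\<bar>
       \<le> \<delta> * (norm a * norm b * norm c * norm d))"

definition op_le :: "real^'n^'n \<Rightarrow> real \<Rightarrow> bool" where
  "op_le D d \<longleftrightarrow> (\<forall>x y. \<bar>x \<bullet> (D *v y)\<bar> \<le> d * (norm x * norm y))"

lemma op_le_inner: "op_le D d \<Longrightarrow> \<bar>x \<bullet> (D *v y)\<bar> \<le> d * (norm x * norm y)"
  by (simp add: op_le_def)


lemma op_leI: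
  assumes "\<And>x. norm (D *v x) \<le> d * norm x" shows "op_le D d"
  unfolding op_le_def
proof (intro allI)
  fix x y
  have "\<bar>x \<bullet> (D *v y)\<bar> \<le> norm x * norm (D *v y)"
    by (rule Cauchy_Schwarz_ineq2)
  also have "\<dots> \<le> norm x * (d * norm y)"
    by (intro mult_left_mono assms) auto
  finally show "\<bar>x \<bullet> (D *v y)\<bar> \<le> d * (norm x * norm y)"
    by (simp add: mult_ac)
qed

lemma op_le_nonneg:
  assumes "op_le (D :: real^'n^'n) d" shows "0 \<le> d"
proof -
  have "0 \<le> \<bar>axis undefined 1 \<bullet> (D *v axis undefined 1)\<bar>"
    by simp
  also have "\<dots> \<le> d * (norm (axis undefined 1 :: real^'n) * norm (axis undefined 1 :: real^'n))"
    by (rule op_le_inner[OF assms])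
  finally show ?thesis
    by simp
qed

lemma op_le_norm:
  assumes "op_le D d" shows "norm (D *v x) \<le> d * norm x"
proof -
  have "norm (D *v x) * norm (D *v x) \<le> norm (D *v x) * (d * norm x)"
    using op_le_inner[OF assms, of "D *v x" x] by (simp add: dot_square_norm power2_eq_square mult_ac)
  then show ?thesis
    using op_le_nonneg[OF assms] by (cases "D *v x = 0") auto
qed

lemma op_le_transpose:
  assumes "op_le D d" shows "op_le (transpose D) d"
  unfolding op_le_def
proof (intro allI)
  fix x y
  have "x \<bullet> (transpose D *v y) = y \<bullet> (D *v x)"
    using transpose_mult_inner[of D y x] by (simp add: inner_commute)
  then show "\<bar>x \<bullet> (transpose D *v y)\<bar> \<le> d * (norm x * norm y)"
    using op_le_inner[OF assms, of y x] by (simp add: mult_ac)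
qed

lemma mult_vec_nth: "(D *v y) $ k = D $ k \<bullet> (y :: real^'n)"
  by (simp add: matrix_vector_mult_def inner_vec_def)

lemma op_le_row:
  assumes "op_le D d" shows "norm (D $ k) \<le> d"
proof -
  have "(norm (D $ k))\<^sup>2 = \<bar>axis k 1 \<bullet> (D *v (D $ k))\<bar>"
    by (simp add: inner_axis' mult_vec_nth power2_norm_eq_inner)
  also have "\<dots> \<le> d * norm (D $ k)"
    using op_le_inner[OF assms, of "axis k 1" "D $ k"] by simp
  finally show ?thesis
    using op_le_nonneg[OF assms] by (cases "D $ k = 0") (auto simp: power2_eq_square)
qed

lemma near_iso4_nonneg:
  assumes "near_iso4 \<delta> n (y :: nat \<Rightarrow> real^'n)" shows "0 \<le> \<delta>"
proof -
  let ?e = "axis undefined 1 :: real^'n"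
  have "0 \<le> \<bar>avg n (\<lambda>i. (?e \<bullet> y i) * (?e \<bullet> y i) * (?e \<bullet> y i) * (?e \<bullet> y i)) - iso4 ?e ?e ?e ?e\<bar>"
    by simp
  also have "\<dots> \<le> \<delta> * (norm ?e * norm ?e * norm ?e * norm ?e)"
    using assms unfolding near_iso4_def by blast
  finally show ?thesis
    by simp
qed

context
  fixes y :: "nat \<Rightarrow> real^'n" and n :: nat and \<delta> :: real
  assumes iso: "near_iso4 \<delta> n y" and unit: "\<And>i. i < n \<Longrightarrow> norm (y i) = 1"
begin

text \<open>Insert 1 = |y|^2 as a sum over the coordinate axes: each contraction contributes one
  error \<delta>, and the contracted main terms add up to (p + 2) (a . b) / (p (p + 2)).\<close>

lemma near_iso4_second_moment:
  "\<bar>avg n (\<lambda>i. (a \<bullet> y i) * (b \<bullet> y i)) - (a \<bullet> b) / real CARD('n)\<bar>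
     \<le> real CARD('n) * \<delta> * (norm a * norm b)"
proof -
  let ?F = "\<lambda>k. avg n (\<lambda>i. (a \<bullet> y i) * (b \<bullet> y i) * (axis k 1 \<bullet> y i) * (axis k 1 \<bullet> y i))"
  let ?p = "real CARD('n)"
  have "avg n (\<lambda>i. (a \<bullet> y i) * (b \<bullet> y i)) = (\<Sum>k\<in>UNIV. ?F k)"
    unfolding avg_sum[symmetric]
  proof (rule avg_cong)
    fix i assume "i < n"
    then have "(\<Sum>k\<in>UNIV. (y i $ k) * (y i $ k)) = 1"
      using unit[of i] by (simp add: norm_eq_1 inner_vec_def)
    then show "(a \<bullet> y i) * (b \<bullet> y i) =
        (\<Sum>k\<in>UNIV. (a \<bullet> y i) * (b \<bullet> y i) * (axis k 1 \<bullet> y i) * (axis k 1 \<bullet> y i))"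
      by (simp add: inner_axis' mult.assoc flip: sum_distrib_left)
  qed
  moreover have "(\<Sum>k\<in>UNIV. iso4 a b (axis k 1) (axis k 1)) = (a \<bullet> b) / ?p"
  proof -
    have ab: "(\<Sum>k\<in>UNIV. a $ k * b $ k) = a \<bullet> b"
      by (simp add: inner_vec_def)
    have "(\<Sum>k\<in>UNIV. iso4 a b (axis k 1) (axis k 1))
        = (?p * (a \<bullet> b) + 2 * (\<Sum>k\<in>UNIV. a $ k * b $ k)) / (?p * (?p + 2))"
      by (simp add: iso4_def inner_axis sum.distrib sum_distrib_left flip: sum_divide_distrib)
    also have "\<dots> = ((?p + 2) * (a \<bullet> b)) / (?p * (?p + 2))"
      by (simp only: ab ring_distribs)
    finally show ?thesis
      by simp
  qed
  moreover have "\<bar>(\<Sum>k\<in>UNIV. ?F k - iso4 a b (axis k 1) (axis k 1))\<bar> \<le> (\<Sum>k\<in>(UNIV::'n set). \<delta> * (norm a * norm b))"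
  proof (rule order_trans[OF sum_abs], rule sum_mono)
    fix k :: 'n
    show "\<bar>?F k - iso4 a b (axis k 1) (axis k 1)\<bar> \<le> \<delta> * (norm a * norm b)"
      using iso[unfolded near_iso4_def, rule_format, of a b "axis k 1" "axis k 1"] by simp
  qed
  ultimately show ?thesis
    by (simp add: sum_subtractf mult.assoc)
qed

text \<open>The quadratic factor y . D y is the sum over \<open>k\<close> of y_k times (row
  \<open>k\<close> of \<open>D\<close>) . y, a product of two linear forms, and the rows have norm
  at most \<open>d\<close>.\<close>

lemma near_iso4_fourth_moment:
  assumes D: "op_le D d"
  shows "\<bar>avg n (\<lambda>i. (a \<bullet> y i) * (b \<bullet> y i) * (y i \<bullet> (D *v y i))) -
      ((a \<bullet> b) * trace D + a \<bullet> (D *v b) + b \<bullet> (D *v a)) / (real CARD('n) * (real CARD('n) + 2))\<bar>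
     \<le> real CARD('n) * \<delta> * d * (norm a * norm b)"
proof -
  let ?F = "\<lambda>k. avg n (\<lambda>i. (a \<bullet> y i) * (b \<bullet> y i) * (axis k 1 \<bullet> y i) * (D $ k \<bullet> y i))"
  let ?p = "real CARD('n)"
  have "avg n (\<lambda>i. (a \<bullet> y i) * (b \<bullet> y i) * (y i \<bullet> (D *v y i))) = (\<Sum>k\<in>UNIV. ?F k)"
    unfolding avg_sum[symmetric]
    by (rule avg_cong)
       (simp add: inner_axis' mult.assoc inner_vec_def[of _ "D *v _"] mult_vec_nth flip: sum_distrib_left)
  moreover have "(\<Sum>k\<in>UNIV. iso4 a b (axis k 1) (D $ k)) =
      ((a \<bullet> b) * trace D + a \<bullet> (D *v b) + b \<bullet> (D *v a)) / (?p * (?p + 2))"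
    by (simp add: iso4_def inner_axis inner_axis' sum.distrib trace_def sum_distrib_left
        inner_vec_def[of _ "D *v _"] mult_vec_nth inner_commute[of _ "D $ _"] mult_ac
        flip: sum_divide_distrib)
  moreover have "\<bar>(\<Sum>k\<in>UNIV. ?F k - iso4 a b (axis k 1) (D $ k))\<bar> \<le> (\<Sum>k\<in>(UNIV::'n set). \<delta> * d * (norm a * norm b))"
  proof (rule order_trans[OF sum_abs], rule sum_mono)
    fix k :: 'n
    have "\<bar>?F k - iso4 a b (axis k 1) (D $ k)\<bar> \<le> \<delta> * (norm a * norm b) * norm (D $ k)"
      using iso[unfolded near_iso4_def, rule_format, of a b "axis k 1" "D $ k"] by (simp add: mult_ac)
    also have "\<dots> \<le> \<delta> * (norm a * norm b) * d"
      by (intro mult_left_mono op_le_row[OF D] mult_nonneg_nonneg near_iso4_nonneg[OF iso]) auto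
    finally show "\<bar>?F k - iso4 a b (axis k 1) (D $ k)\<bar> \<le> \<delta> * d * (norm a * norm b)"
      by (simp add: mult_ac)
  qed
  ultimately show ?thesis
    by (simp add: sum_subtractf mult.assoc)
qed

end

section \<open>Taylor expansion of normalised products and of the scatter\<close>

lemma abs_mult_le: "\<bar>x\<bar> \<le> a \<Longrightarrow> \<bar>y\<bar> \<le> b \<Longrightarrow> \<bar>x * y\<bar> \<le> a * (b::real)"
  by (simp add: abs_mult mult_mono)

lemma abs_inner_le: "norm x \<le> s \<Longrightarrow> norm y \<le> t \<Longrightarrow> \<bar>x \<bullet> y\<bar> \<le> s * t"
  by (meson Cauchy_Schwarz_ineq2 mult_mono norm_ge_zero order_trans)

lemma norm_perturbed_ge:
  "norm (z :: 'a::real_normed_vector) = 1 \<Longrightarrow> norm h \<le> d \<Longrightarrow> 1 - d \<le> norm (z + h)"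
  using norm_diff_triangle_ineq[of z h 0 0] norm_triangle_ineq2[of z "- h"] by simp

lemma normalized_product_expansion:
  fixes z h a b :: "'a::real_inner"
  assumes z: "norm z = 1" and h: "norm h \<le> d" and d: "d \<le> 1/4"
  shows "\<bar>(a \<bullet> (z + h)) * (b \<bullet> (z + h)) / (norm (z + h))\<^sup>2 -
      ((a \<bullet> z) * (b \<bullet> z) + ((a \<bullet> h) * (b \<bullet> z) + (a \<bullet> z) * (b \<bullet> h)) - 2 * ((a \<bullet> z) * (b \<bullet> z) * (z \<bullet> h)))\<bar>
    \<le> 20 * d\<^sup>2 * (norm a * norm b)"
proof -
  have d0: "0 \<le> d"
    using h norm_ge_zero order_trans by blast
  define P0 P1 P2 t q where "P0 = (a \<bullet> z) * (b \<bullet> z)" and "P1 = (a \<bullet> h) * (b \<bullet> z) + (a \<bullet> z) * (b \<bullet> h)"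
    and "P2 = (a \<bullet> h) * (b \<bullet> h)" and "t = z \<bullet> h" and "q = h \<bullet> h"
  note defs = this
  define M N where "M = norm a * norm b" and "N = (norm (z + h))\<^sup>2"
  have M0: "0 \<le> M"
    by (simp add: M_def)
  have az: "\<bar>a \<bullet> z\<bar> \<le> norm a" "\<bar>b \<bullet> z\<bar> \<le> norm b" "\<bar>a \<bullet> h\<bar> \<le> norm a * d" "\<bar>b \<bullet> h\<bar> \<le> norm b * d"
    using abs_inner_le[of a "norm a" z 1] abs_inner_le[of b "norm b" z 1]
      abs_inner_le[of a "norm a" h d] abs_inner_le[of b "norm b" h d] z h by auto
  have P0: "\<bar>P0\<bar> \<le> M"
    unfolding P0_def M_def by (intro abs_mult_le az)
  have "\<bar>(a \<bullet> h) * (b \<bullet> z)\<bar> \<le> norm a * d * norm b" "\<bar>(a \<bullet> z) * (b \<bullet> h)\<bar> \<le> norm a * (norm b * d)"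
    by (intro abs_mult_le az)+
  then have P1: "\<bar>P1\<bar> \<le> 2 * d * M"
    unfolding P1_def M_def by (simp add: mult_ac)
  have "\<bar>P2\<bar> \<le> (norm a * d) * (norm b * d)"
    unfolding P2_def by (intro abs_mult_le az)
  then have P2: "\<bar>P2\<bar> \<le> d\<^sup>2 * M"
    unfolding M_def by (simp add: mult_ac power2_eq_square)
  have t: "\<bar>t\<bar> \<le> d"
    unfolding t_def using abs_inner_le[of z 1 h d] z h by simp
  have q: "\<bar>q\<bar> \<le> d\<^sup>2"
    unfolding q_def using abs_inner_le[OF h h] by (simp add: power2_eq_square)
  have N: "N = 1 + 2 * t + q"
    using z unfolding N_def defs power2_norm_eq_inner
    by (simp add: inner_simps inner_commute[of h z] norm_eq_1)
  have "3/4 \<le> norm (z + h)"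
    using norm_perturbed_ge[OF z h] d by simp
  then have "(3/4)\<^sup>2 \<le> N"
    unfolding N_def by (rule power_mono) simp
  then have N9: "9/16 \<le> N"
    by (simp add: power2_eq_square)
  have num: "(a \<bullet> (z + h)) * (b \<bullet> (z + h)) = P0 + P1 + P2"
    by (simp add: P0_def P1_def P2_def inner_add_right algebra_simps)
  have dd: "d\<^sup>2 \<le> d / 4"
    using mult_left_mono[OF d d0] by (simp add: power2_eq_square)
  have "\<bar>2 * t * P0\<bar> \<le> 2 * d * M"
    using abs_mult_le[OF t P0] by (simp add: abs_mult)
  then have "\<bar>P1 - 2 * t * P0\<bar> \<le> 2 * d * M + 2 * d * M"
    using P1 abs_triangle_ineq4[of P1 "2 * t * P0"] by linarith
  then have "\<bar>P1 - 2 * t * P0\<bar> \<le> 4 * d * M"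
    by linarith
  moreover have "\<bar>2 * t + q\<bar> \<le> 9/4 * d"
    using t q dd by linarith
  ultimately have "\<bar>(2 * t + q) * (P1 - 2 * t * P0)\<bar> \<le> 9/4 * d * (4 * d * M)"
    by (intro abs_mult_le)
  moreover have "\<bar>q * P0\<bar> \<le> d\<^sup>2 * M"
    using abs_mult_le[OF q P0] .
  moreover have "9/4 * d * (4 * d * M) = 9 * (d\<^sup>2 * M)"
    by (simp add: power2_eq_square)
  ultimately have "\<bar>P2 - q * P0 - (2 * t + q) * (P1 - 2 * t * P0)\<bar> \<le> 11 * (d\<^sup>2 * M)"
    using P2 by linarith
  \<comment> \<open>Multiply the proposed expansion by N = 1 + 2 t + q and subtract: the terms of
    order 0 and 1 cancel, and the rest is bounded by (1 + 1 + 9) d^2 M.\<close>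
  moreover have "(P0 + P1 + P2) / N - (P0 + P1 - 2 * (P0 * t)) =
      (P2 - q * P0 - (2 * t + q) * (P1 - 2 * t * P0)) / N"
    using N9 by (simp add: divide_simps) (simp add: N algebra_simps power2_eq_square)
  \<comment> \<open>Since N >= 9/16, 1 / N <= 16/9 <= 20/11, which turns the 11 into 20.\<close>
  moreover have "X / N \<le> 20 / 11 * X" if "0 \<le> X" for X
  proof -
    have "X \<le> 20 / 11 * (X * N)"
      using mult_left_mono[OF N9 that] that by linarith
    then show ?thesis
      using N9 by (simp add: divide_le_eq mult.assoc)
  qed
  moreover define Y where "Y = P2 - q * P0 - (2 * t + q) * (P1 - 2 * t * P0)"
  ultimately have "\<bar>(P0 + P1 + P2) / N - (P0 + P1 - 2 * (P0 * t))\<bar> = \<bar>Y\<bar> / N" "\<bar>Y\<bar> / N \<le> 20 / 11 * \<bar>Y\<bar>"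
    "\<bar>Y\<bar> \<le> 11 * (d\<^sup>2 * M)"
    using N9 by simp_all
  then have "\<bar>(P0 + P1 + P2) / N - (P0 + P1 - 2 * (P0 * t))\<bar> \<le> 20 * (d\<^sup>2 * M)"
    by linarith
  then show ?thesis
    unfolding num N_def P0_def P1_def t_def M_def by (simp only: mult.assoc)
qed

text \<open>The linear terms average to 1/p times the bilinear forms by the second moments; the
  normalising term takes away 2/(p (p + 2)) of them by the fourth moments, and 1/p - 2/(p (p + 2)) =
  1/(p + 2). The second moment of \<open>y\<close> itself stays unexpanded: it is exact in
  \<open>T_n_L_n_difference\<close> and only approximate in
  \<open>isotropic_transform_exists\<close>. The 4 counts two second-moment errors and one
  fourth-moment error taken twice.\<close>

lemma perturbed_scatter_expansion:
  fixes y :: "nat \<Rightarrow> real^'n"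
  assumes iso: "near_iso4 \<delta> n y" and unit: "\<And>i. i < n \<Longrightarrow> norm (y i) = 1"
    and D: "op_le D d" and d: "d \<le> 1/4"
  shows "\<bar>avg n (\<lambda>i. (a \<bullet> (y i + D *v y i)) * (b \<bullet> (y i + D *v y i)) / (norm (y i + D *v y i))\<^sup>2)
      - (avg n (\<lambda>i. (a \<bullet> y i) * (b \<bullet> y i)) + (a \<bullet> (D *v b) + b \<bullet> (D *v a)) / (real CARD('n) + 2)
         - 2 * (a \<bullet> b) * trace D / (real CARD('n) * (real CARD('n) + 2)))\<bar>
     \<le> (20 * d\<^sup>2 + 4 * real CARD('n) * \<delta> * d) * (norm a * norm b)"
proof -
  define p where "p = real CARD('n)"
  have p: "p > 0"
    by (simp add: p_def)
  have \<delta>: "0 \<le> \<delta>"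
    using near_iso4_nonneg[OF iso] .
  have d0: "0 \<le> d"
    using op_le_nonneg[OF D] .
  define X where "X i = (a \<bullet> (y i + D *v y i)) * (b \<bullet> (y i + D *v y i)) / (norm (y i + D *v y i))\<^sup>2" for i
  define E where "E i = (a \<bullet> y i) * (b \<bullet> y i) + ((a \<bullet> (D *v y i)) * (b \<bullet> y i) + (a \<bullet> y i) * (b \<bullet> (D *v y i)))
      - 2 * ((a \<bullet> y i) * (b \<bullet> y i) * (y i \<bullet> (D *v y i)))" for i
  have 1: "\<bar>avg n X - avg n E\<bar> \<le> 20 * d\<^sup>2 * (norm a * norm b)"
    unfolding avg_diff[symmetric] X_def E_def
  proof (intro avg_abs_le normalized_product_expansion)
    fix i assume "i < n"
    then show "norm (D *v y i) \<le> d"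
      using op_le_norm[OF D, of "y i"] unit by simp
  qed (use unit d in auto)
  have E: "avg n E = avg n (\<lambda>i. (a \<bullet> y i) * (b \<bullet> y i))
      + (avg n (\<lambda>i. (a \<bullet> (D *v y i)) * (b \<bullet> y i)) + avg n (\<lambda>i. (a \<bullet> y i) * (b \<bullet> (D *v y i))))
      - 2 * avg n (\<lambda>i. (a \<bullet> y i) * (b \<bullet> y i) * (y i \<bullet> (D *v y i)))"
    unfolding E_def by (simp add: avg_add avg_diff avg_mult_left)
  have sec: "\<bar>avg n (\<lambda>i. (u \<bullet> (D *v y i)) * (v \<bullet> y i)) - (u \<bullet> (D *v v)) / p\<bar> \<le> p * \<delta> * d * (norm u * norm v)" for u v
  proof -
    have "\<bar>avg n (\<lambda>i. ((transpose D *v u) \<bullet> y i) * (v \<bullet> y i)) - ((transpose D *v u) \<bullet> v) / p\<bar>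
       \<le> p * \<delta> * (norm (transpose D *v u) * norm v)"
      unfolding p_def by (rule near_iso4_second_moment[OF iso unit])
    also have "\<dots> \<le> p * \<delta> * ((d * norm u) * norm v)"
      using p \<delta> by (intro mult_left_mono mult_right_mono op_le_norm op_le_transpose D) auto
    finally show ?thesis
      unfolding transpose_mult_inner by (simp add: mult_ac)
  qed
  have 2: "\<bar>avg n (\<lambda>i. (a \<bullet> (D *v y i)) * (b \<bullet> y i)) - (a \<bullet> (D *v b)) / p\<bar> \<le> p * \<delta> * d * (norm a * norm b)"
    by (rule sec)
  have 3: "\<bar>avg n (\<lambda>i. (a \<bullet> y i) * (b \<bullet> (D *v y i))) - (b \<bullet> (D *v a)) / p\<bar> \<le> p * \<delta> * d * (norm a * norm b)"
    using sec[of b a] by (simp add: mult_ac)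
  have 4: "\<bar>avg n (\<lambda>i. (a \<bullet> y i) * (b \<bullet> y i) * (y i \<bullet> (D *v y i))) -
      ((a \<bullet> b) * trace D + a \<bullet> (D *v b) + b \<bullet> (D *v a)) / (p * (p + 2))\<bar> \<le> p * \<delta> * d * (norm a * norm b)"
    unfolding p_def by (rule near_iso4_fourth_moment[OF iso unit D])
  have "(a \<bullet> (D *v b)) / p + (b \<bullet> (D *v a)) / p
      - 2 * (((a \<bullet> b) * trace D + a \<bullet> (D *v b) + b \<bullet> (D *v a)) / (p * (p + 2)))
     = (a \<bullet> (D *v b) + b \<bullet> (D *v a)) / (p + 2) - 2 * (a \<bullet> b) * trace D / (p * (p + 2))"
    using p by (simp add: divide_simps) (simp add: algebra_simps)
  then have "\<bar>avg n X - (avg n (\<lambda>i. (a \<bullet> y i) * (b \<bullet> y i)) + (a \<bullet> (D *v b) + b \<bullet> (D *v a)) / (p + 2)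
         - 2 * (a \<bullet> b) * trace D / (p * (p + 2)))\<bar>
     \<le> 20 * d\<^sup>2 * (norm a * norm b) + 4 * (p * \<delta> * d * (norm a * norm b))"
    using 1 2 3 4 unfolding E abs_le_iff by linarith
  then show ?thesis
    unfolding X_def p_def by (simp add: algebra_simps)
qed

text \<open>The four factors are replaced one at a time, each at the cost \<open>r\<close>.\<close>

lemma near_iso4_perturb:
  fixes w :: "nat \<Rightarrow> real^'n"
  assumes iso: "near_iso4 \<delta> n w" and unit: "\<And>i. i < n \<Longrightarrow> norm (w i) = 1"
    and yu: "\<And>i. i < n \<Longrightarrow> norm (y i) = 1" and yw: "\<And>i. i < n \<Longrightarrow> norm (y i - w i) \<le> r"
    and r: "0 \<le> r"
  shows "near_iso4 (\<delta> + 4 * r) n y"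
  unfolding near_iso4_def
proof (intro allI)
  fix a b c d :: "real^'n"
  let ?M = "norm a * norm b * norm c * norm d"
  have "\<bar>avg n (\<lambda>i. (a \<bullet> y i) * (b \<bullet> y i) * (c \<bullet> y i) * (d \<bullet> y i)) -
      avg n (\<lambda>i. (a \<bullet> w i) * (b \<bullet> w i) * (c \<bullet> w i) * (d \<bullet> w i))\<bar> \<le> 4 * r * ?M"
    unfolding avg_diff[symmetric]
  proof (rule avg_abs_le)
    fix i assume i: "i < n"
    have y: "\<bar>x \<bullet> y i\<bar> \<le> norm x" and w: "\<bar>x \<bullet> w i\<bar> \<le> norm x" and d: "\<bar>x \<bullet> (y i - w i)\<bar> \<le> norm x * r" for x
      using abs_inner_le[of x "norm x" "y i" 1] abs_inner_le[of x "norm x" "w i" 1]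
        abs_inner_le[of x "norm x" "y i - w i" r] unit[OF i] yu[OF i] yw[OF i] by auto
    have "(a \<bullet> y i) * (b \<bullet> y i) * (c \<bullet> y i) * (d \<bullet> y i) - (a \<bullet> w i) * (b \<bullet> w i) * (c \<bullet> w i) * (d \<bullet> w i)
      = (a \<bullet> (y i - w i)) * (b \<bullet> y i) * (c \<bullet> y i) * (d \<bullet> y i) + (a \<bullet> w i) * (b \<bullet> (y i - w i)) * (c \<bullet> y i) * (d \<bullet> y i)
      + (a \<bullet> w i) * (b \<bullet> w i) * (c \<bullet> (y i - w i)) * (d \<bullet> y i) + (a \<bullet> w i) * (b \<bullet> w i) * (c \<bullet> w i) * (d \<bullet> (y i - w i))"
      by (simp add: inner_diff_right algebra_simps)
    moreover have "\<bar>(a \<bullet> (y i - w i)) * (b \<bullet> y i) * (c \<bullet> y i) * (d \<bullet> y i)\<bar> \<le> norm a * r * norm b * norm c * norm d"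
      "\<bar>(a \<bullet> w i) * (b \<bullet> (y i - w i)) * (c \<bullet> y i) * (d \<bullet> y i)\<bar> \<le> norm a * (norm b * r) * norm c * norm d"
      "\<bar>(a \<bullet> w i) * (b \<bullet> w i) * (c \<bullet> (y i - w i)) * (d \<bullet> y i)\<bar> \<le> norm a * norm b * (norm c * r) * norm d"
      "\<bar>(a \<bullet> w i) * (b \<bullet> w i) * (c \<bullet> w i) * (d \<bullet> (y i - w i))\<bar> \<le> norm a * norm b * norm c * (norm d * r)"
      by (intro abs_mult_le y w d)+
    ultimately show "\<bar>(a \<bullet> y i) * (b \<bullet> y i) * (c \<bullet> y i) * (d \<bullet> y i) -
        (a \<bullet> w i) * (b \<bullet> w i) * (c \<bullet> w i) * (d \<bullet> w i)\<bar> \<le> 4 * r * ?M"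
      unfolding abs_le_iff by (simp add: mult_ac)
  qed (use r in auto)
  moreover have "\<bar>avg n (\<lambda>i. (a \<bullet> w i) * (b \<bullet> w i) * (c \<bullet> w i) * (d \<bullet> w i)) - iso4 a b c d\<bar> \<le> \<delta> * ?M"
    using iso unfolding near_iso4_def by blast
  ultimately show "\<bar>avg n (\<lambda>i. (a \<bullet> y i) * (b \<bullet> y i) * (c \<bullet> y i) * (d \<bullet> y i)) - iso4 a b c d\<bar> \<le> (\<delta> + 4 * r) * ?M"
    unfolding ring_distribs by linarith
qed

text \<open>One \<open>r\<close> is the displacement \<open>h\<close>; the other is the radial
  correction, since the length of w + h differs from 1 by at most \<open>r\<close>.\<close>

lemma norm_normalized_perturbed:
  fixes w :: "'a::real_normed_vector"
  assumes "norm w = 1" "norm h \<le> r" "r < 1"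
  shows "norm ((w + h) /\<^sub>R norm (w + h) - w) \<le> 2 * r"
proof -
  have n: "1 - r \<le> norm (w + h)" "norm (w + h) \<le> 1 + r"
    using norm_perturbed_ge[OF assms(1,2)] norm_triangle_ineq[of w h] assms by auto
  then have pos: "norm (w + h) > 0"
    using assms(3) by linarith
  have "(w + h) /\<^sub>R norm (w + h) - (w + h) = (1 / norm (w + h) - 1) *\<^sub>R (w + h)"
    by (simp add: scaleR_diff_left divide_inverse)
  then have "norm ((w + h) /\<^sub>R norm (w + h) - (w + h)) = \<bar>1 / norm (w + h) - 1\<bar> * norm (w + h)"
    by simp
  also have "\<dots> = \<bar>1 - norm (w + h)\<bar>"
    using pos by (simp add: abs_if divide_simps split: if_splits)
  also have "\<dots> \<le> r"
    using n by linarith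
  finally have "norm ((w + h) /\<^sub>R norm (w + h) - (w + h)) \<le> r" .
  then show ?thesis
    using norm_triangle_ineq[of "(w + h) /\<^sub>R norm (w + h) - (w + h)" h] assms(2) by simp
qed

section \<open>Existence and uniqueness of Tyler's estimator\<close>

lemma norm_sq_cart: "(norm (x :: 'a::real_normed_vector^'n))\<^sup>2 = (\<Sum>k\<in>UNIV. (norm (x $ k))\<^sup>2)"
  by (simp add: norm_vec_def L2_set_def sum_nonneg)

text \<open>The norm of a matrix is here the Frobenius norm, which dominates the operator norm.
  Hence a norm ball of matrices, compact and convex as Brouwer's theorem requires, also yields
  \<open>op_le\<close>.\<close>

lemma norm_mult_vec_le: "norm (H *v x) \<le> norm (H :: real^'n^'m) * norm x"
proof -
  have "(norm (H *v x))\<^sup>2 = (\<Sum>k\<in>UNIV. ((H *v x) $ k)\<^sup>2)"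
    by (simp add: norm_sq_cart)
  also have "\<dots> \<le> (\<Sum>k\<in>UNIV. (norm (H $ k) * norm x)\<^sup>2)"
  proof (rule sum_mono)
    fix k
    have "\<bar>(H *v x) $ k\<bar> \<le> norm (H $ k) * norm x"
      unfolding mult_vec_nth by (rule Cauchy_Schwarz_ineq2)
    then show "((H *v x) $ k)\<^sup>2 \<le> (norm (H $ k) * norm x)\<^sup>2"
      by (metis abs_ge_zero power2_abs power_mono)
  qed
  also have "\<dots> = (norm H * norm x)\<^sup>2"
    by (simp add: power_mult_distrib norm_sq_cart[of H] flip: sum_distrib_right)
  finally show ?thesis
    by (rule power2_le_imp_le) simp
qed

lemma norm_matrix_le_l1: "norm (M :: real^'n^'m) \<le> (\<Sum>k\<in>UNIV. \<Sum>l\<in>UNIV. \<bar>M $ k $ l\<bar>)"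
proof -
  have "norm M \<le> (\<Sum>k\<in>UNIV. norm (M $ k))"
    by (simp add: norm_vec_def L2_set_le_sum)
  also have "\<dots> \<le> (\<Sum>k\<in>UNIV. \<Sum>l\<in>UNIV. \<bar>M $ k $ l\<bar>)"
    by (intro sum_mono norm_le_l1_cart)
  finally show ?thesis .
qed

text \<open>Scatter of the directions of \<open>(I + H) w\<close>.\<close>
definition scatter :: "nat \<Rightarrow> (nat \<Rightarrow> real^'n) \<Rightarrow> real^'n^'n \<Rightarrow> real^'n^'n" where
  "scatter n w H = (1 / real n) *\<^sub>R (\<Sum>i<n. (1 / (norm (w i + H *v w i))\<^sup>2) *\<^sub>R
     outer (w i + H *v w i) (w i + H *v w i))"

lemma scatter_form:
  "a \<bullet> (scatter n w H *v b) =
    avg n (\<lambda>i. (a \<bullet> (w i + H *v w i)) * (b \<bullet> (w i + H *v w i)) / (norm (w i + H *v w i))\<^sup>2)"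
  unfolding scatter_def avg_def matrix_scaleR_mult_vec matrix_sum_mult_vec outer_mult_vec
    inner_scaleR_right inner_sum_right
  by (simp add: sum_divide_distrib inner_commute[of b] mult_ac flip: sum_distrib_left)

lemma sym_scatter: "sym_mat (scatter n w H)"
proof (rule sym_matI)
  fix x y show "x \<bullet> (scatter n w H *v y) = (scatter n w H *v x) \<bullet> y"
    unfolding inner_commute[of "_ *v x"] scatter_form by (simp add: mult_ac)
qed

lemma matrix_nth_form: "(M :: real^'n^'m) $ k $ l = axis k 1 \<bullet> (M *v axis l 1)"
  by (simp add: inner_axis' mult_vec_nth inner_axis)

text \<open>Every summand is the orthogonal projection onto a line and has trace 1. This keeps the
  map of \<open>isotropic_transform_exists\<close> among trace-free matrices.\<close>

lemma trace_scatter: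
  assumes "n > 0" "\<And>i. i < n \<Longrightarrow> w i + H *v w i \<noteq> 0"
  shows "trace (scatter n w H) = 1"
proof -
  have "trace (scatter n w H) = avg n (\<lambda>i. \<Sum>k\<in>UNIV. ((w i + H *v w i) $ k)\<^sup>2 / (norm (w i + H *v w i))\<^sup>2)"
    unfolding trace_def avg_sum matrix_nth_form[of "scatter n w H"] scatter_form
    by (simp add: inner_axis' power2_eq_square)
  also have "\<dots> = avg n (\<lambda>i. 1)"
  proof (rule avg_cong)
    fix i assume "i < n"
    then have "(norm (w i + H *v w i))\<^sup>2 \<noteq> 0"
      using assms(2) by simp
    moreover have "(\<Sum>k\<in>UNIV. ((w i + H *v w i) $ k)\<^sup>2) = (norm (w i + H *v w i))\<^sup>2"
      by (simp only: norm_sq_cart real_norm_def power2_abs)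
    ultimately show "(\<Sum>k\<in>UNIV. ((w i + H *v w i) $ k)\<^sup>2 / (norm (w i + H *v w i))\<^sup>2) = 1"
      unfolding sum_divide_distrib[symmetric] by (simp only: divide_self not_False_eq_True)
  qed
  finally show ?thesis
    using assms(1) by (simp add: avg_def)
qed

lemma continuous_on_outer:
  "continuous_on S f \<Longrightarrow> continuous_on S (\<lambda>x. outer (f x) (f x))"
  unfolding outer_def by (intro continuous_on_vec_lambda continuous_intros)

lemma continuous_on_mult_vec_left: "continuous_on S (\<lambda>H. (H :: real^'n^'m) *v x)"
proof -
  have "(\<lambda>H. (H :: real^'n^'m) *v x) = (\<lambda>H. \<chi> k. H $ k \<bullet> x)"
    by (auto simp: vec_eq_iff mult_vec_nth)
  then show ?thesis
    by (simp only:) (intro continuous_on_vec_lambda continuous_intros)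
qed

lemma continuous_on_scatter:
  assumes "\<And>H i. H \<in> S \<Longrightarrow> i < n \<Longrightarrow> w i + H *v w i \<noteq> 0"
  shows "continuous_on S (scatter n w)"
  unfolding scatter_def
  by (intro continuous_intros continuous_on_outer continuous_on_mult_vec_left) (use assms in auto)

lemma trace_scaleR: "trace (c *\<^sub>R (M :: real^'n^'n)) = c * trace M"
  by (simp add: trace_def sum_distrib_left)

lemma sym_mat_nth:
  assumes "sym_mat M" shows "M $ l $ k = M $ k $ l"
proof -
  have "M $ l $ k = transpose M $ k $ l"
    by (simp add: transpose_def)
  then show ?thesis
    using assms unfolding sym_mat_def by (simp only:)
qed

text \<open>For symmetric trace-free H the scatter is I/p + 2 H/(p + 2) up to small errors, so
  subtracting (p + 2)/2 times the defect is a Newton step with the limiting derivative. It maps the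
  symmetric trace-free matrices of norm at most \<open>r\<close> to themselves, and Brouwer's
  theorem then asks for continuity only, not for a Lipschitz estimate. The radius is such that the
  sampling error p \<delta> uses one half of it; \<open>small\<close> lets the quadratic error use
  the other.\<close>

lemma isotropic_transform_exists:
  fixes w :: "nat \<Rightarrow> real^'n"
  defines "p \<equiv> real CARD('n)"
  assumes iso: "near_iso4 \<delta> n w" and unit: "\<And>i. i < n \<Longrightarrow> norm (w i) = 1" and n: "n > 0"
    and r: "r = p ^ 3 * (p + 2) * \<delta>" and small: "24 * p\<^sup>2 * (p + 2) * r \<le> 1"
  shows "\<exists>H. sym_mat H \<and> op_le H r \<and> scatter n w H = (1 / p) *\<^sub>R mat 1"
proof -
  have p1: "p \<ge> 1"
    using zero_less_card_finite[where ?'a = 'n] unfolding p_def by linarith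
  have \<delta>: "\<delta> \<ge> 0"
    using near_iso4_nonneg[OF iso] .
  have r0: "r \<ge> 0"
    using p1 \<delta> by (simp add: r)
  have "1 * 1 * (1 + 2) * r * 24 \<le> p\<^sup>2 * (p + 2) * r * 24"
    using p1 r0 by (intro mult_mono) auto
  then have r4: "r \<le> 1/4"
    using small by (simp only: mult_ac) simp
  define K where "K = {H :: real^'n^'n. transpose H = H \<and> trace H = 0 \<and> norm H \<le> r}"
  define \<Psi> where "\<Psi> H = H - ((p + 2) / 2) *\<^sub>R (scatter n w H - (1 / p) *\<^sub>R mat 1)" for H
  have Keq: "K = cball 0 r \<inter> {H. transpose H = H} \<inter> {H. trace H = 0}"
    by (auto simp: K_def)
  have op: "op_le H r" if "H \<in> K" for H
    using that by (intro op_leI order_trans[OF norm_mult_vec_le] mult_right_mono) (auto simp: K_def)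
  have nz: "w i + H *v w i \<noteq> 0" if "H \<in> K" "i < n" for H i
  proof -
    have "1 - r \<le> norm (w i + H *v w i)"
      using op_le_norm[OF op[OF that(1)], of "w i"] unit[OF that(2)]
      by (intro norm_perturbed_ge) auto
    then show ?thesis
      using r4 by auto
  qed
  have "closed {H :: real^'n^'n. transpose H = H}"
    unfolding transpose_def by (intro closed_Collect_eq continuous_on_vec_lambda continuous_intros)
  moreover have "closed {H :: real^'n^'n. trace H = 0}"
    unfolding trace_def by (intro closed_Collect_eq continuous_intros)
  ultimately have "compact K"
    unfolding Keq by (intro compact_Int_closed compact_cball)
  moreover have "convex K"
    unfolding Keq
  proof (intro convex_Int convex_cball)
    show "convex {H :: real^'n^'n. transpose H = H}"
      by (rule convexI) (auto simp: transpose_def vec_eq_iff)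
    show "convex {H :: real^'n^'n. trace H = 0}"
      by (rule convexI) (simp add: trace_def sum.distrib flip: sum_distrib_left)
  qed
  moreover have "K \<noteq> {}"
    using r0 by (auto simp: K_def trace_def transpose_def vec_eq_iff intro!: exI[of _ 0])
  moreover have "continuous_on K \<Psi>"
    unfolding \<Psi>_def using nz by (intro continuous_intros continuous_on_scatter)
  moreover have "\<Psi> \<in> K \<rightarrow> K"
  proof
    fix H assume H: "H \<in> K"
    have trH: "trace H = 0" and symH: "sym_mat H"
      using H by (auto simp: K_def sym_mat_def)
    have Hsym: "H $ l $ k = H $ k $ l" for k l
      using symH by (rule sym_mat_nth)
    have "\<Psi> H $ l $ k = \<Psi> H $ k $ l" for k l
      using Hsym[of l k] sym_mat_nth[OF sym_scatter, of n w H l k] by (simp add: \<Psi>_def mat_def)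
    then have 1: "transpose (\<Psi> H) = \<Psi> H"
      unfolding transpose_def vec_eq_iff by simp
    have "trace (\<Psi> H) = trace H - ((p + 2) / 2) * (trace (scatter n w H) - (1 / p) * trace (mat 1 :: real^'n^'n))"
      unfolding \<Psi>_def trace_sub trace_scaleR ..
    then have 2: "trace (\<Psi> H) = 0"
      using p1 trH by (simp add: trace_scatter n nz H trace_I) (simp add: p_def)
    \<comment> \<open>An equal share of \<open>r\<close> for each of the p^2 entries suffices,
      because the norm is at most the sum of the absolute entries.\<close>
    have entry: "\<bar>\<Psi> H $ k $ l\<bar> \<le> r / p\<^sup>2" for k l
    proof -
      let ?a = "axis k 1 :: real^'n" and ?b = "axis l 1 :: real^'n"
      have "\<bar>?a \<bullet> (scatter n w H *v ?b) - (avg n (\<lambda>i. (?a \<bullet> w i) * (?b \<bullet> w i))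
          + (?a \<bullet> (H *v ?b) + ?b \<bullet> (H *v ?a)) / (p + 2) - 2 * (?a \<bullet> ?b) * trace H / (p * (p + 2)))\<bar>
         \<le> (20 * r\<^sup>2 + 4 * p * \<delta> * r) * (norm ?a * norm ?b)"
        unfolding scatter_form p_def
        by (rule perturbed_scatter_expansion[OF iso unit op[OF H] r4])
      moreover have "\<bar>avg n (\<lambda>i. (?a \<bullet> w i) * (?b \<bullet> w i)) - (?a \<bullet> ?b) / p\<bar> \<le> p * \<delta> * (norm ?a * norm ?b)"
        unfolding p_def by (rule near_iso4_second_moment[OF iso unit])
      ultimately have "\<bar>scatter n w H $ k $ l - ((?a \<bullet> ?b) / p + 2 * H $ k $ l / (p + 2))\<bar>
          \<le> 20 * r\<^sup>2 + 4 * p * \<delta> * r + p * \<delta>"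
        by (simp add: trH Hsym flip: matrix_nth_form)
      moreover have "?a \<bullet> ?b = (mat 1 :: real^'n^'n) $ k $ l"
        by (simp add: mat_def inner_axis_axis)
      \<comment> \<open>The summand H of the Newton step cancels the linear response of the scatter,
        so only the error of the expansion remains.\<close>
      moreover have "\<Psi> H $ k $ l = - ((p + 2) / 2) *
          (scatter n w H $ k $ l - ((mat 1 :: real^'n^'n) $ k $ l / p + 2 * H $ k $ l / (p + 2)))"
        using p1 unfolding \<Psi>_def by (simp add: divide_simps) (simp add: algebra_simps)
      ultimately have "\<bar>\<Psi> H $ k $ l\<bar> \<le> (p + 2) / 2 * (20 * r\<^sup>2 + 4 * p * \<delta> * r + p * \<delta>)"
        using p1 by (simp add: abs_mult mult_left_mono)
      also have "\<dots> \<le> r / p\<^sup>2"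
      proof -
        have "\<delta> * (4 * p) \<le> \<delta> * (4 * (p ^ 3 * (p + 2)))"
          using \<delta> p1 mult_mono[of p "p ^ 3" 1 "p + 2"] power_increasing[of 1 3 p]
          by (intro mult_left_mono) auto
        then have "4 * p * \<delta> \<le> 4 * r"
          unfolding r by (simp add: mult_ac)
        then have "(4 * p * \<delta>) * r \<le> (4 * r) * r"
          using r0 by (rule mult_right_mono)
        then have "20 * r\<^sup>2 + 4 * p * \<delta> * r + p * \<delta> \<le> 24 * r * r + p * \<delta>"
          by (simp add: power2_eq_square)
        then have "p\<^sup>2 * (p + 2) * (20 * r\<^sup>2 + 4 * p * \<delta> * r + p * \<delta>) \<le> p\<^sup>2 * (p + 2) * (24 * r * r + p * \<delta>)"
          using p1 by (intro mult_left_mono) auto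
        also have "\<dots> = (24 * p\<^sup>2 * (p + 2) * r) * r + r"
          unfolding r by (simp add: algebra_simps power2_eq_square power3_eq_cube)
        also have "\<dots> \<le> 2 * r"
          using mult_right_mono[OF small r0] by simp
        finally show ?thesis
          using p1 by (simp add: divide_simps mult_ac)
      qed
      finally show ?thesis .
    qed
    have "norm (\<Psi> H) \<le> (\<Sum>k\<in>(UNIV :: 'n set). \<Sum>l\<in>(UNIV :: 'n set). r / p\<^sup>2)"
      by (rule order_trans[OF norm_matrix_le_l1]) (intro sum_mono entry)
    also have "\<dots> = r"
      using p1 by (simp add: p_def power2_eq_square)
    finally show "\<Psi> H \<in> K"
      using 1 2 by (simp add: K_def)
  qed
  ultimately obtain H where H: "H \<in> K" "\<Psi> H = H"
    using brouwer by metis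
  have "scatter n w H = (1 / p) *\<^sub>R mat 1"
    using H(2) p1 by (auto simp: \<Psi>_def)
  with H op show ?thesis
    by (auto simp: K_def sym_mat_def)
qed

text \<open>If every w_i were orthogonal to \<open>a\<close> or to \<open>b\<close>, the moment with
  arguments a, a, b, b would vanish, while under the uniform law it is at least |a|^2 |b|^2 / (p (p
  + 2)). Uniqueness relies on this general position.\<close>

lemma near_iso4_no_splitting:
  fixes w :: "nat \<Rightarrow> real^'n"
  assumes iso: "near_iso4 \<delta> n w" and \<delta>: "\<delta> < 1 / (real CARD('n) * (real CARD('n) + 2))"
    and ab: "a \<noteq> 0" "b \<noteq> 0"
  shows "\<exists>i<n. a \<bullet> w i \<noteq> 0 \<and> b \<bullet> w i \<noteq> 0"
proof (rule ccontr)
  assume "\<not> ?thesis"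
  then have "avg n (\<lambda>i. (a \<bullet> w i) * (a \<bullet> w i) * (b \<bullet> w i) * (b \<bullet> w i)) = avg n (\<lambda>i. 0)"
    by (intro avg_cong) auto
  then have "avg n (\<lambda>i. (a \<bullet> w i) * (a \<bullet> w i) * (b \<bullet> w i) * (b \<bullet> w i)) = 0"
    by (simp only:) (simp add: avg_def)
  then have "iso4 a a b b \<le> \<delta> * (norm a * norm a * norm b * norm b)"
    using iso[unfolded near_iso4_def, rule_format, of a a b b] by simp
  moreover have "iso4 a a b b \<ge> 1 / (real CARD('n) * (real CARD('n) + 2)) * ((a \<bullet> a) * (b \<bullet> b))"
    by (simp add: iso4_def divide_right_mono)
  moreover have "norm a * norm a * norm b * norm b = (a \<bullet> a) * (b \<bullet> b)"
    by (simp add: dot_square_norm power2_eq_square)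
  ultimately have "1 / (real CARD('n) * (real CARD('n) + 2)) * ((a \<bullet> a) * (b \<bullet> b)) \<le> \<delta> * ((a \<bullet> a) * (b \<bullet> b))"
    by simp
  moreover have "(a \<bullet> a) * (b \<bullet> b) > 0"
    using ab by simp
  ultimately show False
    using \<delta> by (simp only: mult_le_cancel_right) auto
qed

text \<open>The form is nonnegative along x + t y for every t. The degenerate case matters because
  the lemma is also applied to the merely semidefinite difference of two inverses.\<close>

lemma psd_cauchy_schwarz:
  fixes D :: "real^'n^'n"
  assumes D: "sym_mat D" and psd: "\<And>x. 0 \<le> x \<bullet> (D *v x)"
  shows "(x \<bullet> (D *v y))\<^sup>2 \<le> (x \<bullet> (D *v x)) * (y \<bullet> (D *v y))"
proof -
  let ?X = "x \<bullet> (D *v x)" and ?Y = "y \<bullet> (D *v y)" and ?B = "x \<bullet> (D *v y)"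
  have yx: "y \<bullet> (D *v x) = ?B"
    using sym_mat_inner[OF D, of y x] by (simp add: inner_commute)
  have q: "0 \<le> ?X + 2 * t * ?B + t\<^sup>2 * ?Y" for t
    using psd[of "x + t *\<^sub>R y"] yx
    by (simp add: matrix_vector_right_distrib matrix_vector_mult_scaleR inner_add_left inner_add_right
        power2_eq_square algebra_simps)
  show ?thesis
  proof (cases "?Y = 0")
    case True
    \<comment> \<open>With \<open>?Y = 0\<close> the form is affine in t; were the slope nonzero,
      this t would give the value -1.\<close>
    have "?B = 0"
      using q[of "- (?X + 1) / (2 * ?B)"] True by (cases "?B = 0") (auto simp: field_simps)
    then show ?thesis
      using True by simp
  next
    case False
    then have "?Y > 0"
      using psd[of y] by simp
    then show ?thesis
      using q[of "- ?B / ?Y"] by (simp add: field_simps power2_eq_square)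
  qed
qed

lemma posdef_inverse:
  assumes V: "sym_mat (V :: real^'n^'n)" "posdef V"
  shows "sym_mat (matrix_inv V)" "posdef (matrix_inv V)"
    "V *v (matrix_inv V *v x) = x" "matrix_inv V *v (V *v x) = x"
proof -
  obtain e \<mu> where e: "onb e" and Ve: "V = spec_mat e \<mu>"
    using spectral_theorem[OF V(1)] .
  have \<mu>: "\<mu> j > 0" if "j \<in> {1..CARD('n)}" for j
    using V(2) that unfolding Ve posdef_spec_mat[OF e] by blast
  have inv: "matrix_inv V = spec_mat e (\<lambda>j. 1 / \<mu> j)"
    unfolding Ve using \<mu> by (intro matrix_inv_spec_mat[OF e]) force
  show "sym_mat (matrix_inv V)" "posdef (matrix_inv V)"
    unfolding inv posdef_spec_mat[OF e] using \<mu> by (auto simp: sym_spec_mat)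
  show "V *v (matrix_inv V *v x) = x" "matrix_inv V *v (V *v x) = x"
    unfolding inv
    by (simp_all add: Ve matrix_vector_mul_assoc spec_mat_mult[OF e])
       (subst spec_mat_one[OF e]; use \<mu> in force)+
qed

lemma posdef_quad_pos: "posdef V \<Longrightarrow> x \<noteq> 0 \<Longrightarrow> x \<bullet> (V *v x) > 0"
  by (simp add: posdef_def)

lemma posdef_quad_nonneg: "posdef V \<Longrightarrow> 0 \<le> x \<bullet> (V *v x)"
  by (cases "x = 0") (auto simp: posdef_def intro: less_imp_le)

text \<open>At a point \<open>x\<close> where the quotient of the quadratic forms of two solutions is maximal, the
  two estimating equations force equality termwise, so that the sample splits between two proper
  subspaces unless the solutions are proportional.\<close>
lemma tyler_unique:
  fixes V1 V2 :: "real^'n^'n"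
  assumes V: "shape V1" "shape V2"
    and S: "S_n n U V1 = (1 / real CARD('n)) *\<^sub>R mat 1" "S_n n U V2 = (1 / real CARD('n)) *\<^sub>R mat 1"
    and nosplit: "\<And>a b. a \<noteq> 0 \<Longrightarrow> b \<noteq> 0 \<Longrightarrow> \<exists>i<n. a \<bullet> U i \<noteq> 0 \<and> b \<bullet> U i \<noteq> 0"
  shows "V1 = V2"
proof -
  note V1 = V(1)[unfolded shape_def] and V2 = V(2)[unfolded shape_def]
  let ?p = "real CARD('n)"
  let ?K = "sphere (0 :: real^'n) 1"
  have cont: "continuous_on ?K (\<lambda>x. (x \<bullet> (V2 *v x)) / (x \<bullet> (V1 *v x)))"
  proof (intro continuous_intros ballI)
    fix x :: "real^'n" assume "x \<in> ?K"
    then have "x \<noteq> 0"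
      by auto
    then show "x \<bullet> (V1 *v x) \<noteq> 0"
      using V1 unfolding posdef_def by (metis less_irrefl)
  qed
  have "compact ?K" "?K \<noteq> {}"
    by auto
  from continuous_attains_sup[OF this cont] obtain x where x: "norm x = 1"
    and max: "\<And>y. norm y = 1 \<Longrightarrow> (y \<bullet> (V2 *v y)) / (y \<bullet> (V1 *v y)) \<le> (x \<bullet> (V2 *v x)) / (x \<bullet> (V1 *v x))"
    by auto
  define k where "k = (x \<bullet> (V2 *v x)) / (x \<bullet> (V1 *v x))"
  have x0: "x \<noteq> 0"
    using x by auto
  have k: "k > 0"
    unfolding k_def using V1 V2 x0 by (simp add: posdef_def)
  have kx: "x \<bullet> (V2 *v x) = k * (x \<bullet> (V1 *v x))"
    unfolding k_def using posdef_quad_pos[of V1 x] V1 x0 by simp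
  have le: "y \<bullet> (V2 *v y) \<le> k * (y \<bullet> (V1 *v y))" for y
  proof (cases "y = 0")
    case False
    let ?z = "y /\<^sub>R norm y"
    have "(?z \<bullet> (V2 *v ?z)) / (?z \<bullet> (V1 *v ?z)) \<le> k"
      unfolding k_def using False by (intro max) simp
    moreover have "(?z \<bullet> (V2 *v ?z)) / (?z \<bullet> (V1 *v ?z)) = (y \<bullet> (V2 *v y)) / (y \<bullet> (V1 *v y))"
      using False by (simp add: matrix_vector_mult_scaleR)
    ultimately have "(y \<bullet> (V2 *v y)) / (y \<bullet> (V1 *v y)) \<le> k"
      by simp
    then show ?thesis
      using posdef_quad_pos[of V1 y] V1 False by (simp add: pos_divide_le_eq)
  qed simp
  define W1 W2 where "W1 = matrix_inv V1" and "W2 = matrix_inv V2"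
  have W1: "sym_mat W1" "posdef W1" "\<And>x. V1 *v (W1 *v x) = x" "\<And>x. W1 *v (V1 *v x) = x"
    unfolding W1_def using posdef_inverse V1 by blast+
  have W2: "sym_mat W2" "posdef W2" "\<And>x. V2 *v (W2 *v x) = x" "\<And>x. W2 *v (V2 *v x) = x"
    unfolding W2_def using posdef_inverse V2 by blast+
  \<comment> \<open>Inversion reverses the order: V2 <= k V1 gives W1 <= k W2, by Cauchy-Schwarz for
    \<open>V2\<close> at the vectors \<open>W2 *v u\<close> and \<open>W1 *v u\<close>.\<close>
  have inv_le: "u \<bullet> (W1 *v u) \<le> k * (u \<bullet> (W2 *v u))" for u
  proof (cases "u = 0")
    case False
    let ?y = "W1 *v u" and ?z = "W2 *v u"
    have q1: "u \<bullet> (W1 *v u) > 0"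
      using W1(2) False by (rule posdef_quad_pos)
    have "(?z \<bullet> (V2 *v ?y))\<^sup>2 \<le> (?z \<bullet> (V2 *v ?z)) * (?y \<bullet> (V2 *v ?y))"
      using V2 by (intro psd_cauchy_schwarz) (auto intro: posdef_quad_nonneg)
    moreover have "?z \<bullet> (V2 *v ?y) = u \<bullet> (W1 *v u)"
      using sym_mat_inner[of V2 ?z ?y] V2 by (simp add: W2)
    moreover have "?z \<bullet> (V2 *v ?z) = u \<bullet> (W2 *v u)"
      by (simp add: W2 inner_commute)
    ultimately have "(u \<bullet> (W1 *v u))\<^sup>2 \<le> (u \<bullet> (W2 *v u)) * (?y \<bullet> (V2 *v ?y))"
      by simp
    also have "\<dots> \<le> (u \<bullet> (W2 *v u)) * (k * (?y \<bullet> (V1 *v ?y)))"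
      by (intro mult_left_mono le posdef_quad_nonneg W2)
    also have "?y \<bullet> (V1 *v ?y) = u \<bullet> (W1 *v u)"
      by (simp add: W1 inner_commute)
    finally show ?thesis
      using q1 by (simp add: power2_eq_square mult.commute[of k])
  qed simp
  define D where "D = W2 - (1 / k) *\<^sub>R W1"
  have Dv: "D *v u = W2 *v u - (1 / k) *\<^sub>R (W1 *v u)" for u
    by (simp add: D_def matrix_vector_mult_diff_rdistrib matrix_scaleR_mult_vec)
  have Dsym: "sym_mat D"
    by (rule sym_matI) (use W1 W2 in \<open>simp add: Dv inner_diff_left inner_diff_right sym_mat_inner\<close>)
  have Dpsd: "0 \<le> u \<bullet> (D *v u)" for u
    using inv_le[of u] k by (simp add: Dv inner_diff_right divide_simps mult.commute)
  \<comment> \<open>\<open>f i\<close> is k times the i-th term of the equation of \<open>V1\<close>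
    at \<open>x\<close> minus that of \<open>V2\<close>. The average is zero because
    \<open>x\<close> attains the quotient \<open>k\<close>, and each term is nonnegative by
    \<open>inv_le\<close>, so all vanish.\<close>
  define f where "f i = (x \<bullet> U i)\<^sup>2 * (k / (U i \<bullet> (W1 *v U i)) - 1 / (U i \<bullet> (W2 *v U i)))" for i
  have f0: "f i \<ge> 0" for i
  proof (cases "U i = 0")
    case False
    have "U i \<bullet> (W1 *v U i) > 0" "U i \<bullet> (W2 *v U i) > 0"
      using W1(2) W2(2) False by (auto simp: posdef_def)
    with inv_le[of "U i"] have "1 / (U i \<bullet> (W2 *v U i)) \<le> k / (U i \<bullet> (W1 *v U i))"
      by (simp add: divide_simps mult.commute)
    then show ?thesis
      by (simp add: f_def)
  qed (simp add: f_def)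
  have "\<forall>x y. ?p * avg n (\<lambda>i. (x \<bullet> U i) * (y \<bullet> U i) / (U i \<bullet> (W1 *v U i))) = x \<bullet> (V1 *v y)"
    unfolding W1_def using S(1) V1 by (subst (asm) S_n_isotropic_iff) auto
  then have "k * (?p * avg n (\<lambda>i. (x \<bullet> U i)\<^sup>2 / (U i \<bullet> (W1 *v U i)))) = x \<bullet> (V2 *v x)"
    by (simp add: kx power2_eq_square)
  moreover have "\<forall>x y. ?p * avg n (\<lambda>i. (x \<bullet> U i) * (y \<bullet> U i) / (U i \<bullet> (W2 *v U i))) = x \<bullet> (V2 *v y)"
    unfolding W2_def using S(2) V2 by (subst (asm) S_n_isotropic_iff) auto
  then have "?p * avg n (\<lambda>i. (x \<bullet> U i)\<^sup>2 / (U i \<bullet> (W2 *v U i))) = x \<bullet> (V2 *v x)"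
    by (simp add: power2_eq_square)
  ultimately have "?p * (k * avg n (\<lambda>i. (x \<bullet> U i)\<^sup>2 / (U i \<bullet> (W1 *v U i)))
      - avg n (\<lambda>i. (x \<bullet> U i)\<^sup>2 / (U i \<bullet> (W2 *v U i)))) = 0"
    by (simp add: algebra_simps)
  then have "k * avg n (\<lambda>i. (x \<bullet> U i)\<^sup>2 / (U i \<bullet> (W1 *v U i)))
      - avg n (\<lambda>i. (x \<bullet> U i)\<^sup>2 / (U i \<bullet> (W2 *v U i))) = 0"
    by simp
  moreover have "f = (\<lambda>i. k * ((x \<bullet> U i)\<^sup>2 / (U i \<bullet> (W1 *v U i))) - (x \<bullet> U i)\<^sup>2 / (U i \<bullet> (W2 *v U i)))"
    by (simp add: fun_eq_iff f_def right_diff_distrib)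
  ultimately have "avg n f = 0"
    by (simp only: avg_diff avg_mult_left)
  moreover obtain i0 where "i0 < n"
    using nosplit[OF x0 x0] by auto
  ultimately have "sum f {..<n} = 0"
    by (auto simp: avg_def)
  then have fi: "f i = 0" if "i < n" for i
    using that f0 by (simp add: sum_nonneg_eq_0_iff)
  \<comment> \<open>Some \<open>U i\<close> is orthogonal neither to \<open>x\<close> nor to a
    nonzero row of \<open>D\<close>. Then \<open>f i = 0\<close> gives U_i . D U_i = 0, and
    semidefiniteness forces D U_i = 0, which contradicts the choice of the row.\<close>
  have "D = 0"
  proof (rule ccontr)
    assume "D \<noteq> 0"
    then obtain l where l: "D $ l \<noteq> 0"
      by (auto simp: vec_eq_iff)
    obtain i where i: "i < n" "x \<bullet> U i \<noteq> 0" "D $ l \<bullet> U i \<noteq> 0"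
      using nosplit[OF x0 l] by blast
    then have "U i \<noteq> 0"
      by auto
    then have "U i \<bullet> (W1 *v U i) > 0" "U i \<bullet> (W2 *v U i) > 0"
      using W1(2) W2(2) by (auto simp: posdef_def)
    then have "U i \<bullet> (D *v U i) = 0"
      using fi[OF i(1)] i(2) k by (simp add: f_def Dv inner_diff_right field_simps)
    then have "(axis l 1 \<bullet> (D *v U i))\<^sup>2 \<le> 0"
      using psd_cauchy_schwarz[OF Dsym Dpsd, of "axis l 1" "U i"] by simp
    then show False
      using i(3) by (simp add: inner_axis' mult_vec_nth)
  qed
  then have W21: "W2 *v u = (1 / k) *\<^sub>R (W1 *v u)" for u
    using Dv[of u] by simp
  have "V1 *v u = (1 / k) *\<^sub>R (V2 *v u)" for u
  proof -
    have "V1 *v u = V1 *v (W2 *v (V2 *v u))"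
      by (simp add: W2)
    then show ?thesis
      by (simp add: W21 matrix_vector_mult_scaleR W1)
  qed
  \<comment> \<open>Only proportionality is known so far; the common trace fixes the factor.\<close>
  then have V12: "V1 = (1 / k) *\<^sub>R V2"
    by (simp add: matrix_eq matrix_scaleR_mult_vec)
  then have "trace V1 = (1 / k) * trace V2"
    by (simp add: trace_scaleR)
  then have "k = 1"
    using V1 V2 k by (simp add: divide_simps)
  with V12 show ?thesis
    by simp
qed

section \<open>Tyler's estimator of a nearly isotropic sample\<close>

lemma op_le_id_plus:
  assumes "op_le H r"
  shows "norm (x + H *v x) \<le> (1 + r) * norm x" "(1 - r) * norm x \<le> norm (x + H *v x)"
  using op_le_norm[OF assms, of x] norm_triangle_ineq[of x "H *v x"] norm_triangle_ineq2[of x "- (H *v x)"]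
  by (auto simp: algebra_simps)

lemma sym_mat_add_id: "sym_mat H \<Longrightarrow> sym_mat (mat 1 + H)"
  by (rule sym_matI) (simp add: matrix_vector_mult_add_rdistrib inner_add_left inner_add_right sym_mat_inner)

text \<open>A symmetric perturbation smaller than 1 leaves the identity positive definite, so the
  inverse comes with its symmetry from \<open>posdef_inverse\<close>.\<close>

lemma id_plus_invertible:
  fixes H :: "real^'n^'n"
  assumes H: "op_le H r" "r < 1" and sym: "sym_mat H"
  obtains Bi where "sym_mat Bi" "\<And>x. (mat 1 + H) *v (Bi *v x) = x" "\<And>x. Bi *v ((mat 1 + H) *v x) = x"
proof -
  have "sym_mat (mat 1 + H)"
    by (rule sym_mat_add_id[OF sym])
  moreover have "posdef (mat 1 + H)"
    unfolding posdef_def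
  proof safe
    fix x :: "real^'n" assume "x \<noteq> 0"
    then have "r * (norm x * norm x) < 1 * (norm x * norm x)"
      using H(2) by (intro mult_strict_right_mono) auto
    with op_le_inner[OF H(1), of x x] show "0 < x \<bullet> ((mat 1 + H) *v x)"
      by (simp add: matrix_vector_mult_add_rdistrib inner_add_right dot_square_norm power2_eq_square)
  qed
  ultimately show thesis
    using that posdef_inverse by blast
qed

text \<open>Let B = I + H make the directions of B w_i isotropic. A matrix proportional to A B^-2 A
  solves the estimating equation: the form of its inverse at U_i is |B w_i|^2 up to the factor t_i^2
  / s, and t_i cancels since only directions count. The trace determines \<open>s\<close>. The
  explicit form of the solution, more than its existence, gives access to its eigenvectors.\<close>

lemma tyler_of_near_isotropic:
  fixes w U :: "nat \<Rightarrow> real^'n" and A Ai :: "real^'n^'n"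
  defines "p \<equiv> real CARD('n)"
  assumes iso: "near_iso4 \<delta> n w" and unit: "\<And>i. i < n \<Longrightarrow> norm (w i) = 1" and n: "n > 0"
    and r: "r = p ^ 3 * (p + 2) * \<delta>" and small: "24 * p\<^sup>2 * (p + 2) * r \<le> 1"
    and A: "sym_mat A" and Ai: "sym_mat Ai" "\<And>x. Ai *v (A *v x) = x" "\<And>x. A *v (Ai *v x) = x"
    and U: "\<And>i. i < n \<Longrightarrow> U i = t i *\<^sub>R (A *v w i)" and t: "\<And>i. i < n \<Longrightarrow> t i > 0"
  obtains H Bi s where "sym_mat H" "op_le H r" "scatter n w H = (1 / p) *\<^sub>R mat 1"
    "sym_mat Bi" "\<And>x. (mat 1 + H) *v (Bi *v x) = x" "\<And>x. Bi *v ((mat 1 + H) *v x) = x"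
    "s > 0" "tyler_ok n U" "tyler n U = s *\<^sub>R (A ** Bi ** Bi ** A)"
proof -
  have p1: "p \<ge> 1"
    using zero_less_card_finite[where ?'a = 'n] unfolding p_def by linarith
  have \<delta>: "\<delta> \<ge> 0"
    using near_iso4_nonneg[OF iso] .
  have r0: "r \<ge> 0"
    using p1 \<delta> by (simp add: r)
  have p2: "1 \<le> p\<^sup>2 * (p + 2)"
    using p1 mult_mono[of 1 "p\<^sup>2" 1 "p + 2"] power_mono[of 1 p 2] by simp
  then have "1 * r * 24 \<le> p\<^sup>2 * (p + 2) * r * 24"
    using r0 by (intro mult_right_mono) auto
  then have r1: "r < 1"
    using small by linarith
  obtain H where H: "sym_mat H" "op_le H r" "scatter n w H = (1 / p) *\<^sub>R mat 1"
    using isotropic_transform_exists[OF iso unit n r[unfolded p_def]] small unfolding p_def by blast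
  obtain Bi where Bi: "sym_mat Bi" "\<And>x. (mat 1 + H) *v (Bi *v x) = x" "\<And>x. Bi *v ((mat 1 + H) *v x) = x"
    using id_plus_invertible[OF H(2) r1 H(1)] by blast
  define B where "B = mat 1 + H"
  have Bsym: "sym_mat B"
    unfolding B_def by (rule sym_mat_add_id[OF H(1)])
  have Bv: "B *v x = x + H *v x" for x
    by (simp add: B_def matrix_vector_mult_add_rdistrib)
  note BBi = Bi(2,3)[folded B_def]
  let ?M = "A ** Bi ** Bi ** A"
  have M: "x \<bullet> (?M *v y) = (Bi *v (A *v x)) \<bullet> (Bi *v (A *v y))" for x y
    by (simp add: sym_mat_inner[OF A] sym_mat_inner[OF Bi(1)] flip: matrix_vector_mul_assoc)
  have Mpos: "x \<bullet> (?M *v x) > 0" if "x \<noteq> 0" for x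
  proof -
    have "Bi *v (A *v x) \<noteq> 0"
      using that BBi(1)[of "A *v x"] Ai(2)[of x] by auto
    then show ?thesis
      by (simp add: M)
  qed
  have "trace ?M = (\<Sum>k\<in>UNIV. axis k 1 \<bullet> (?M *v axis k 1))"
    by (simp add: trace_def flip: matrix_nth_form)
  also have "\<dots> > 0"
    by (intro sum_pos Mpos) auto
  finally have trM: "trace ?M > 0" .
  define s where "s = p / trace ?M"
  have s: "s > 0"
    using trM p1 by (simp add: s_def)
  define V where "V = s *\<^sub>R ?M"
  have Vf: "x \<bullet> (V *v y) = s * (x \<bullet> (?M *v y))" for x y
    by (simp add: V_def matrix_scaleR_mult_vec)
  have Vsym: "sym_mat V"
  proof (rule sym_matI)
    fix x y
    show "x \<bullet> (V *v y) = (V *v x) \<bullet> y"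
      unfolding inner_commute[of "V *v x"] Vf M by (simp add: inner_commute)
  qed
  have Vpd: "posdef V"
    using Mpos s by (simp add: posdef_def Vf)
  have "trace V = s * trace ?M"
    by (simp add: V_def trace_scaleR)
  then have Vshape: "shape V"
    using Vsym Vpd trM by (simp add: shape_def s_def p_def)
  have Vinv: "matrix_inv V = (1 / s) *\<^sub>R (Ai ** B ** B ** Ai)"
    by (rule matrix_inv_unique)
       (use s in \<open>simp add: matrix_eq V_def matrix_scaleR_mult_vec matrix_vector_mult_scaleR Ai BBi
          flip: matrix_vector_mul_assoc\<close>)
  have q: "U i \<bullet> (matrix_inv V *v U i) = (t i)\<^sup>2 / s * (norm (w i + H *v w i))\<^sup>2" if "i < n" for i
  proof -
    have "x \<bullet> (B *v (B *v x)) = (norm (x + H *v x))\<^sup>2" for x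
      by (simp add: sym_mat_inner[OF Bsym] power2_norm_eq_inner flip: Bv)
    then show ?thesis
      unfolding U[OF that] Vinv
      by (simp add: matrix_scaleR_mult_vec matrix_vector_mult_scaleR sym_mat_inner[OF Ai(1)] Ai(2)
          power2_eq_square[of "t i"] flip: matrix_vector_mul_assoc)
  qed
  have "S_n n U V = (1 / real CARD('n)) *\<^sub>R mat 1"
    unfolding S_n_isotropic_iff[OF Vsym Vpd]
  proof (intro allI)
    fix x y
    have wB: "w i = Bi *v (w i + H *v w i)" for i
      using BBi(2)[of "w i"] by (simp add: Bv)
    have "avg n (\<lambda>i. (x \<bullet> U i) * (y \<bullet> U i) / (U i \<bullet> (matrix_inv V *v U i)))
      = avg n (\<lambda>i. s * (((Bi *v (A *v x)) \<bullet> (w i + H *v w i)) * ((Bi *v (A *v y)) \<bullet> (w i + H *v w i))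
          / (norm (w i + H *v w i))\<^sup>2))"
    proof (rule avg_cong)
      fix i assume i: "i < n"
      have "x \<bullet> U i = t i * ((Bi *v (A *v x)) \<bullet> (w i + H *v w i))" for x
        unfolding U[OF i] using sym_mat_inner[OF A, of x "w i"] sym_mat_inner[OF Bi(1), of "A *v x" "w i + H *v w i"]
        by (simp flip: wB)
      then show "(x \<bullet> U i) * (y \<bullet> U i) / (U i \<bullet> (matrix_inv V *v U i))
        = s * (((Bi *v (A *v x)) \<bullet> (w i + H *v w i)) * ((Bi *v (A *v y)) \<bullet> (w i + H *v w i))
          / (norm (w i + H *v w i))\<^sup>2)"
        unfolding q[OF i] using t[OF i] s by (simp add: power2_eq_square[of "t i"])
    qed
    also have "\<dots> = s * ((Bi *v (A *v x)) \<bullet> (scatter n w H *v (Bi *v (A *v y))))"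
      by (simp only: avg_mult_left scatter_form)
    also have "\<dots> = x \<bullet> (V *v y) / p"
      by (simp add: H(3) matrix_scaleR_mult_vec Vf M)
    finally show "real CARD('n) * avg n (\<lambda>i. (x \<bullet> U i) * (y \<bullet> U i) / (U i \<bullet> (matrix_inv V *v U i))) = x \<bullet> (V *v y)"
      using p1 by (simp add: p_def)
  qed
  note sol = Vshape this
  \<comment> \<open>p (p + 2) \<delta> is at most \<open>r\<close>, hence below 1: the threshold of
    \<open>near_iso4_no_splitting\<close>.\<close>
  have \<delta>1: "\<delta> < 1 / (p * (p + 2))"
  proof -
    have "1 * \<delta> \<le> p\<^sup>2 * \<delta>"
      using \<delta> p1 power_mono[of 1 p 2] by (intro mult_right_mono) auto
    then have "p * (p + 2) * \<delta> \<le> p * (p + 2) * (p\<^sup>2 * \<delta>)"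
      using p1 by (intro mult_left_mono) auto
    also have "\<dots> = r"
      by (simp add: r power2_eq_square power3_eq_cube)
    finally show ?thesis
      using r1 p1 less_le_trans[of 0 "1 * 3" "p * (p + 2)"] mult_mono[of 1 p 3 "p + 2"]
      by (subst pos_less_divide_eq) (auto simp: mult.commute)
  qed
  have uniq: "V' = V" if V': "shape V' \<and> S_n n U V' = (1 / real CARD('n)) *\<^sub>R mat 1" for V'
  proof (rule tyler_unique)
    fix a b :: "real^'n" assume ab: "a \<noteq> 0" "b \<noteq> 0"
    have nz: "A *v x \<noteq> 0" if "x \<noteq> 0" for x
      using that Ai(2)[of x] by auto
    obtain i where "i < n" "(A *v a) \<bullet> w i \<noteq> 0" "(A *v b) \<bullet> w i \<noteq> 0"
      using near_iso4_no_splitting[OF iso \<delta>1[unfolded p_def] nz nz] ab by blast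
    then show "\<exists>i<n. a \<bullet> U i \<noteq> 0 \<and> b \<bullet> U i \<noteq> 0"
      using t by (intro exI[of _ i]) (force simp: U sym_mat_inner[OF A])
  qed (use V' sol in auto)
  have "tyler_ok n U"
    unfolding tyler_ok_def using sol uniq by blast
  moreover have "tyler n U = V"
    unfolding tyler_def using sol uniq by (intro the_equality) blast+
  ultimately show thesis
    using that H Bi s unfolding V_def by blast
qed

section \<open>The Gram--Schmidt basis\<close>

lemma one_le_card [simp]: "1 \<le> CARD('a::finite)"
  using zero_less_card_finite[where ?'a = 'a] by linarith

text \<open>Each step writes a single new value and leaves the earlier ones alone, so all
  sufficiently long runs agree at \<open>k\<close>.\<close>

lemma gs_eq_theta_tilde: "k < m \<Longrightarrow> gs t0 th m k = theta_tilde t0 th k"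
  by (induction m) (auto simp: theta_tilde_def Let_def less_Suc_eq)

lemma theta_tilde_rec:
  fixes t0 :: "real^'n"
  defines "v \<equiv> \<lambda>th j. th j - (t0 \<bullet> th j) *\<^sub>R t0 -
    (\<Sum>k\<in>{2..<j}. (theta_tilde t0 th k \<bullet> th j) *\<^sub>R theta_tilde t0 th k)"
  shows "theta_tilde t0 th j = v th j /\<^sub>R norm (v th j)"
proof -
  have "(\<Sum>k\<in>{2..<j}. outer (gs t0 th j k) (gs t0 th j k)) *v x =
      (\<Sum>k\<in>{2..<j}. (theta_tilde t0 th k \<bullet> x) *\<^sub>R theta_tilde t0 th k)" for x
    unfolding matrix_sum_mult_vec outer_mult_vec by (intro sum.cong) (auto simp: gs_eq_theta_tilde)
  then show ?thesis
    by (simp add: theta_tilde_def[of _ _ j] Let_def v_def matrix_vector_mult_diff_rdistrib outer_mult_vec)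
qed

context
  fixes t0 :: "real^'n" and e :: "nat \<Rightarrow> real^'n"
  assumes t0: "norm t0 = 1" and e: "onb e"
begin

text \<open>\<open>gs_rho j\<close> is the squared length of \<open>gs_rest j\<close>, the component
  of t0 orthogonal to e_2, ..., e_j. The span of t0, e_2, ..., e_(j-1) is also spanned by the
  mutually orthogonal e_2, ..., e_(j-1) and \<open>gs_rest (j - 1)\<close>, which makes Gram-Schmidt
  explicit.\<close>

definition gs_rho :: "nat \<Rightarrow> real" where
  "gs_rho j = 1 - (\<Sum>k\<in>{2..j}. (t0 \<bullet> e k)\<^sup>2)"

definition gs_rest :: "nat \<Rightarrow> real^'n" where
  "gs_rest j = t0 - (\<Sum>k\<in>{2..j}. (t0 \<bullet> e k) *\<^sub>R e k)"

text \<open>The vector e_j is already orthogonal to e_2, ..., e_(j-1), so only its component along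
  \<open>gs_rest (j - 1)\<close> has to be removed; the prefactor is the reciprocal of the remaining
  length.\<close>

definition gs_vec :: "nat \<Rightarrow> real^'n" where
  "gs_vec j = (sqrt (gs_rho (j - 1)) / sqrt (gs_rho j)) *\<^sub>R
     (e j - ((t0 \<bullet> e j) / gs_rho (j - 1)) *\<^sub>R gs_rest (j - 1))"

definition gs_basis :: "nat \<Rightarrow> real^'n" where
  "gs_basis j = (if j = 1 then t0 else gs_vec j)"

lemma gs_rho_step: "j \<ge> 2 \<Longrightarrow> gs_rho (j - 1) = gs_rho j + (t0 \<bullet> e j)\<^sup>2"
  by (cases j) (auto simp: gs_rho_def)

lemma gs_rest_step: "j \<ge> 2 \<Longrightarrow> gs_rest j = gs_rest (j - 1) - (t0 \<bullet> e j) *\<^sub>R e j"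
  by (cases j) (auto simp: gs_rest_def)

lemma gs_rest_inner_e:
  assumes "j \<le> CARD('n)" "k \<in> {1..CARD('n)}"
  shows "gs_rest j \<bullet> e k = (if k \<in> {2..j} then 0 else t0 \<bullet> e k)"
proof -
  have "(\<Sum>l\<in>{2..j}. ((t0 \<bullet> e l) *\<^sub>R e l) \<bullet> e k) = (\<Sum>l\<in>{2..j}. if l = k then t0 \<bullet> e l else 0)"
    by (intro sum.cong) (use assms in \<open>auto simp: onb_inner[OF e]\<close>)
  then show ?thesis
    by (simp add: gs_rest_def inner_diff_left inner_sum_left)
qed

lemma gs_rest_inner_t0: "gs_rest j \<bullet> t0 = gs_rho j"
  using t0 by (simp add: gs_rest_def gs_rho_def inner_diff_left inner_sum_left norm_eq_1
      power2_eq_square inner_commute[of "e _"])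

lemma gs_rest_inner_self:
  assumes "j \<le> CARD('n)" shows "gs_rest j \<bullet> gs_rest j = gs_rho j"
proof -
  have "gs_rest j \<bullet> gs_rest j = gs_rest j \<bullet> t0 - (\<Sum>k\<in>{2..j}. (t0 \<bullet> e k) * (gs_rest j \<bullet> e k))"
    by (subst (2) gs_rest_def) (simp add: inner_diff_right inner_sum_right)
  also have "(\<Sum>k\<in>{2..j}. (t0 \<bullet> e k) * (gs_rest j \<bullet> e k)) = 0"
    using assms by (intro sum.neutral) (auto simp: gs_rest_inner_e)
  finally show ?thesis
    by (simp add: gs_rest_inner_t0)
qed

text \<open>Positivity means that t0 lies outside the span of e_2, ..., e_j, so that no Gram-Schmidt
  step divides by zero. It is supplied by \<open>gs_basis_change_small\<close>.\<close>

context
  assumes rho_pos: "\<And>j. j \<le> CARD('n) \<Longrightarrow> gs_rho j > 0"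
begin

text \<open>\<open>gs_rest (j - 1)\<close> has no component along e_2, ..., e_(j-1), so the change
  of basis is upper triangular apart from its first column. The other entries below the diagonal,
  which the grading would multiply by a possibly huge eigenvalue ratio, are exactly zero.\<close>

lemma gs_vec_inner_e:
  assumes j: "j \<in> {2..CARD('n)}" and k: "k \<in> {1..CARD('n)}"
  shows "gs_vec j \<bullet> e k =
    (if k = j then sqrt (gs_rho j) / sqrt (gs_rho (j - 1))
     else if k = 1 \<or> k > j then - (t0 \<bullet> e j) * (t0 \<bullet> e k) / (sqrt (gs_rho j) * sqrt (gs_rho (j - 1)))
     else 0)"
proof -
  have pos: "gs_rho j > 0" "gs_rho (j - 1) > 0"
    using j by (auto intro: rho_pos)
  have sq: "sqrt (gs_rho (j - 1)) * sqrt (gs_rho (j - 1)) = gs_rho (j - 1)" "sqrt (gs_rho j) * sqrt (gs_rho j) = gs_rho j"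
    using pos by auto
  have nz: "sqrt (gs_rho j) \<noteq> 0" "sqrt (gs_rho (j - 1)) \<noteq> 0" "gs_rho (j - 1) \<noteq> 0"
    using pos by auto
  have ejk: "e j \<bullet> e k = (if k = j then 1 else 0)"
    using j k by (simp add: onb_inner[OF e])
  have v: "gs_vec j \<bullet> e k = (sqrt (gs_rho (j - 1)) / sqrt (gs_rho j)) *
     ((if k = j then 1 else 0) - ((t0 \<bullet> e j) / gs_rho (j - 1)) * (if k \<in> {2..j - 1} then 0 else t0 \<bullet> e k))"
  proof -
    have "gs_rest (j - 1) \<bullet> e k = (if k \<in> {2..j - 1} then 0 else t0 \<bullet> e k)"
      using j k by (intro gs_rest_inner_e) auto
    then show ?thesis
      by (simp only: gs_vec_def inner_scaleR_left inner_diff_left ejk)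
  qed
  consider "k = j" | "k = 1 \<or> k > j" "k \<noteq> j" | "2 \<le> k" "k < j"
    using k j by fastforce
  then show ?thesis
  proof cases
    case 1
    have "gs_vec j \<bullet> e k = (sqrt (gs_rho (j - 1)) / sqrt (gs_rho j)) * (gs_rho j / gs_rho (j - 1))"
    proof -
      have "\<not> j \<le> j - 1"
        using j by auto
      then show ?thesis
        using 1 j nz unfolding v by (simp add: gs_rho_step[of j] divide_simps power2_eq_square)
    qed
    also have "\<dots> = sqrt (gs_rho j) / sqrt (gs_rho (j - 1))"
    proof -
      have alg: "b / a * (a * a / (b * b)) = a / b" if "a \<noteq> 0" "b \<noteq> 0" for a b :: real
        using that by simp
      show ?thesis
        using alg[OF nz(1,2)] unfolding sq .
    qed
    finally show ?thesis
      using 1 by simp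
  next
    case 2
    have "gs_vec j \<bullet> e k = - (sqrt (gs_rho (j - 1)) / sqrt (gs_rho j) * ((t0 \<bullet> e j) / gs_rho (j - 1)) * (t0 \<bullet> e k))"
      using 2 j unfolding v by auto
    also have "\<dots> = - (t0 \<bullet> e j) * (t0 \<bullet> e k) / (sqrt (gs_rho j) * sqrt (gs_rho (j - 1)))"
    proof -
      have alg: "- (b / a * (x / (b * b)) * y) = - x * y / (a * b)" if "b \<noteq> 0" for a b x y :: real
        using that by simp
      show ?thesis
        using alg[OF nz(2), of "sqrt (gs_rho j)"] unfolding sq .
    qed
    finally show ?thesis
      using 2 by auto
  next
    case 3
    then show ?thesis
      unfolding v using j by auto
  qed
qed

lemma gs_vec_inner_t0:
  assumes j: "j \<in> {2..CARD('n)}"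
  shows "gs_vec j \<bullet> t0 = 0"
  using j rho_pos[of "j - 1"]
  by (simp add: gs_vec_def inner_diff_left gs_rest_inner_t0 inner_commute[of "e j"])

lemma gs_vec_unnormalized_norm:
  assumes j: "j \<in> {2..CARD('n)}"
  shows "norm (e j - ((t0 \<bullet> e j) / gs_rho (j - 1)) *\<^sub>R gs_rest (j - 1)) = sqrt (gs_rho j) / sqrt (gs_rho (j - 1))"
proof -
  let ?v = "e j - ((t0 \<bullet> e j) / gs_rho (j - 1)) *\<^sub>R gs_rest (j - 1)"
  have pos: "gs_rho (j - 1) > 0"
    using j by (auto intro: rho_pos)
  have "e j \<bullet> gs_rest (j - 1) = t0 \<bullet> e j" "gs_rest (j - 1) \<bullet> e j = t0 \<bullet> e j"
    using j gs_rest_inner_e[of "j - 1" j] by (auto simp: inner_commute)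
  moreover have "e j \<bullet> e j = 1" "gs_rest (j - 1) \<bullet> gs_rest (j - 1) = gs_rho (j - 1)"
    using j gs_rest_inner_self[of "j - 1"] by (auto simp: onb_inner[OF e])
  ultimately have "?v \<bullet> ?v = 1 - (t0 \<bullet> e j)\<^sup>2 / gs_rho (j - 1)"
    using pos by (simp add: inner_diff_left inner_diff_right power2_eq_square)
  also have "\<dots> = gs_rho j / gs_rho (j - 1)"
    using pos gs_rho_step[of j] j by (simp add: field_simps)
  finally show ?thesis
    by (simp add: norm_eq_sqrt_inner real_sqrt_divide)
qed

text \<open>The sum telescopes: the k-th term is the decrease of gs_rest / gs_rho from k - 1 to k,
  and at index 1 that quotient is t0. It collects the projections onto all earlier Gram-Schmidt
  vectors.\<close>

lemma gs_vec_sum: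
  assumes "1 \<le> m" "m \<le> CARD('n)"
  shows "(\<Sum>k\<in>{2..m}. ((t0 \<bullet> e k) / (sqrt (gs_rho k) * sqrt (gs_rho (k - 1)))) *\<^sub>R gs_vec k)
    = t0 - (1 / gs_rho m) *\<^sub>R gs_rest m"
  using assms
proof (induction m rule: nat_induct_at_least)
  case base
  then show ?case
    by (simp add: gs_rho_def gs_rest_def)
next
  case (Suc m)
  let ?c = "t0 \<bullet> e (Suc m)"
  have pos: "gs_rho (Suc m) > 0" "gs_rho m > 0"
    using Suc by (auto intro: rho_pos)
  have rho: "gs_rho m = gs_rho (Suc m) + ?c\<^sup>2" and rest: "gs_rest (Suc m) = gs_rest m - ?c *\<^sub>R e (Suc m)"
    using gs_rho_step[of "Suc m"] gs_rest_step[of "Suc m"] Suc.hyps by auto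
  have "(?c / (sqrt (gs_rho (Suc m)) * sqrt (gs_rho m))) *\<^sub>R gs_vec (Suc m)
      = (?c / gs_rho (Suc m)) *\<^sub>R (e (Suc m) - (?c / gs_rho m) *\<^sub>R gs_rest m)"
    using pos by (simp add: gs_vec_def)
  also have "\<dots> = (1 / gs_rho m) *\<^sub>R gs_rest m - (1 / gs_rho (Suc m)) *\<^sub>R gs_rest (Suc m)"
  proof -
    have "1 / gs_rho m = 1 / gs_rho (Suc m) - ?c * ?c / (gs_rho (Suc m) * gs_rho m)"
    proof -
      have "?c * ?c = gs_rho m - gs_rho (Suc m)"
        using rho by (simp add: power2_eq_square)
      then show ?thesis
        using pos by (simp add: diff_divide_distrib)
    qed
    then have "(1 / gs_rho m) *\<^sub>R gs_rest m =
        (1 / gs_rho (Suc m)) *\<^sub>R gs_rest m - (?c * ?c / (gs_rho (Suc m) * gs_rho m)) *\<^sub>R gs_rest m"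
      by (simp only: scaleR_diff_left)
    then show ?thesis
      by (simp add: rest algebra_simps)
  qed
  finally have "(?c / (sqrt (gs_rho (Suc m)) * sqrt (gs_rho m))) *\<^sub>R gs_vec (Suc m)
      = (1 / gs_rho m) *\<^sub>R gs_rest m - (1 / gs_rho (Suc m)) *\<^sub>R gs_rest (Suc m)" .
  moreover have "{2..Suc m} = insert (Suc m) {2..m}"
    using Suc.hyps by auto
  ultimately show ?case
    using Suc by simp
qed

text \<open>The inner products with the earlier vectors share the factor - t0 . e_j, so the
  projections are summed by \<open>gs_vec_sum\<close> and t0 cancels. \<open>th\<close> and
  \<open>e\<close> have to agree from index 2 on, which leaves the sign of e_1 free.\<close>

lemma theta_tilde_eq_gs_vec:
  assumes th: "\<And>j. j \<in> {2..CARD('n)} \<Longrightarrow> th j = e j" and "j \<in> {2..CARD('n)}"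
  shows "theta_tilde t0 th j = gs_vec j"
  using assms(2)
proof (induction j rule: less_induct)
  case (less j)
  let ?c = "t0 \<bullet> e j"
  have "(\<Sum>k\<in>{2..<j}. (theta_tilde t0 th k \<bullet> th j) *\<^sub>R theta_tilde t0 th k)
      = (\<Sum>k\<in>{2..j - 1}. - ?c *\<^sub>R (((t0 \<bullet> e k) / (sqrt (gs_rho k) * sqrt (gs_rho (k - 1)))) *\<^sub>R gs_vec k))"
  proof (rule sum.cong)
    fix k assume k: "k \<in> {2..j - 1}"
    then have "theta_tilde t0 th k = gs_vec k" "gs_vec k \<bullet> th j = - (t0 \<bullet> e k) * ?c / (sqrt (gs_rho k) * sqrt (gs_rho (k - 1)))"
      using less gs_vec_inner_e[of k j] th[of j] by auto
    then show "(theta_tilde t0 th k \<bullet> th j) *\<^sub>R theta_tilde t0 th k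
       = - ?c *\<^sub>R (((t0 \<bullet> e k) / (sqrt (gs_rho k) * sqrt (gs_rho (k - 1)))) *\<^sub>R gs_vec k)"
      by simp
  qed (use less.prems in auto)
  also have "\<dots> = - ?c *\<^sub>R (t0 - (1 / gs_rho (j - 1)) *\<^sub>R gs_rest (j - 1))"
    using less.prems by (subst gs_vec_sum[symmetric]) (auto simp: scaleR_sum_right)
  finally have "th j - (t0 \<bullet> th j) *\<^sub>R t0 - (\<Sum>k\<in>{2..<j}. (theta_tilde t0 th k \<bullet> th j) *\<^sub>R theta_tilde t0 th k)
     = e j - (?c / gs_rho (j - 1)) *\<^sub>R gs_rest (j - 1)"
    using th[OF less.prems] by (simp add: algebra_simps)
  then show ?case
    unfolding theta_tilde_rec[of t0 th j] using gs_vec_unnormalized_norm[OF less.prems]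
    by (simp add: gs_vec_def divide_inverse mult.commute)
qed

lemma onb_gs_basis: "onb gs_basis"
proof -
  have unit: "gs_vec j \<bullet> gs_vec j = 1" if j: "j \<in> {2..CARD('n)}" for j
  proof -
    have "gs_rho j > 0" "gs_rho (j - 1) > 0"
      using j by (auto intro: rho_pos)
    then have "norm (gs_vec j) = 1"
      unfolding gs_vec_def norm_scaleR gs_vec_unnormalized_norm[OF j] by simp
    then show ?thesis
      by (simp add: norm_eq_1)
  qed
  have less: "gs_vec k \<bullet> gs_vec j = 0" if j: "j \<in> {2..CARD('n)}" and k: "k \<in> {2..CARD('n)}" and "j < k" for j k
  proof -
    have ke: "gs_vec k \<bullet> e l = 0" if "l \<in> {2..j}" for l
      using that k j \<open>j < k\<close> by (subst gs_vec_inner_e) auto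
    have "gs_vec k \<bullet> gs_rest (j - 1) = 0"
      using k j by (auto simp: gs_rest_def inner_diff_right inner_sum_right gs_vec_inner_t0 ke intro!: sum.neutral)
    moreover have "gs_vec k \<bullet> e j = 0"
      using j by (intro ke) auto
    ultimately show ?thesis
      by (subst (2) gs_vec_def) (simp add: inner_diff_right)
  qed
  have t00: "t0 \<bullet> t0 = 1"
    using t0 by (simp add: norm_eq_1)
  show ?thesis
    unfolding onb_def
  proof (intro ballI)
    fix j k assume jk: "j \<in> {1..CARD('n)}" "k \<in> {1..CARD('n)}"
    consider "j = 1" "k = 1" | "j = 1" "k \<in> {2..CARD('n)}" | "j \<in> {2..CARD('n)}" "k = 1"
      | "j \<in> {2..CARD('n)}" "k \<in> {2..CARD('n)}" "j < k" | "j \<in> {2..CARD('n)}" "k \<in> {2..CARD('n)}" "k < j"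
      | "j \<in> {2..CARD('n)}" "k = j"
      using jk by fastforce
    then show "gs_basis j \<bullet> gs_basis k = (if j = k then 1 else 0)"
    proof cases
      case 2
      then show ?thesis
        using gs_vec_inner_t0[of k] inner_commute[of t0 "gs_vec k"] by (simp add: gs_basis_def)
    next
      case 4
      then show ?thesis
        using less[of j k] inner_commute[of "gs_vec j" "gs_vec k"] by (simp add: gs_basis_def)
    qed (simp_all add: gs_basis_def t00 unit less gs_vec_inner_t0)
  qed
qed

lemma V_tilde_eq_spec_mat:
  assumes th: "\<And>j. j \<in> {2..CARD('n)} \<Longrightarrow> th j = e j"
  shows "V_tilde t0 lh th = spec_mat gs_basis lh"
proof -
  have "{1..CARD('n)} = insert 1 {2..CARD('n)}"
    by (auto simp: Suc_le_eq)
  moreover have "theta_tilde t0 th j = gs_vec j" if "j \<in> {2..CARD('n)}" for j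
    using theta_tilde_eq_gs_vec[of th j] th that by blast
  ultimately show ?thesis
    by (simp add: V_tilde_def spec_mat_def gs_basis_def)
qed

end

end

text \<open>In \<open>x\<close> the factor \<open>sqrt (lh 1 / lh j)\<close> is the grading that makes the bounds uniform in
  the spectrum; it survives because the \<open>j\<close>-th Gram--Schmidt vector involves only \<open>t0\<close> and the
  eigenvectors with larger eigenvalues.\<close>
lemma gs_basis_change_small:
  fixes t0 :: "real^'n" and e :: "nat \<Rightarrow> real^'n" and lh :: "nat \<Rightarrow> real"
  defines "g \<equiv> gs_basis t0 e" and "p \<equiv> real CARD('n)"
  defines "M \<equiv> \<lambda>j k. sqrt (lh k / lh j) * (g j \<bullet> e k)"
  assumes t0: "norm t0 = 1" and e: "onb e" and sign: "t0 \<bullet> e 1 \<ge> 0"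
    and lpos: "\<And>j. j \<in> {1..CARD('n)} \<Longrightarrow> lh j > 0"
    and ldec: "\<And>j k. 1 \<le> j \<Longrightarrow> j \<le> k \<Longrightarrow> k \<le> CARD('n) \<Longrightarrow> lh k \<le> lh j"
    and x: "\<And>j. j \<in> {2..CARD('n)} \<Longrightarrow> \<bar>(t0 \<bullet> e j) * sqrt (lh 1 / lh j)\<bar> \<le> \<epsilon>"
    and \<epsilon>: "0 \<le> \<epsilon>" "p * \<epsilon> \<le> 1/2"
  shows gs_rho_pos: "j \<le> CARD('n) \<Longrightarrow> gs_rho t0 e j > 0"
    and gs_basis_change_entry: "j \<in> {1..CARD('n)} \<Longrightarrow> k \<in> {1..CARD('n)} \<Longrightarrow>
          \<bar>M j k - (if j = k then 1 else 0)\<bar> \<le> 2 * \<epsilon>"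
    and gs_basis_change_first: "j \<in> {2..CARD('n)} \<Longrightarrow>
          \<bar>M j 1 + M 1 j - (t0 \<bullet> e j) * (sqrt (lh j / lh 1) - sqrt (lh 1 / lh j))\<bar> \<le> \<epsilon>\<^sup>2"
proof -
  define c where "c j = t0 \<bullet> e j" for j
  define \<sigma> where "\<sigma> = p * \<epsilon>\<^sup>2"
  have p1: "1 \<le> p"
    using one_le_card[where 'a = 'n] unfolding p_def by linarith
  have "\<sigma> = (p * \<epsilon>) * \<epsilon>"
    by (simp add: \<sigma>_def power2_eq_square)
  also have "\<dots> \<le> 1/2 * \<epsilon>"
    by (intro mult_right_mono \<epsilon>)
  finally have \<sigma>\<epsilon>: "\<sigma> \<le> \<epsilon> / 2"
    by simp
  have "1 * \<epsilon> \<le> p * \<epsilon>"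
    by (intro mult_right_mono p1 \<epsilon>)
  then have \<epsilon>2: "\<epsilon> \<le> 1/2"
    using \<epsilon>(2) by simp
  have \<sigma>: "0 \<le> \<sigma>" "\<sigma> \<le> 1/4"
    using \<sigma>\<epsilon> \<epsilon>2 p1 by (auto simp: \<sigma>_def)
  have c_le: "\<bar>c j\<bar> \<le> \<epsilon>" if j: "j \<in> {2..CARD('n)}" for j
  proof -
    have "1 \<le> lh 1 / lh j"
      using j lpos[of j] ldec[of 1 j] by simp
    then have "\<bar>c j\<bar> * 1 \<le> \<bar>c j\<bar> * sqrt (lh 1 / lh j)"
      by (intro mult_left_mono) auto
    also have "\<dots> = \<bar>c j * sqrt (lh 1 / lh j)\<bar>"
      using lpos[of j] lpos[of 1] j by (simp add: abs_mult)
    finally show ?thesis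
      using x[OF j] by (simp add: c_def)
  qed
  have rho: "1 - \<sigma> \<le> gs_rho t0 e j" "gs_rho t0 e j \<le> 1" if "j \<le> CARD('n)" for j
  proof -
    have "(\<Sum>k\<in>{2..j}. (c k)\<^sup>2) \<le> (\<Sum>k\<in>{2..j}. \<epsilon>\<^sup>2)"
    proof (rule sum_mono)
      fix k assume "k \<in> {2..j}"
      then have "\<bar>c k\<bar> \<le> \<epsilon>"
        using that by (intro c_le) auto
      then show "(c k)\<^sup>2 \<le> \<epsilon>\<^sup>2"
        using power_mono[of "\<bar>c k\<bar>" \<epsilon> 2] by simp
    qed
    also have "\<dots> = real (card {2..j}) * \<epsilon>\<^sup>2"
      by simp
    also have "\<dots> \<le> \<sigma>"
      unfolding \<sigma>_def p_def using that by (intro mult_right_mono) auto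
    finally show "1 - \<sigma> \<le> gs_rho t0 e j"
      by (simp add: gs_rho_def[OF t0 e] c_def)
    show "gs_rho t0 e j \<le> 1"
      by (simp add: gs_rho_def[OF t0 e] sum_nonneg)
  qed
  have pos: "gs_rho t0 e j > 0" if "j \<le> CARD('n)" for j
    using rho(1)[OF that] \<sigma> by linarith
  then show "j \<le> CARD('n) \<Longrightarrow> gs_rho t0 e j > 0" for j .
  define r where "r j = sqrt (gs_rho t0 e j)" for j
  have r: "1 - \<sigma> \<le> r j" "r j \<le> 1" if "j \<le> CARD('n)" for j
  proof -
    have "(1 - \<sigma>)\<^sup>2 \<le> 1 - \<sigma>"
      using \<sigma> mult_left_mono[of "1 - \<sigma>" 1 "1 - \<sigma>"] by (simp add: power2_eq_square)
    then have "sqrt ((1 - \<sigma>)\<^sup>2) \<le> r j"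
      unfolding r_def using rho(1)[OF that] by (intro real_sqrt_le_mono) linarith
    then show "1 - \<sigma> \<le> r j"
      using \<sigma> by simp
    show "r j \<le> 1"
      unfolding r_def using rho(2)[OF that] by simp
  qed
  have rpos: "r j > 0" if "j \<le> CARD('n)" for j
    using r[OF that] \<sigma> by linarith
  have rpos1: "r (j - 1) > 0" if "j \<le> CARD('n)" for j
    by (rule rpos) (use that in linarith)
  \<comment> \<open>The squared coordinates of the unit vector t0 add up to 1, so the first is
    determined by the others up to the sign fixed by \<open>sign\<close>.\<close>
  have c1: "c 1 = r CARD('n)"
  proof -
    have "{1..CARD('n)} = insert 1 {2..CARD('n)}"
      by auto
    moreover have "1 = (\<Sum>j\<in>{1..CARD('n)}. (c j)\<^sup>2)"
      using onb_norm2[OF e, of t0] t0 by (simp add: c_def inner_commute)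
    ultimately have "1 = (c 1)\<^sup>2 + (\<Sum>j\<in>{2..CARD('n)}. (c j)\<^sup>2)"
      by simp
    then have "gs_rho t0 e CARD('n) = (c 1)\<^sup>2"
      by (simp add: gs_rho_def[OF t0 e] c_def)
    then show ?thesis
      using sign by (simp add: r_def c_def)
  qed
  have c1b: "1 - \<sigma> \<le> c 1" "c 1 \<le> 1"
    unfolding c1 using r[of "CARD('n)"] by auto
  \<comment> \<open>As \<open>gs_rho\<close> decreases, the product dominates r_j^2 = rho_j; this
    costs one \<sigma> instead of two.\<close>
  have rr: "1 - \<sigma> \<le> r j * r (j - 1)" "r j * r (j - 1) \<le> 1" if "j \<in> {2..CARD('n)}" for j
  proof -
    have "gs_rho t0 e j \<le> gs_rho t0 e (j - 1)"
      using gs_rho_step[OF t0 e, of j] that by simp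
    then have "r j \<le> r (j - 1)"
      unfolding r_def by simp
    then have "r j * r j \<le> r j * r (j - 1)"
      using rpos[of j] that by (intro mult_left_mono) auto
    moreover have "r j * r j = gs_rho t0 e j"
      unfolding r_def using pos[of j] that by simp
    ultimately show "1 - \<sigma> \<le> r j * r (j - 1)"
      using rho(1)[of j] that by auto
    show "r j * r (j - 1) \<le> 1"
    proof -
      have "j \<le> CARD('n)" "j - 1 \<le> CARD('n)"
        using that by auto
      then show ?thesis
        using r rpos by (intro mult_le_one) (auto intro: less_imp_le)
    qed
  qed
  have M1: "M 1 k = sqrt (lh k / lh 1) * c k" for k
    by (simp add: M_def g_def gs_basis_def[OF t0 e] c_def)
  have Mj: "M j k = sqrt (lh k / lh j) * (if k = j then r j / r (j - 1)
      else if k = 1 \<or> k > j then - c j * c k / (r j * r (j - 1)) else 0)"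
    if "j \<in> {2..CARD('n)}" "k \<in> {1..CARD('n)}" for j k
  proof -
    have "g j = gs_vec t0 e j"
      using that by (auto simp: g_def gs_basis_def[OF t0 e])
    then show ?thesis
      unfolding M_def using gs_vec_inner_e[OF t0 e pos that] by (simp only: r_def c_def)
  qed
  have lr: "0 \<le> sqrt (lh k / lh j)" "sqrt (lh k / lh j) \<le> 1" if "1 \<le> j" "j \<le> k" "k \<le> CARD('n)" for j k
    using lpos[of j] lpos[of k] ldec[OF that] that by auto
  show "\<bar>M j k - (if j = k then 1 else 0)\<bar> \<le> 2 * \<epsilon>" if jk: "j \<in> {1..CARD('n)}" "k \<in> {1..CARD('n)}" for j k
  proof -
    consider "j = 1" "k = 1" | "j = 1" "k \<in> {2..CARD('n)}" | "j \<in> {2..CARD('n)}" "k = 1"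
      | "j \<in> {2..CARD('n)}" "k = j" | "j \<in> {2..CARD('n)}" "j < k" | "j \<in> {2..CARD('n)}" "2 \<le> k" "k < j"
      using jk by fastforce
    then show ?thesis
    proof cases
      case 1
      then show ?thesis
        using lpos[of 1] jk c1b \<sigma>\<epsilon> \<epsilon> by (simp add: M1)
    next
      case 2
      have "\<bar>sqrt (lh k / lh 1) * c k\<bar> \<le> 1 * \<epsilon>"
        using lr[of 1 k] c_le[of k] 2 by (intro abs_mult_le) auto
      then show ?thesis
        using 2 \<epsilon> by (simp add: M1)
    next
      \<comment> \<open>In this column the grading factor may be large; it is absorbed by the
        hypothesis \<open>x\<close>, and dividing by a product that is at least 1/2 costs a factor
        2.\<close>
      case 3
      have "\<bar>(c j * sqrt (lh 1 / lh j)) * c 1\<bar> \<le> \<epsilon> * 1"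
        using x[of j] 3 c1b \<sigma> by (intro abs_mult_le) (auto simp: c_def)
      also have "\<dots> \<le> 2 * \<epsilon> * (r j * r (j - 1))"
        using mult_left_mono[OF rr(1)[of j], of "2 * \<epsilon>"] 3 \<epsilon> \<sigma> mult_left_mono[of "1/2" "1 - \<sigma>" "2 * \<epsilon>"] by simp
      finally have "\<bar>(c j * sqrt (lh 1 / lh j)) * c 1\<bar> / (r j * r (j - 1)) \<le> 2 * \<epsilon>"
        using rpos[of j] rpos1[of j] 3 by (subst pos_divide_le_eq) auto
      moreover have "\<bar>M j k\<bar> = \<bar>(c j * sqrt (lh 1 / lh j)) * c 1\<bar> / (r j * r (j - 1))"
        using 3 jk rpos[of j] rpos1[of j] by (simp add: Mj abs_mult mult_ac)
      ultimately show ?thesis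
        using 3 by auto
    next
      case 4
      have "r j / r (j - 1) \<le> 1"
        using rr[of j] gs_rho_step[OF t0 e, of j] 4 rpos1[of j] by (auto simp: r_def)
      moreover have "1 - \<sigma> \<le> r j / r (j - 1)"
      proof -
        have "(1 - \<sigma>) * r (j - 1) \<le> (1 - \<sigma>) * 1"
          using r[of "j - 1"] 4 \<sigma> by (intro mult_left_mono) auto
        then have "(1 - \<sigma>) * r (j - 1) \<le> r j"
          using r[of j] 4 by auto
        then show ?thesis
          using rpos1[of j] 4 by (subst pos_le_divide_eq) auto
      qed
      ultimately have "\<bar>r j / r (j - 1) - 1\<bar> \<le> 2 * \<epsilon>"
        using \<sigma>\<epsilon> \<epsilon> by linarith
      moreover have "M j k = r j / r (j - 1)"
        using 4 jk lpos[of j] by (simp add: Mj)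
      ultimately show ?thesis
        using 4 by simp
    next
      \<comment> \<open>Above the diagonal the grading factor is at most 1, and the entry contains
        two small coordinates.\<close>
      case 5
      have "\<bar>sqrt (lh k / lh j) * (c j * c k)\<bar> \<le> 1 * (\<epsilon> * \<epsilon>)"
        using lr[of j k] c_le[of j] c_le[of k] 5 jk by (intro abs_mult_le) auto
      also have "\<dots> \<le> \<epsilon> * 1"
        using \<epsilon> \<epsilon>2 by (simp add: mult_left_le)
      also have "\<dots> \<le> 2 * \<epsilon> * (r j * r (j - 1))"
        using mult_left_mono[OF rr(1)[of j], of "2 * \<epsilon>"] 5 \<epsilon> \<sigma> mult_left_mono[of "1/2" "1 - \<sigma>" "2 * \<epsilon>"] by simp
      finally have "\<bar>sqrt (lh k / lh j) * (c j * c k)\<bar> / (r j * r (j - 1)) \<le> 2 * \<epsilon>"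
        using rpos[of j] rpos1[of j] 5 by (subst pos_divide_le_eq) auto
      moreover have "\<bar>M j k\<bar> = \<bar>sqrt (lh k / lh j) * (c j * c k)\<bar> / (r j * r (j - 1))"
        using 5 jk rpos[of j] rpos1[of j] by (simp add: Mj abs_mult mult_ac)
      ultimately show ?thesis
        using 5 by auto
    next
      \<comment> \<open>The grading factor may be arbitrarily large here, but the entry is
        zero.\<close>
      case 6
      then show ?thesis
        using jk \<epsilon> by (simp add: Mj)
    qed
  qed
  show "\<bar>M j 1 + M 1 j - (t0 \<bullet> e j) * (sqrt (lh j / lh 1) - sqrt (lh 1 / lh j))\<bar> \<le> \<epsilon>\<^sup>2"
    if j: "j \<in> {2..CARD('n)}" for j
  proof -
    let ?x = "c j * sqrt (lh 1 / lh j)" and ?R = "r j * r (j - 1)"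
    have R: "?R > 0"
      using rpos[of j] rpos1[of j] j by auto
    have "M j 1 = - (?x * (c 1 / ?R))"
      using j by (simp add: Mj)
    \<comment> \<open>To first order \<open>M j 1\<close> is \<open>- ?x\<close>. Both c_1 and
      \<open>?R\<close> are within \<sigma> of 1, and 2 \<sigma> <= \<epsilon>, so replacing their
      quotient by 1 costs \<epsilon>^2.\<close>
    then have eq: "M j 1 + M 1 j - c j * (sqrt (lh j / lh 1) - sqrt (lh 1 / lh j)) = ?x * (1 - c 1 / ?R)"
      by (simp add: M1 algebra_simps)
    have "\<bar>1 - c 1 / ?R\<bar> \<le> 2 * \<sigma>"
    proof -
      have "c 1 \<le> (1 + 2 * \<sigma>) * (1 - \<sigma>)"
        using c1b \<sigma> mult_left_mono[of \<sigma> "1/2" \<sigma>] by (simp add: algebra_simps)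
      also have "\<dots> \<le> (1 + 2 * \<sigma>) * ?R"
        using rr[OF j] \<sigma> by (intro mult_left_mono) auto
      finally have "c 1 / ?R \<le> 1 + 2 * \<sigma>"
        using R by (subst pos_divide_le_eq) auto
      moreover have "(1 - \<sigma>) * ?R \<le> (1 - \<sigma>) * 1"
        using rr[OF j] \<sigma> by (intro mult_left_mono) auto
      then have "1 - \<sigma> \<le> c 1 / ?R"
        using R c1b by (subst pos_le_divide_eq) auto
      ultimately show ?thesis
        using \<sigma> by linarith
    qed
    then have "\<bar>?x * (1 - c 1 / ?R)\<bar> \<le> \<epsilon> * \<epsilon>"
      using x[OF j] \<sigma>\<epsilon> by (intro abs_mult_le) (auto simp: c_def)
    then show ?thesis
      unfolding eq[unfolded c_def, folded c_def] using eq by (simp add: power2_eq_square c_def)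
  qed
qed

section \<open>Deterministic comparison of the two statistics\<close>

text \<open>In the basis \<open>f\<close> the standardised sample consists of the isotropic directions \<open>y\<close>, and replacing
  \<open>e\<close> by its Gram--Schmidt basis amounts to a perturbation \<open>D\<close> of the identity, of which only the
  entries \<open>(j, 1)\<close> and \<open>(1, j)\<close> matter to first order.\<close>
lemma T_n_L_n_difference:
  fixes t0 :: "real^'n" and e f :: "nat \<Rightarrow> real^'n" and lh :: "nat \<Rightarrow> real" and \<epsilon> \<delta> :: real
  defines "p \<equiv> real CARD('n)"
  defines "d \<equiv> 2 * p\<^sup>2 * \<epsilon>"
  defines "E \<equiv> \<epsilon>\<^sup>2 + (20 * d\<^sup>2 + 4 * p * \<delta> * d)"
  assumes t0: "norm t0 = 1" and e: "onb e" and sign: "t0 \<bullet> e 1 \<ge> 0"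
    and lpos: "\<And>j. j \<in> {1..CARD('n)} \<Longrightarrow> lh j > 0"
    and ldec: "\<And>j k. 1 \<le> j \<Longrightarrow> j \<le> k \<Longrightarrow> k \<le> CARD('n) \<Longrightarrow> lh k \<le> lh j"
    and x: "\<And>j. j \<in> {2..CARD('n)} \<Longrightarrow> \<bar>(t0 \<bullet> e j) * sqrt (lh 1 / lh j)\<bar> \<le> \<epsilon>"
    and \<epsilon>: "0 \<le> \<epsilon>" "8 * p\<^sup>2 * \<epsilon> \<le> 1"
    and th: "\<And>j. j \<in> {2..CARD('n)} \<Longrightarrow> th j = e j"
    and f: "onb f" and iso: "near_iso4 \<delta> n y" and unit: "\<And>i. i < n \<Longrightarrow> norm (y i) = 1"
    and second: "\<And>a b. avg n (\<lambda>i. (a \<bullet> y i) * (b \<bullet> y i)) = (a \<bullet> b) / p"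
    and \<tau>: "\<And>i. i < n \<Longrightarrow> \<tau> i > 0"
    and U: "\<And>i k. i < n \<Longrightarrow> k \<in> {1..CARD('n)} \<Longrightarrow> e k \<bullet> U i = \<tau> i * sqrt (lh k) * (f k \<bullet> y i)"
  shows "\<bar>T_n t0 n U (V_tilde t0 lh th) - L_n t0 n (spec_mat e lh) (lh 1)\<bar>
    \<le> real n * (p\<^sup>2 * (p + 2)) * (E * (E + 4 * \<epsilon>))"
proof -
  let ?I = "{1..CARD('n)}" and ?J = "{2..CARD('n)}"
  have p1: "1 \<le> p"
    using one_le_card[where 'a = 'n] unfolding p_def by linarith
  have "1 * p * \<epsilon> \<le> p * p * \<epsilon>"
    using p1 \<epsilon>(1) by (intro mult_right_mono) auto
  then have p\<epsilon>: "p * \<epsilon> \<le> 1/2"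
    using \<epsilon>(2) by (simp add: power2_eq_square)
  define g where "g = gs_basis t0 e"
  define M where "M j k = sqrt (lh k / lh j) * (g j \<bullet> e k)" for j k
  note small = gs_basis_change_small[OF t0 e sign lpos ldec x \<epsilon>(1) p\<epsilon>[unfolded p_def], folded g_def, folded M_def]
  have rho: "gs_rho t0 e j > 0" if "j \<le> CARD('n)" for j
    by (rule small(1)) (use that in auto)
  have M_le: "\<bar>M j k - (if j = k then 1 else 0)\<bar> \<le> 2 * \<epsilon>" if "j \<in> ?I" "k \<in> ?I" for j k
    by (rule small(2)) (use that in auto)
  have M_first: "\<bar>M j 1 + M 1 j - (t0 \<bullet> e j) * (sqrt (lh j / lh 1) - sqrt (lh 1 / lh j))\<bar> \<le> \<epsilon>\<^sup>2"
    if "j \<in> ?J" for j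
    by (rule small(3)) (use that in auto)
  have g: "onb g"
    unfolding g_def using onb_gs_basis[OF t0 e] rho by blast
  have g1: "g 1 = t0"
    by (simp add: g_def gs_basis_def[OF t0 e])
  have Vt: "V_tilde t0 lh th = spec_mat g lh"
    unfolding g_def using V_tilde_eq_spec_mat[OF t0 e, of th] rho th by blast
  let ?N = "spec_mat g (\<lambda>j. 1 / sqrt (lh j))"
  have N: "mat_isqrt (V_tilde t0 lh th) = ?N"
    unfolding Vt using lpos by (intro mat_isqrt_spec_mat[OF g]) auto
  \<comment> \<open>\<open>D\<close> is M - I carried over to the basis \<open>f\<close>; its p^2
    entries, each at most 2 \<epsilon>, give the operator bound \<open>d\<close>.\<close>
  define \<Delta> where "\<Delta> j k = M j k - (if j = k then 1 else 0)" for j k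
  define D where "D = (\<Sum>j\<in>?I. \<Sum>k\<in>?I. \<Delta> j k *\<^sub>R outer (f j) (f k))"
  have Dv: "D *v z = (\<Sum>j\<in>?I. (\<Sum>k\<in>?I. \<Delta> j k * (f k \<bullet> z)) *\<^sub>R f j)" for z
    by (simp add: D_def matrix_sum_mult_vec matrix_scaleR_mult_vec outer_mult_vec scaleR_sum_left)
  have fD: "f j \<bullet> (D *v z) = (\<Sum>k\<in>?I. \<Delta> j k * (f k \<bullet> z))" if "j \<in> ?I" for j z
    unfolding Dv by (rule onb_inner_sum[OF f that])
  have fDf: "f j \<bullet> (D *v f k) = \<Delta> j k" if "j \<in> ?I" "k \<in> ?I" for j k
  proof -
    have "(\<Sum>l\<in>?I. \<Delta> j l * (f l \<bullet> f k)) = (\<Sum>l\<in>?I. if l = k then \<Delta> j l else 0)"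
      by (intro sum.cong) (use that in \<open>auto simp: onb_inner[OF f]\<close>)
    then show ?thesis
      using that by (simp add: fD)
  qed
  have D: "op_le D d"
    unfolding op_le_def
  proof (intro allI)
    fix a b :: "real^'n"
    have fle: "\<bar>f j \<bullet> z\<bar> \<le> norm z" if "j \<in> ?I" for j z
      using abs_inner_le[of "f j" 1 z "norm z"] onb_norm[OF f that] by simp
    have "a \<bullet> (D *v b) = (\<Sum>j\<in>?I. \<Sum>k\<in>?I. (f j \<bullet> a) * (\<Delta> j k * (f k \<bullet> b)))"
      by (subst onb_parseval[OF f]) (simp add: fD sum_distrib_left)
    also have "\<bar>\<dots>\<bar> \<le> (\<Sum>j\<in>?I. \<Sum>k\<in>?I. norm a * (2 * \<epsilon> * norm b))"
      by (intro order_trans[OF sum_abs] sum_mono abs_mult_le fle) (use M_le in \<open>auto simp: \<Delta>_def\<close>)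
    also have "\<dots> = d * (norm a * norm b)"
      by (simp add: d_def p_def power2_eq_square)
    finally show "\<bar>a \<bullet> (D *v b)\<bar> \<le> d * (norm a * norm b)" .
  qed
  have d: "d \<le> 1/4"
    using \<epsilon>(2) by (simp add: d_def)
  have fy: "f j \<bullet> (y i + D *v y i) = (\<Sum>k\<in>?I. M j k * (f k \<bullet> y i))" if j: "j \<in> ?I" for i j
  proof -
    have "(\<Sum>k\<in>?I. M j k * (f k \<bullet> y i)) = (\<Sum>k\<in>?I. \<Delta> j k * (f k \<bullet> y i) + (if k = j then f k \<bullet> y i else 0))"
      by (intro sum.cong) (auto simp: \<Delta>_def algebra_simps)
    then show ?thesis
      using j by (simp add: inner_add_right fD sum.distrib)
  qed
  \<comment> \<open>The coordinates of V_tilde^(-1/2) U_i along \<open>g\<close> are those of y_i +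
    D y_i along \<open>f\<close>, up to one scalar \<tau>_i that the normalisation in
    \<open>S_n\<close> cancels.\<close>
  have NU: "g j \<bullet> (?N *v U i) = \<tau> i * (f j \<bullet> (y i + D *v y i))" if i: "i < n" and j: "j \<in> ?I" for i j
  proof -
    have "g j \<bullet> U i = (\<Sum>k\<in>?I. (e k \<bullet> g j) * (e k \<bullet> U i))"
      by (rule onb_parseval[OF e])
    then have "g j \<bullet> (?N *v U i) = (\<Sum>k\<in>?I. (1 / sqrt (lh j)) * ((e k \<bullet> g j) * (\<tau> i * sqrt (lh k) * (f k \<bullet> y i))))"
      using i by (simp add: inner_spec_mat[OF g j] U sum_divide_distrib)
    also have "\<dots> = (\<Sum>k\<in>?I. \<tau> i * (M j k * (f k \<bullet> y i)))"
      by (intro sum.cong) (auto simp: M_def real_sqrt_divide inner_commute[of "g j"])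
    finally show ?thesis
      by (simp add: fy[OF j] sum_distrib_left)
  qed
  have normNU: "(norm (?N *v U i))\<^sup>2 = (\<tau> i)\<^sup>2 * (norm (y i + D *v y i))\<^sup>2" if "i < n" for i
    by (simp add: onb_norm2[OF g, of "?N *v U i"] onb_norm2[OF f, of "y i + _"] NU[OF that]
        power_mult_distrib sum_distrib_left)
  define S where "S = S_n n U (V_tilde t0 lh th)"
  have S: "g j \<bullet> (S *v t0) = avg n (\<lambda>i. (f j \<bullet> (y i + D *v y i)) * (f 1 \<bullet> (y i + D *v y i)) / (norm (y i + D *v y i))\<^sup>2)"
    if j: "j \<in> ?I" for j
  proof -
    have "g j \<bullet> (S *v t0) = avg n (\<lambda>i. (g j \<bullet> (?N *v U i)) * (t0 \<bullet> (?N *v U i)) / (norm (?N *v U i))\<^sup>2)"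
      unfolding S_def by (subst S_n_form) (simp_all add: N sym_spec_mat)
    also have "\<dots> = avg n (\<lambda>i. (f j \<bullet> (y i + D *v y i)) * (f 1 \<bullet> (y i + D *v y i)) / (norm (y i + D *v y i))\<^sup>2)"
    proof (rule avg_cong)
      fix i assume i: "i < n"
      have "t0 \<bullet> (?N *v U i) = \<tau> i * (f 1 \<bullet> (y i + D *v y i))"
        using NU[OF i, of 1] by (simp add: g1)
      then show "(g j \<bullet> (?N *v U i)) * (t0 \<bullet> (?N *v U i)) / (norm (?N *v U i))\<^sup>2
        = (f j \<bullet> (y i + D *v y i)) * (f 1 \<bullet> (y i + D *v y i)) / (norm (y i + D *v y i))\<^sup>2"
        using \<tau>[OF i] by (simp add: NU[OF i j] normNU[OF i] power2_eq_square[of "\<tau> i"])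
    qed
    finally show ?thesis .
  qed
  \<comment> \<open>The common first-order term. Its square is (t0 . e_j)^2 (lh_1 / lh_j + lh_j /
    lh_1 - 2), the contribution of index j to \<open>L_n\<close>.\<close>
  define a where "a j = (t0 \<bullet> e j) * (sqrt (lh j / lh 1) - sqrt (lh 1 / lh j))" for j
  have E0: "0 \<le> 20 * d\<^sup>2 + 4 * p * \<delta> * d"
    using near_iso4_nonneg[OF iso] p1 op_le_nonneg[OF D] by auto
  have Sj: "\<bar>g j \<bullet> (S *v t0) - a j / (p + 2)\<bar> \<le> E" if j: "j \<in> ?J" for j
  proof -
    have ji: "j \<in> ?I" "1 \<in> ?I" "j \<noteq> 1"
      using j by auto
    \<comment> \<open>Orthogonality removes both the trace term and the second-moment term, the
      latter because second moments of \<open>y\<close> are exact.\<close>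
    have fj1: "f j \<bullet> f 1 = 0"
      using onb_inner[OF f ji(1,2)] ji(3) by simp
    have "\<bar>g j \<bullet> (S *v t0) - (avg n (\<lambda>i. (f j \<bullet> y i) * (f 1 \<bullet> y i)) + (f j \<bullet> (D *v f 1) + f 1 \<bullet> (D *v f j)) / (p + 2)
         - 2 * (f j \<bullet> f 1) * trace D / (p * (p + 2)))\<bar>
     \<le> (20 * d\<^sup>2 + 4 * p * \<delta> * d) * (norm (f j) * norm (f 1))"
      unfolding S[OF ji(1)] p_def
      by (rule perturbed_scatter_expansion[OF iso unit D d])
    then have 1: "\<bar>g j \<bullet> (S *v t0) - (M j 1 + M 1 j) / (p + 2)\<bar> \<le> 20 * d\<^sup>2 + 4 * p * \<delta> * d"
      using ji by (simp add: second fj1 fDf \<Delta>_def onb_norm[OF f])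
    have "\<bar>(M j 1 + M 1 j) / (p + 2) - a j / (p + 2)\<bar> = \<bar>M j 1 + M 1 j - a j\<bar> / (p + 2)"
      using p1 by (simp add: abs_divide flip: diff_divide_distrib)
    also have "\<dots> \<le> \<bar>M j 1 + M 1 j - a j\<bar> / 1"
      using p1 by (intro divide_left_mono) auto
    also have "\<dots> \<le> \<epsilon>\<^sup>2"
      using M_first[OF j] by (simp add: a_def)
    finally show ?thesis
      using 1 unfolding E_def by linarith
  qed
  have a_le: "\<bar>a j / (p + 2)\<bar> \<le> 2 * \<epsilon>" if j: "j \<in> ?J" for j
  proof -
    have le: "lh j \<le> lh 1" "lh j > 0" "lh 1 > 0"
      using j ldec[of 1 j] lpos[of j] lpos[of 1] by auto
    then have "sqrt (lh j / lh 1) \<le> 1" "1 \<le> sqrt (lh 1 / lh j)" "0 \<le> sqrt (lh j / lh 1)"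
      by auto
    then have "\<bar>sqrt (lh j / lh 1) - sqrt (lh 1 / lh j)\<bar> \<le> \<bar>sqrt (lh 1 / lh j)\<bar>"
      by linarith
    then have "\<bar>a j\<bar> \<le> \<bar>(t0 \<bullet> e j) * sqrt (lh 1 / lh j)\<bar>"
      unfolding a_def abs_mult by (intro mult_left_mono) auto
    then have "\<bar>a j\<bar> \<le> 2 * \<epsilon>"
      using x[OF j] \<epsilon> by linarith
    moreover have "\<bar>a j / (p + 2)\<bar> \<le> \<bar>a j\<bar> / 1"
      unfolding abs_divide using p1 by (intro divide_left_mono) auto
    ultimately show ?thesis
      by linarith
  qed
  have I: "?I = insert 1 ?J"
    by auto
  have proj: "(norm ((mat 1 - outer t0 t0) *v z))\<^sup>2 = (\<Sum>j\<in>?J. (g j \<bullet> z)\<^sup>2)" for z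
  proof -
    let ?z = "(mat 1 - outer t0 t0) *v z"
    have z: "?z = z - (t0 \<bullet> z) *\<^sub>R t0"
      by (simp add: matrix_vector_mult_diff_rdistrib outer_mult_vec)
    have "g 1 \<bullet> ?z = 0"
      using t0 by (simp add: z g1 inner_diff_right norm_eq_1)
    moreover have "g j \<bullet> ?z = g j \<bullet> z" if "j \<in> ?J" for j
      using that onb_inner[OF g, of j 1] by (simp add: z inner_diff_right g1)
    ultimately show ?thesis
      unfolding onb_norm2[OF g, of ?z] I by simp
  qed
  have T: "T_n t0 n U (V_tilde t0 lh th) = real n * p * (p + 2) * (\<Sum>j\<in>?J. (g j \<bullet> (S *v t0))\<^sup>2)"
    unfolding T_n_def proj by (simp add: p_def S_def)
  \<comment> \<open>The constant 2 is distributed over the coordinates by Parseval's identity for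
    the unit vector t0; the summand at index 1 is zero.\<close>
  have L: "L_n t0 n (spec_mat e lh) (lh 1) = real n * p * (p + 2) * (\<Sum>j\<in>?J. (a j / (p + 2))\<^sup>2)"
  proof -
    let ?c = "\<lambda>j. e j \<bullet> t0"
    have inv: "matrix_inv (spec_mat e lh) = spec_mat e (\<lambda>j. 1 / lh j)"
      using lpos by (intro matrix_inv_spec_mat[OF e]) force
    have "(\<Sum>j\<in>?I. (?c j)\<^sup>2) = 1"
      using onb_norm2[OF e, of t0] t0 by simp
    then have "lh 1 * (t0 \<bullet> (matrix_inv (spec_mat e lh) *v t0)) + (1 / lh 1) * (t0 \<bullet> (spec_mat e lh *v t0)) - 2
      = (\<Sum>j\<in>?I. lh 1 * (1 / lh j * (?c j)\<^sup>2)) + (\<Sum>j\<in>?I. (1 / lh 1) * (lh j * (?c j)\<^sup>2)) - 2 * (\<Sum>j\<in>?I. (?c j)\<^sup>2)"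
      unfolding inv spec_mat_quad by (simp only: sum_distrib_left)
    also have "\<dots> = (\<Sum>j\<in>?I. (?c j)\<^sup>2 * (lh 1 / lh j + lh j / lh 1 - 2))"
      by (simp add: sum_distrib_left algebra_simps sum.distrib sum_subtractf)
    also have "\<dots> = (\<Sum>j\<in>?J. (?c j)\<^sup>2 * (lh 1 / lh j + lh j / lh 1 - 2))"
      using lpos[of 1] unfolding I by simp
    also have "\<dots> = (\<Sum>j\<in>?J. (a j)\<^sup>2)"
    proof (rule sum.cong)
      fix j assume j: "j \<in> ?J"
      then have l: "lh j > 0" "lh 1 > 0"
        using lpos by auto
      then have "(sqrt (lh j / lh 1))\<^sup>2 = lh j / lh 1" "(sqrt (lh 1 / lh j))\<^sup>2 = lh 1 / lh j"
        "sqrt (lh j / lh 1) * sqrt (lh 1 / lh j) = 1"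
        by (simp_all flip: real_sqrt_mult)
      then have "(sqrt (lh j / lh 1) - sqrt (lh 1 / lh j))\<^sup>2 = lh 1 / lh j + lh j / lh 1 - 2"
        by (simp only: power2_diff mult.assoc)
      then show "(?c j)\<^sup>2 * (lh 1 / lh j + lh j / lh 1 - 2) = (a j)\<^sup>2"
        by (simp add: a_def power_mult_distrib inner_commute)
    qed simp
    finally have *: "lh 1 * (t0 \<bullet> (matrix_inv (spec_mat e lh) *v t0)) + (1 / lh 1) * (t0 \<bullet> (spec_mat e lh *v t0)) - 2
      = (\<Sum>j\<in>?J. (a j)\<^sup>2)" .
    have "L_n t0 n (spec_mat e lh) (lh 1) = real n * p / (p + 2) * (\<Sum>j\<in>?J. (a j)\<^sup>2)"
      unfolding L_n_def * p_def ..
    also have "\<dots> = real n * p * (p + 2) * (\<Sum>j\<in>?J. (a j / (p + 2))\<^sup>2)"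
      using p1 by (simp add: power_divide power2_eq_square[of "p + 2"] flip: sum_divide_distrib)
    finally show ?thesis .
  qed
  \<comment> \<open>Difference of squares: a_j / (p + 2) is at most 2 \<epsilon>, so the sum of the
    two numbers is at most E + 4 \<epsilon>. With \<delta> comparable to \<epsilon> the product is
    of third order.\<close>
  have "\<bar>(g j \<bullet> (S *v t0))\<^sup>2 - (a j / (p + 2))\<^sup>2\<bar> \<le> E * (E + 4 * \<epsilon>)" if j: "j \<in> ?J" for j
  proof -
    let ?s = "g j \<bullet> (S *v t0)" and ?b = "a j / (p + 2)"
    have "?s\<^sup>2 - ?b\<^sup>2 = (?s - ?b) * (?s + ?b)"
      by (simp add: power2_eq_square algebra_simps)
    moreover have "\<bar>(?s - ?b) * (?s + ?b)\<bar> \<le> E * (E + 4 * \<epsilon>)"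
      using Sj[OF j] a_le[OF j] by (intro abs_mult_le) linarith+
    ultimately show ?thesis
      by simp
  qed
  then have "\<bar>\<Sum>j\<in>?J. (g j \<bullet> (S *v t0))\<^sup>2 - (a j / (p + 2))\<^sup>2\<bar> \<le> (\<Sum>j\<in>?J. E * (E + 4 * \<epsilon>))"
    by (intro order_trans[OF sum_abs] sum_mono)
  also have "\<dots> = real (card ?J) * (E * (E + 4 * \<epsilon>))"
    by simp
  also have "\<dots> \<le> p * (E * (E + 4 * \<epsilon>))"
  proof (intro mult_right_mono mult_nonneg_nonneg add_nonneg_nonneg)
    show "0 \<le> E"
      using E0 by (simp add: E_def)
    show "real (card ?J) \<le> p"
      by (simp add: p_def)
  qed (use \<epsilon>(1) E0 in \<open>auto simp: E_def\<close>)
  finally have "real n * p * (p + 2) * \<bar>\<Sum>j\<in>?J. (g j \<bullet> (S *v t0))\<^sup>2 - (a j / (p + 2))\<^sup>2\<bar>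
      \<le> real n * p * (p + 2) * (p * (E * (E + 4 * \<epsilon>)))"
    using p1 by (intro mult_left_mono) auto
  moreover have "\<bar>T_n t0 n U (V_tilde t0 lh th) - L_n t0 n (spec_mat e lh) (lh 1)\<bar>
     = real n * p * (p + 2) * \<bar>\<Sum>j\<in>?J. (g j \<bullet> (S *v t0))\<^sup>2 - (a j / (p + 2))\<^sup>2\<bar>"
    using p1 unfolding T L by (simp add: sum_subtractf abs_mult flip: right_diff_distrib)
  ultimately show ?thesis
    by (simp add: power2_eq_square mult_ac)
qed

text \<open>Put c = t0 . e_j, \<kappa> = sqrt (s lam_1 / lh_j), and let f_j be the vectors of
  \<open>transformed_onb\<close>. As A t0 = sqrt lam_1 t0, the numbers t0 . (I + H) f_j and t0 . (I
  + H)^-1 f_j equal \<kappa> c and c / \<kappa>. Both matrices are I + O(r), so \<kappa> c - c /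
  \<kappa> = O(r), and the eigenvalue gap keeps \<kappa> above 1. What gets bounded is \<kappa> |c|
  rather than |c|, which produces the grading.\<close>

lemma eigenvector_deviation:
  fixes t0 :: "real^'n" and b e :: "nat \<Rightarrow> real^'n" and H Bi :: "real^'n^'n"
  assumes b: "onb b" "b 1 = t0" and lam: "\<And>j. j \<in> {1..CARD('n)} \<Longrightarrow> lam j > 0"
    and p2: "2 \<le> CARD('n)"
    and lam2: "\<And>j. j \<in> {2..CARD('n)} \<Longrightarrow> lam j \<le> lam 2" and gap: "lam 1 \<ge> (1 + \<eta>) * lam 2" and \<eta>: "\<eta> > 0"
    and A: "A = spec_mat b (\<lambda>j. sqrt (lam j))"
    and H: "sym_mat H" "op_le H r" and r: "r \<le> 1/2" "4 * (1 + \<eta>) * r \<le> \<eta>"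
    and Bi: "sym_mat Bi" "\<And>x. (mat 1 + H) *v (Bi *v x) = x" "\<And>x. Bi *v ((mat 1 + H) *v x) = x"
    and s: "s > 0" and V: "s *\<^sub>R (A ** Bi ** Bi ** A) = spec_mat e lh" and e: "onb e"
    and ldec: "\<And>j k. 1 \<le> j \<Longrightarrow> j \<le> k \<Longrightarrow> k \<le> CARD('n) \<Longrightarrow> lh k \<le> lh j"
  shows eigenvalue_pos: "j \<in> {1..CARD('n)} \<Longrightarrow> lh j > 0"
    and eigenvector_deviation_le: "j \<in> {2..CARD('n)} \<Longrightarrow> \<bar>(t0 \<bullet> e j) * sqrt (lh 1 / lh j)\<bar> \<le> 6 * (2 + \<eta>) / \<eta> * r"
    and transformed_onb: "onb (\<lambda>j. sqrt (s / lh j) *\<^sub>R (Bi *v (A *v e j)))"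
proof -
  let ?I = "{1..CARD('n)}" and ?J = "{2..CARD('n)}"
  have r0: "0 \<le> r"
    by (rule op_le_nonneg[OF H(2)])
  have Asym: "sym_mat A"
    unfolding A by (rule sym_spec_mat)
  have Bv: "(mat 1 + H) *v x = x + H *v x" for x
    by (simp add: matrix_vector_mult_add_rdistrib)
  have form: "x \<bullet> (spec_mat e lh *v y) = s * ((Bi *v (A *v x)) \<bullet> (Bi *v (A *v y)))" for x y
    unfolding V[symmetric]
    by (simp add: matrix_scaleR_mult_vec sym_mat_inner[OF Asym] sym_mat_inner[OF Bi(1)] flip: matrix_vector_mul_assoc)
  have lh: "lh j = s * (norm (Bi *v (A *v e j)))\<^sup>2" if "j \<in> ?I" for j
    using form[of "e j" "e j"] that by (simp add: inner_spec_mat[OF e] onb_inner[OF e] power2_norm_eq_inner)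
  have pos: "lh j > 0" if j: "j \<in> ?I" for j
  proof -
    have "A *v e j \<noteq> 0"
    proof
      assume "A *v e j = 0"
      then have "e j \<bullet> (A *v e j) = 0"
        by simp
      moreover have "posdef A"
        unfolding A posdef_spec_mat[OF b(1)] using lam by auto
      moreover have "e j \<noteq> 0"
        using onb_norm[OF e j] by auto
      ultimately show False
        unfolding posdef_def by (metis less_irrefl)
    qed
    then have "Bi *v (A *v e j) \<noteq> 0"
      using Bi(2)[of "A *v e j"] by auto
    then show ?thesis
      using s by (simp add: lh[OF j])
  qed
  then show "j \<in> ?I \<Longrightarrow> lh j > 0" for j .
  let ?f = "\<lambda>j. sqrt (s / lh j) *\<^sub>R (Bi *v (A *v e j))"
  show f: "onb ?f"
    unfolding onb_def
  proof (intro ballI)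
    fix j k assume jk: "j \<in> ?I" "k \<in> ?I"
    have "s * ((Bi *v (A *v e j)) \<bullet> (Bi *v (A *v e k))) = lh j * (if j = k then 1 else 0)"
      using form[of "e j" "e k"] jk by (simp add: inner_spec_mat[OF e] onb_inner[OF e])
    then have *: "(Bi *v (A *v e j)) \<bullet> (Bi *v (A *v e k)) = lh j / s * (if j = k then 1 else 0)"
      using s by (simp add: field_simps)
    then show "?f j \<bullet> ?f k = (if j = k then 1 else 0)"
    proof -
      have "sqrt (s / lh j) * sqrt (s / lh j) = s / lh j"
        using s pos[OF jk(1)] by simp
      then show ?thesis
        using * s pos[OF jk(1)] by (auto simp: mult.assoc[symmetric])
    qed
  qed
  have Bi_le: "(1 - r) * norm (Bi *v x) \<le> norm x" for x
    using op_le_id_plus(2)[OF H(2), of "Bi *v x"] Bi(2)[of x] by (simp add: Bv)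
  have Bi_le2: "norm (Bi *v x) \<le> 2 * norm x" for x
  proof -
    have "1/2 * norm (Bi *v x) \<le> (1 - r) * norm (Bi *v x)"
      using r by (intro mult_right_mono) auto
    then show ?thesis
      using Bi_le[of x] by linarith
  qed
  have A2: "(norm (A *v x))\<^sup>2 = (\<Sum>j\<in>?I. lam j * (b j \<bullet> x)\<^sup>2)" for x
    unfolding onb_norm2[OF b(1), of "A *v x"]
    by (intro sum.cong) (use lam in \<open>auto simp: A inner_spec_mat[OF b(1)] power_mult_distrib less_imp_le\<close>)
  have lam2pos: "lam 2 > 0"
    using lam p2 by auto
  have lam12: "lam 2 \<le> lam 1"
    using gap \<eta> lam2pos by (smt (verit) mult_less_cancel_right1)
  have lam1: "lam j \<le> lam 1" if "j \<in> ?I" for j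
    using that lam2[of j] lam12 by (cases "j = 1") auto
  have A_le: "(norm (A *v x))\<^sup>2 \<le> lam 1 * (norm x)\<^sup>2" for x
    unfolding A2 onb_norm2[OF b(1), of x] sum_distrib_left by (intro sum_mono mult_right_mono lam1) auto
  have A_le2: "(norm (A *v x))\<^sup>2 \<le> lam 2 * (norm x)\<^sup>2" if "t0 \<bullet> x = 0" for x
    unfolding A2 onb_norm2[OF b(1), of x] sum_distrib_left
  proof (rule sum_mono)
    fix j assume "j \<in> ?I"
    then show "lam j * (b j \<bullet> x)\<^sup>2 \<le> lam 2 * (b j \<bullet> x)\<^sup>2"
      using that b(2) lam2[of j] by (cases "j = 1") (auto intro: mult_right_mono)
  qed
  have lh1: "lh 1 \<le> 4 * (s * lam 1)"
  proof -
    have "(norm (Bi *v (A *v e 1)))\<^sup>2 \<le> (2 * norm (A *v e 1))\<^sup>2"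
      by (intro power_mono Bi_le2) auto
    also have "\<dots> \<le> 4 * (lam 1 * (norm (e 1))\<^sup>2)"
      using A_le[of "e 1"] by (simp add: power_mult_distrib)
    finally show ?thesis
      using s onb_norm[OF e, of 1] by (simp add: lh mult_ac)
  qed
  \<comment> \<open>Courant-Fischer by hand: the plane of e_1 and e_2 contains a nonzero vector
    orthogonal to t0; on unit vectors of this kind the estimated form is at least lh_2 and the form
    of A^2 at most lam_2.\<close>
  have lh2: "(1 - r)\<^sup>2 * lh 2 \<le> s * lam 2"
  proof -
    have I12: "1 \<in> ?I" "2 \<in> ?I"
      using p2 by auto
    have ee: "e 1 \<bullet> e 1 = 1" "e 2 \<bullet> e 2 = 1" "e 1 \<bullet> e 2 = 0" "e 2 \<bullet> e 1 = 0"
      using I12 by (simp_all add: onb_inner[OF e])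
    obtain \<alpha> \<beta> :: real where ab: "\<alpha>\<^sup>2 + \<beta>\<^sup>2 > 0" "\<alpha> * (t0 \<bullet> e 1) + \<beta> * (t0 \<bullet> e 2) = 0"
    proof (cases "t0 \<bullet> e 1 = 0")
      case True
      then show ?thesis
        using that[of 1 0] by simp
    next
      case False
      then have "(t0 \<bullet> e 2)\<^sup>2 + (- (t0 \<bullet> e 1))\<^sup>2 > 0"
        by (simp add: add_nonneg_pos)
      then show ?thesis
        using that[of "t0 \<bullet> e 2" "- (t0 \<bullet> e 1)"] by simp
    qed
    define x where "x = \<alpha> *\<^sub>R e 1 + \<beta> *\<^sub>R e 2"
    have x0: "t0 \<bullet> x = 0"
      using ab by (simp add: x_def inner_add_right)
    have nx: "(norm x)\<^sup>2 = \<alpha>\<^sup>2 + \<beta>\<^sup>2"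
      unfolding power2_norm_eq_inner by (simp add: x_def inner_add_left inner_add_right ee power2_eq_square)
    have "spec_mat e lh *v x = (\<alpha> * lh 1) *\<^sub>R e 1 + (\<beta> * lh 2) *\<^sub>R e 2"
      using spec_mat_eigen[OF e I12(1), of lh] spec_mat_eigen[OF e I12(2), of lh]
      by (simp add: x_def matrix_vector_right_distrib matrix_vector_mult_scaleR)
    then have "x \<bullet> (spec_mat e lh *v x) = \<alpha>\<^sup>2 * lh 1 + \<beta>\<^sup>2 * lh 2"
      by (simp add: x_def inner_add_left inner_add_right ee power2_eq_square)
    then have "s * (norm (Bi *v (A *v x)))\<^sup>2 = \<alpha>\<^sup>2 * lh 1 + \<beta>\<^sup>2 * lh 2"
      using form[of x x] by (simp add: power2_norm_eq_inner)
    moreover have "\<alpha>\<^sup>2 * lh 2 \<le> \<alpha>\<^sup>2 * lh 1"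
      using ldec[of 1 2] p2 by (intro mult_left_mono) auto
    ultimately have "lh 2 * (norm x)\<^sup>2 \<le> s * (norm (Bi *v (A *v x)))\<^sup>2"
      unfolding nx by (simp add: algebra_simps)
    then have "(1 - r)\<^sup>2 * (lh 2 * (norm x)\<^sup>2) \<le> (1 - r)\<^sup>2 * (s * (norm (Bi *v (A *v x)))\<^sup>2)"
      by (intro mult_left_mono) auto
    also have "\<dots> = s * ((1 - r) * norm (Bi *v (A *v x)))\<^sup>2"
      by (simp add: power_mult_distrib)
    also have "\<dots> \<le> s * (norm (A *v x))\<^sup>2"
      using s r by (intro mult_left_mono power_mono Bi_le) auto
    also have "\<dots> \<le> s * (lam 2 * (norm x)\<^sup>2)"
      using s by (intro mult_left_mono A_le2 x0) auto
    finally have "((1 - r)\<^sup>2 * lh 2) * (norm x)\<^sup>2 \<le> (s * lam 2) * (norm x)\<^sup>2"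
      by (simp add: mult_ac)
    then show ?thesis
      using ab(1) nx by (metis mult_le_cancel_right_pos)
  qed
  \<comment> \<open>4 (1 + \<eta>) r <= \<eta> says that half of the gap survives the factor 1 - 2
    r, which is at most (1 - r)^2.\<close>
  have rr: "(1 + \<eta>) * (1 - r)\<^sup>2 \<ge> 1 + \<eta> / 2"
  proof -
    have "(1 + \<eta>) * (1 - 2 * r) \<le> (1 + \<eta>) * (1 - r)\<^sup>2"
      using \<eta> by (intro mult_left_mono) (auto simp: power2_diff)
    then show ?thesis
      using r(2) by (simp add: algebra_simps)
  qed
  show "\<bar>(t0 \<bullet> e j) * sqrt (lh 1 / lh j)\<bar> \<le> 6 * (2 + \<eta>) / \<eta> * r" if j: "j \<in> ?J" for j
  proof -
    have ji: "j \<in> ?I"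
      using j by auto
    have l: "lh j > 0" "lh 1 > 0" "lam 1 > 0"
      using pos[OF ji] pos[of 1] lam[of 1] by auto
    define c where "c = t0 \<bullet> e j"
    define \<kappa> where "\<kappa> = sqrt (s * lam 1 / lh j)"
    have \<kappa>pos: "\<kappa> > 0"
      using s l by (simp add: \<kappa>_def)
    have At0: "A *v t0 = sqrt (lam 1) *\<^sub>R t0"
      using spec_mat_eigen[OF b(1), of 1] b(2) by (simp add: A)
    have 1: "t0 \<bullet> ((mat 1 + H) *v ?f j) = \<kappa> * c"
    proof -
      have "t0 \<bullet> ((mat 1 + H) *v ?f j) = sqrt (s / lh j) * ((A *v t0) \<bullet> e j)"
        by (simp add: matrix_vector_mult_scaleR Bi(2) sym_mat_inner[OF Asym])
      also have "\<dots> = \<kappa> * c"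
        by (simp add: At0 c_def \<kappa>_def flip: real_sqrt_mult)
      finally show ?thesis .
    qed
    have 2: "t0 \<bullet> (Bi *v ?f j) = c / \<kappa>"
    proof -
      have "lh j * c = s * ((Bi *v (A *v t0)) \<bullet> (Bi *v (A *v e j)))"
        using form[of t0 "e j"] by (simp add: spec_mat_eigen[OF e ji] c_def)
      also have "\<dots> = s * sqrt (lam 1) * (t0 \<bullet> (Bi *v (Bi *v (A *v e j))))"
        by (simp add: At0 matrix_vector_mult_scaleR sym_mat_inner[OF Bi(1)])
      finally have *: "t0 \<bullet> (Bi *v (Bi *v (A *v e j))) = lh j * c / (s * sqrt (lam 1))"
        using s l by (simp add: field_simps)
      have "t0 \<bullet> (Bi *v ?f j) = sqrt (s / lh j) * (lh j * c / (s * sqrt (lam 1)))"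
        by (simp add: matrix_vector_mult_scaleR *)
      also have "\<dots> = (sqrt s * (sqrt (lh j) * sqrt (lh j)) * c) / (sqrt (lh j) * ((sqrt s * sqrt s) * sqrt (lam 1)))"
        using s l by (simp add: real_sqrt_divide)
      also have "\<dots> = c / \<kappa>"
      proof -
        have "sqrt s \<noteq> 0" "sqrt (lh j) \<noteq> 0" "sqrt (lam 1) \<noteq> 0"
          using s l by auto
        then show ?thesis
          unfolding \<kappa>_def real_sqrt_divide real_sqrt_mult by (simp add: divide_simps del: real_sqrt_mult_self)
      qed
      finally show ?thesis .
    qed
    have "norm (?f j) = 1"
      by (rule onb_norm[OF f ji])
    have nb: "norm (Bi *v ?f j) \<le> 2"
      using Bi_le2[of "?f j"] \<open>norm (?f j) = 1\<close> by simp
    \<comment> \<open>From f_j = (I + H) Bi f_j; the two terms on the right have norm at most r and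
      2 r.\<close>
    have "(mat 1 + H) *v ?f j - Bi *v ?f j = H *v ?f j + H *v (Bi *v ?f j)"
      using Bi(2)[of "?f j"] unfolding Bv by (simp add: algebra_simps)
    then have "\<kappa> * c - c / \<kappa> = t0 \<bullet> (H *v ?f j) + t0 \<bullet> (H *v (Bi *v ?f j))"
      using 1 2 by (metis inner_add_right inner_diff_right)
    moreover have "norm t0 = 1"
      using onb_norm[OF b(1), of 1] b(2) by simp
    then have "\<bar>t0 \<bullet> (H *v ?f j)\<bar> \<le> r" "\<bar>t0 \<bullet> (H *v (Bi *v ?f j))\<bar> \<le> r * norm (Bi *v ?f j)"
      using op_le_inner[OF H(2), of t0 "?f j"] op_le_inner[OF H(2), of t0 "Bi *v ?f j"] \<open>norm (?f j) = 1\<close>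
      by simp_all
    moreover have "r * norm (Bi *v ?f j) \<le> r * 2"
      using nb r0 by (rule mult_left_mono)
    ultimately have diff: "\<bar>\<kappa> * c - c / \<kappa>\<bar> \<le> 3 * r"
      by linarith
    have \<kappa>2: "\<kappa>\<^sup>2 \<ge> 1 + \<eta> / 2"
    proof -
      have "(1 + \<eta> / 2) * lh j \<le> ((1 + \<eta>) * (1 - r)\<^sup>2) * lh 2"
        using rr ldec[of 2 j] j l \<eta> by (intro mult_mono) auto
      also have "\<dots> \<le> (1 + \<eta>) * (s * lam 2)"
        using mult_left_mono[OF lh2, of "1 + \<eta>"] \<eta> by (simp add: mult.assoc)
      also have "\<dots> \<le> s * lam 1"
        using mult_left_mono[OF gap, of s] s by (simp add: mult_ac)
      finally have "1 + \<eta> / 2 \<le> s * lam 1 / lh j"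
        using l by (subst pos_le_divide_eq) auto
      then show ?thesis
        using s l by (simp add: \<kappa>_def)
    qed
    \<comment> \<open>1 - 1/\<kappa>^2 is at least 1 - 1/(1 + \<eta>/2) = \<eta>/(2 + \<eta>), the
      origin of the factor (2 + \<eta>)/\<eta>.\<close>
    have "\<kappa> * \<bar>c\<bar> * (\<eta> / (2 + \<eta>)) \<le> \<kappa> * \<bar>c\<bar> * (1 - 1 / \<kappa>\<^sup>2)"
    proof (intro mult_left_mono)
      have "1 / \<kappa>\<^sup>2 \<le> 1 / (1 + \<eta> / 2)"
        using \<kappa>2 \<eta> \<kappa>pos by (intro divide_left_mono mult_pos_pos) auto
      also have "\<dots> = 1 - \<eta> / (2 + \<eta>)"
        using \<eta> by (simp add: field_simps)
      finally show "\<eta> / (2 + \<eta>) \<le> 1 - 1 / \<kappa>\<^sup>2"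
        by linarith
    qed (use \<kappa>pos in auto)
    also have "\<dots> = \<bar>\<kappa> * c - c / \<kappa>\<bar>"
    proof -
      have "\<kappa> * c - c / \<kappa> = (\<kappa> * c) * (1 - 1 / \<kappa>\<^sup>2)"
        using \<kappa>pos by (simp add: field_simps power2_eq_square)
      moreover have "1 / \<kappa>\<^sup>2 \<le> 1"
        using \<kappa>2 \<eta> \<kappa>pos by (subst pos_divide_le_eq) auto
      then have "1 - 1 / \<kappa>\<^sup>2 \<ge> 0"
        by simp
      ultimately show ?thesis
        using \<kappa>pos by (simp add: abs_mult)
    qed
    finally have "\<kappa> * \<bar>c\<bar> * (\<eta> / (2 + \<eta>)) \<le> 3 * r"
      using diff by linarith
    then have "\<kappa> * \<bar>c\<bar> * \<eta> \<le> 3 * r * (2 + \<eta>)"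
      using \<eta> by (simp add: pos_divide_le_eq)
    then have \<kappa>c: "\<kappa> * \<bar>c\<bar> \<le> 3 * (2 + \<eta>) / \<eta> * r"
      using \<eta> by (simp add: pos_le_divide_eq mult_ac)
    \<comment> \<open>Passing from \<kappa> to the grading factor costs at most sqrt 4, by
      \<open>lh1\<close>; this turns 3 into 6.\<close>
    have "sqrt (lh 1 / lh j) = \<kappa> * sqrt (lh 1 / (s * lam 1))"
      using s l by (simp add: \<kappa>_def flip: real_sqrt_mult)
    moreover have "lh 1 / (s * lam 1) \<le> 2\<^sup>2"
      using lh1 s l by (subst pos_divide_le_eq) auto
    then have "sqrt (lh 1 / (s * lam 1)) \<le> 2"
      by (intro real_le_lsqrt) (use s l in auto)
    ultimately have "\<bar>c * sqrt (lh 1 / lh j)\<bar> \<le> (\<kappa> * \<bar>c\<bar>) * 2"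
      using \<kappa>pos s l by (simp add: abs_mult mult_ac)
         (metis (no_types, opaque_lifting) abs_ge_zero less_imp_le mult.commute mult.left_commute mult_left_mono mult_nonneg_nonneg)
    also have "\<dots> \<le> 3 * (2 + \<eta>) / \<eta> * r * 2"
      using \<kappa>c by (rule mult_right_mono) simp
    also have "\<dots> = 6 * (2 + \<eta>) / \<eta> * r"
      by simp
    finally show ?thesis
      unfolding c_def .
  qed
qed

lemma decreasing_chain:
  fixes lh :: "nat \<Rightarrow> real"
  assumes "\<And>j. j \<in> {m..<P} \<Longrightarrow> lh (Suc j) \<le> lh j" and "m \<le> j" "j \<le> k" "k \<le> P"
  shows "lh k \<le> lh j"
  using assms(3,4)
proof (induction k rule: dec_induct)
  case (step k)
  then show ?case
    using assms(1)[of k] assms(2) by force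
qed simp

text \<open>The comparison of the statistics is applied with \<epsilon> = K r. The coefficients of
  \<open>K2\<close> come from (K r)^2, 20 d^2 and 4 p \<delta>' d, where d = 2 p^2 K r and \<delta>'
  <= 9 r.\<close>

lemma T_n_L_n_near_isotropic:
  fixes t0 :: "real^'n" and b :: "nat \<Rightarrow> real^'n" and w U :: "nat \<Rightarrow> real^'n" and lam lh :: "nat \<Rightarrow> real"
    and \<eta> \<delta> :: real
  defines "p \<equiv> real CARD('n)"
  defines "K \<equiv> 6 * (2 + \<eta>) / \<eta>"
  defines "r \<equiv> p ^ 3 * (p + 2) * \<delta>"
  defines "K2 \<equiv> K\<^sup>2 + 80 * p ^ 4 * K\<^sup>2 + 72 * p ^ 3 * K"
  assumes b: "onb b" "b 1 = t0" and lam: "\<And>j. j \<in> {1..CARD('n)} \<Longrightarrow> lam j > 0"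
    and p2: "2 \<le> CARD('n)"
    and lam2: "\<And>j. j \<in> {2..CARD('n)} \<Longrightarrow> lam j \<le> lam 2" and gap: "lam 1 \<ge> (1 + \<eta>) * lam 2" and \<eta>: "\<eta> > 0"
    and A: "A = spec_mat b (\<lambda>j. sqrt (lam j))"
    and iso: "near_iso4 \<delta> n w" and unit: "\<And>i. i < n \<Longrightarrow> norm (w i) = 1" and n: "n > 0"
    and U: "\<And>i. i < n \<Longrightarrow> U i = t i *\<^sub>R (A *v w i)" and t: "\<And>i. i < n \<Longrightarrow> t i > 0"
    and r: "24 * p\<^sup>2 * (p + 2) * r \<le> 1" "r \<le> 1/2" "4 * (1 + \<eta>) * r \<le> \<eta>" "8 * p\<^sup>2 * (K * r) \<le> 1"
    and spec: "tyler_ok n U \<Longrightarrow> (\<forall>j\<in>{1..<CARD('n)}. lh (Suc j) \<le> lh j) \<and> onb th \<and> tyler n U = spec_mat th lh"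
  shows "\<bar>T_n t0 n U (V_tilde t0 lh th) - L_n t0 n (tyler n U) (lh 1)\<bar>
    \<le> real n * (p\<^sup>2 * (p + 2)) * (K2 * (K2 + 4 * K) * r ^ 3)"
proof -
  let ?I = "{1..CARD('n)}"
  define Ai where "Ai = spec_mat b (\<lambda>j. 1 / sqrt (lam j))"
  have p1: "1 \<le> p"
    using one_le_card[where 'a = 'n] unfolding p_def by linarith
  have Asym: "sym_mat A" "sym_mat Ai"
    unfolding A Ai_def by (rule sym_spec_mat)+
  have "Ai ** A = mat 1" "A ** Ai = mat 1"
    unfolding A Ai_def spec_mat_mult[OF b(1)] using lam by (intro spec_mat_one[OF b(1)]; force)+
  then have AiA: "Ai *v (A *v x) = x" "A *v (Ai *v x) = x" for x
    by (simp_all add: matrix_vector_mul_assoc)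
  have rr: "r = real CARD('n) ^ 3 * (real CARD('n) + 2) * \<delta>"
    by (simp add: r_def p_def)
  obtain H Bi s where H: "sym_mat H" "op_le H r" "scatter n w H = (1 / p) *\<^sub>R mat 1"
    and Bi: "sym_mat Bi" "\<And>x. (mat 1 + H) *v (Bi *v x) = x" "\<And>x. Bi *v ((mat 1 + H) *v x) = x"
    and s: "s > 0" and ok: "tyler_ok n U" and V: "tyler n U = s *\<^sub>R (A ** Bi ** Bi ** A)"
    using tyler_of_near_isotropic[OF iso unit n rr r(1)[unfolded p_def] Asym AiA U t] unfolding p_def by blast
  have th: "onb th" and tyl: "tyler n U = spec_mat th lh"
    and dec: "\<And>j. j \<in> {1..<CARD('n)} \<Longrightarrow> lh (Suc j) \<le> lh j"
    using spec[OF ok] by auto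
  have ldec: "lh k \<le> lh j" if "1 \<le> j" "j \<le> k" "k \<le> CARD('n)" for j k
    using decreasing_chain[of 1 "CARD('n)" lh j k] dec that by blast
  \<comment> \<open>Flipping the first eigenvector so that t0 . e_1 >= 0 changes neither its outer
    product nor \<open>V_tilde\<close>, in which \<open>th 1\<close> does not occur.\<close>
  define \<sigma> :: real where "\<sigma> = (if t0 \<bullet> th 1 < 0 then -1 else 1)"
  define e where "e j = (if j = 1 then \<sigma> *\<^sub>R th 1 else th j)" for j
  have e: "onb e"
    using th unfolding onb_def e_def by (auto simp: \<sigma>_def)
  have sign: "t0 \<bullet> e 1 \<ge> 0"
    by (simp add: e_def \<sigma>_def)
  have "outer (e j) (e j) = outer (th j) (th j)" for j
    by (auto simp: e_def \<sigma>_def outer_def)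
  then have the: "spec_mat e lh = spec_mat th lh"
    by (simp add: spec_mat_def)
  have Ve: "s *\<^sub>R (A ** Bi ** Bi ** A) = spec_mat e lh"
    using V tyl the by simp
  note dev = eigenvector_deviation[OF b lam p2 lam2 gap \<eta> A H(1,2) r(2,3) Bi s Ve e ldec]
  have lpos: "lh j > 0" if "j \<in> ?I" for j
    by (rule dev(1)) (use that in auto)
  have x: "\<bar>(t0 \<bullet> e j) * sqrt (lh 1 / lh j)\<bar> \<le> K * r" if "j \<in> {2..CARD('n)}" for j
    unfolding K_def by (rule dev(2)) (use that in auto)
  define f where "f j = sqrt (s / lh j) *\<^sub>R (Bi *v (A *v e j))" for j
  have f: "onb f"
    unfolding f_def by (rule dev(3)) auto
  define z where "z i = w i + H *v w i" for i
  define y where "y i = z i /\<^sub>R norm (z i)" for i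
  have r0: "0 \<le> r"
    by (rule op_le_nonneg[OF H(2)])
  have Hw: "norm (H *v w i) \<le> r" if "i < n" for i
    using op_le_norm[OF H(2), of "w i"] unit[OF that] by simp
  have zpos: "norm (z i) > 0" if "i < n" for i
    using norm_perturbed_ge[OF unit[OF that] Hw[OF that]] r(2) unfolding z_def by linarith
  have yu: "norm (y i) = 1" if "i < n" for i
    using zpos[OF that] by (simp add: y_def)
  have yw: "norm (y i - w i) \<le> 2 * r" if "i < n" for i
    unfolding y_def z_def using norm_normalized_perturbed[OF unit[OF that] Hw[OF that]] r(2) by simp
  have isoy: "near_iso4 (\<delta> + 4 * (2 * r)) n y"
    using r0 by (intro near_iso4_perturb[OF iso unit yu yw]) auto
  have second: "avg n (\<lambda>i. (a \<bullet> y i) * (c \<bullet> y i)) = (a \<bullet> c) / p" for a c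
  proof -
    have "avg n (\<lambda>i. (a \<bullet> y i) * (c \<bullet> y i)) = a \<bullet> (scatter n w H *v c)"
      unfolding scatter_form
      by (rule avg_cong) (simp add: y_def z_def power2_eq_square divide_inverse)
    then show ?thesis
      by (simp add: H(3) matrix_scaleR_mult_vec)
  qed
  define \<tau> where "\<tau> i = t i * norm (z i) / sqrt s" for i
  have \<tau>: "\<tau> i > 0" if "i < n" for i
    using t[OF that] zpos[OF that] s by (simp add: \<tau>_def)
  have eU: "e k \<bullet> U i = \<tau> i * sqrt (lh k) * (f k \<bullet> y i)" if i: "i < n" and k: "k \<in> ?I" for i k
  proof -
    have Bz: "Bi *v z i = w i"
      using Bi(3)[of "w i"] by (simp add: z_def matrix_vector_mult_add_rdistrib)
    have "e k \<bullet> U i = t i * ((Bi *v (A *v e k)) \<bullet> z i)"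
      using sym_mat_inner[OF Asym(1), of "e k" "w i"] sym_mat_inner[OF Bi(1), of "A *v e k" "z i"]
      by (simp add: U[OF i] Bz)
    moreover have "f k \<bullet> y i = sqrt (s / lh k) * ((Bi *v (A *v e k)) \<bullet> z i) / norm (z i)"
      by (simp add: f_def y_def divide_inverse)
    ultimately show ?thesis
      using zpos[OF i] s lpos[OF k] by (simp add: \<tau>_def real_sqrt_divide)
  qed
  \<comment> \<open>Passing from w_i to the exactly isotropic y_i moves each direction by at most 2
    r; four factors make this 8 r.\<close>
  define \<delta>' d E where "\<delta>' = \<delta> + 4 * (2 * r)" and "d = 2 * p\<^sup>2 * (K * r)"
    and "E = (K * r)\<^sup>2 + (20 * d\<^sup>2 + 4 * p * \<delta>' * d)"
  have K0: "0 \<le> K"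
    using \<eta> by (simp add: K_def)
  have the2: "th j = e j" if "j \<in> {2..CARD('n)}" for j
    using that by (simp add: e_def)
  have "\<bar>T_n t0 n U (V_tilde t0 lh th) - L_n t0 n (spec_mat e lh) (lh 1)\<bar>
    \<le> real n * (p\<^sup>2 * (p + 2)) * (E * (E + 4 * (K * r)))"
    unfolding E_def d_def \<delta>'_def p_def
    by (rule T_n_L_n_difference[where \<tau> = \<tau>, OF _ e sign lpos ldec x _ _ the2 f isoy yu second[unfolded p_def] \<tau> eU])
       (use b onb_norm[OF b(1), of 1] K0 r0 r(4) in \<open>auto simp: p_def\<close>)
  also have "\<dots> \<le> real n * (p\<^sup>2 * (p + 2)) * (K2 * (K2 + 4 * K) * r ^ 3)"
  proof (rule mult_left_mono)
    have \<delta>0: "0 \<le> \<delta>"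
      by (rule near_iso4_nonneg[OF iso])
    have "1 \<le> p ^ 3 * (p + 2)"
      using p1 mult_mono[of 1 "p ^ 3" 1 "p + 2"] by simp
    then have "\<delta> \<le> r"
      unfolding r_def using mult_right_mono[of 1 "p ^ 3 * (p + 2)" \<delta>] \<delta>0 by simp
    then have "4 * p * \<delta>' * d \<le> 4 * p * (9 * r) * d"
      unfolding \<delta>'_def d_def using p1 K0 r0 by (intro mult_left_mono mult_right_mono) auto
    then have E2: "E \<le> K2 * r\<^sup>2"
      unfolding E_def d_def K2_def
      by (simp add: algebra_simps power2_eq_square power3_eq_cube power4_eq_xxxx)
    have K20: "0 \<le> K2"
      using K0 p1 by (simp add: K2_def)
    have "0 \<le> 4 * p * \<delta>' * d"
      unfolding \<delta>'_def d_def using p1 K0 r0 \<delta>0 by (intro mult_nonneg_nonneg) auto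
    then have E0: "0 \<le> E"
      by (simp add: E_def)
    have "r\<^sup>2 \<le> r"
      using r0 r(2) by (simp add: power2_eq_square mult_left_le)
    then have "K2 * r\<^sup>2 \<le> K2 * r"
      using K20 by (rule mult_left_mono)
    then have "E + 4 * (K * r) \<le> (K2 + 4 * K) * r"
      using E2 by (simp add: algebra_simps)
    then have "E * (E + 4 * (K * r)) \<le> (K2 * r\<^sup>2) * ((K2 + 4 * K) * r)"
      using E0 E2 K0 r0 K20 by (intro mult_mono) auto
    then show "E * (E + 4 * (K * r)) \<le> K2 * (K2 + 4 * K) * r ^ 3"
      by (simp add: power2_eq_square power3_eq_cube mult_ac)
  qed (use p1 in auto)
  finally show ?thesis
    using tyl the by simp
qed

section \<open>The angular Gaussian law\<close>

lemma matrix_vector_mult_borel [measurable]: "(\<lambda>x. (A :: real^'n^'m) *v x) \<in> borel_measurable borel"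
  by (intro borel_measurable_continuous_onI continuous_intros)

section \<open>Lebesgue measure under translations, scalings and linear maps\<close>

lemma nn_integral_lborel_translate:
  fixes f :: "'a::euclidean_space \<Rightarrow> ennreal"
  assumes [measurable]: "f \<in> borel_measurable borel"
  shows "(\<integral>\<^sup>+x. f (c + x) \<partial>lborel) = (\<integral>\<^sup>+x. f x \<partial>lborel)"
proof -
  have "lborel = distr lborel borel (\<lambda>x. c + x)"
    using lborel_affine[of 1 c] by (simp add: density_1)
  then have "(\<integral>\<^sup>+x. f x \<partial>lborel) = (\<integral>\<^sup>+x. f x \<partial>distr lborel borel (\<lambda>x. c + x))"
    by simp
  then show ?thesis
    by (simp add: nn_integral_distr)
qed

lemma nn_integral_lborel_scale:
  fixes f :: "'a::euclidean_space \<Rightarrow> ennreal"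
  assumes [measurable]: "f \<in> borel_measurable borel" and t: "t > 0"
  shows "(\<integral>\<^sup>+x. f x \<partial>lborel) = ennreal (t ^ DIM('a)) * (\<integral>\<^sup>+x. f (t *\<^sub>R x) \<partial>lborel)"
proof -
  have "(\<integral>\<^sup>+x. f x \<partial>lborel) = (\<integral>\<^sup>+x. f x \<partial>density (distr lborel borel (\<lambda>x. 0 + t *\<^sub>R x)) (\<lambda>_. \<bar>t\<bar> ^ DIM('a)))"
    using t by (subst lborel_affine[of t 0]) auto
  then show ?thesis
    using t by (simp add: nn_integral_density nn_integral_distr nn_integral_cmult)
qed

text \<open>Uniqueness of Haar measure: integrating \<open>indicator B (T x) * indicator S y\<close> in two ways
  shows that the image measure is proportional to Lebesgue measure; the unit ball \<open>B\<close> fixes the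
  constant.\<close>
lemma lborel_orthogonal_transformation:
  fixes T :: "real^'n \<Rightarrow> real^'n"
  assumes T: "orthogonal_transformation T"
  shows "distr lborel borel T = lborel"
proof (rule measure_eqI)
  fix S :: "(real^'n) set" assume "S \<in> sets (distr lborel borel T)"
  then have [measurable]: "S \<in> sets borel"
    by simp
  have lin: "linear T" and nT: "\<And>x. norm (T x) = norm x"
    using T by (auto simp: orthogonal_transformation)
  have [measurable]: "T \<in> borel_measurable borel"
    using lin by (intro borel_measurable_continuous_onI linear_continuous_on linear_conv_bounded_linear[THEN iffD1])
  define B where "B = ball (0 :: real^'n) 1"
  have [measurable]: "B \<in> sets borel"
    by (simp add: B_def)
  define v where "v = emeasure lborel B"
  have v: "v \<noteq> 0" "v \<noteq> \<infinity>"
  proof -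
    have "unit_ball_vol (real CARD('n)) > 0"
      by (rule unit_ball_vol_pos) simp
    then have "unit_ball_vol (real CARD('n)) \<noteq> 0"
      by linarith
    then show "v \<noteq> 0" "v \<noteq> \<infinity>"
      by (simp_all add: v_def B_def emeasure_ball)
  qed
  have Bv: "(\<integral>\<^sup>+y. indicator B (c - y) \<partial>lborel) = v" for c :: "real^'n"
  proof -
    have "(\<integral>\<^sup>+y. indicator B (c - y) \<partial>lborel) = (\<integral>\<^sup>+y. indicator (ball c 1) y \<partial>lborel)"
    proof (rule nn_integral_cong)
      fix y
      have "c - y \<in> B \<longleftrightarrow> y \<in> ball c 1"
        by (simp only: B_def mem_ball dist_norm diff_0 norm_minus_cancel)
      then show "indicator B (c - y) = (indicator (ball c 1) y :: ennreal)"
        by (simp only: indicator_def)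
    qed
    then show ?thesis
      by (simp add: v_def B_def emeasure_ball)
  qed
  define T' where "T' = inv T"
  have T': "T (T' x) = x" for x
    unfolding T'_def by (rule surj_f_inv_f[OF orthogonal_transformation_surj[OF T]])
  have "v * emeasure lborel S = (\<integral>\<^sup>+x. indicator B (T x) * (\<integral>\<^sup>+y. indicator S y \<partial>lborel) \<partial>lborel)"
  proof -
    have "indicator B (T x) = (indicator B x :: ennreal)" for x
      by (simp add: indicator_def nT B_def)
    moreover have "(\<integral>\<^sup>+x. indicator B x * emeasure lborel S \<partial>lborel) = v * emeasure lborel S"
      by (subst nn_integral_multc) (auto simp: v_def)
    ultimately show ?thesis
      by simp
  qed
  \<comment> \<open>Translating \<open>y\<close> by \<open>T x\<close> couples the variables; after
    the exchange of integrals, translating \<open>x\<close> by the preimage of \<open>- y\<close>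
    frees the other indicator.\<close>
  also have "\<dots> = (\<integral>\<^sup>+x. (\<integral>\<^sup>+y. indicator B (T x) * indicator S (T x + y) \<partial>lborel) \<partial>lborel)"
  proof (rule nn_integral_cong)
    fix x :: "real^'n"
    have "(\<integral>\<^sup>+y. indicator S y \<partial>lborel) = (\<integral>\<^sup>+y. indicator S (T x + y) \<partial>lborel :: ennreal)"
      by (rule nn_integral_lborel_translate[symmetric]) measurable
    then show "indicator B (T x) * (\<integral>\<^sup>+y. indicator S y \<partial>lborel)
        = (\<integral>\<^sup>+y. indicator B (T x) * indicator S (T x + y) \<partial>lborel :: ennreal)"
      by (simp only:) (subst nn_integral_cmult; measurable)
  qed
  also have "\<dots> = (\<integral>\<^sup>+y. (\<integral>\<^sup>+x. indicator B (T x) * indicator S (T x + y) \<partial>lborel) \<partial>lborel)"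
    by (rule lborel_pair.Fubini'[symmetric]) measurable
  also have "\<dots> = (\<integral>\<^sup>+y. (\<integral>\<^sup>+x. indicator B (T x - y) * indicator S (T x) \<partial>lborel) \<partial>lborel)"
  proof (rule nn_integral_cong)
    fix y :: "real^'n"
    have "(\<integral>\<^sup>+x. indicator B (T x) * indicator S (T x + y) \<partial>lborel)
        = (\<integral>\<^sup>+x. indicator B (T (- T' y + x)) * indicator S (T (- T' y + x) + y) \<partial>lborel :: ennreal)"
      by (rule nn_integral_lborel_translate[symmetric]) measurable
    moreover have "T (- T' y + x) = T x - y" for x
      by (simp only: linear_add[OF lin] linear_neg[OF lin] T') simp
    ultimately show "(\<integral>\<^sup>+x. indicator B (T x) * indicator S (T x + y) \<partial>lborel)
        = (\<integral>\<^sup>+x. indicator B (T x - y) * indicator S (T x) \<partial>lborel :: ennreal)"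
      by simp
  qed
  also have "\<dots> = (\<integral>\<^sup>+x. (\<integral>\<^sup>+y. indicator B (T x - y) * indicator S (T x) \<partial>lborel) \<partial>lborel)"
    by (rule lborel_pair.Fubini') measurable
  also have "\<dots> = (\<integral>\<^sup>+x. v * indicator S (T x) \<partial>lborel)"
    by (simp add: nn_integral_multc Bv)
  also have "\<dots> = v * emeasure lborel {x. T x \<in> S}"
  proof -
    have "(indicator S (T x) :: ennreal) = indicator {x. T x \<in> S} x" for x
      by (simp add: indicator_def)
    moreover have "{x. T x \<in> S} \<in> sets lborel"
      by measurable
    ultimately show ?thesis
      by (simp add: nn_integral_cmult)
  qed
  also have "emeasure lborel {x. T x \<in> S} = emeasure (distr lborel borel T) S"
    by (simp add: emeasure_distr vimage_def)
  finally show "emeasure (distr lborel borel T) S = emeasure lborel S"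
    using v by (simp add: ennreal_mult_cancel_left)
qed simp

lemma nn_integral_lborel_orthogonal:
  fixes T :: "real^'n \<Rightarrow> real^'n"
  assumes T: "orthogonal_transformation T" and [measurable]: "f \<in> borel_measurable borel"
  shows "(\<integral>\<^sup>+x. f (T x) \<partial>lborel) = (\<integral>\<^sup>+x. f x \<partial>lborel)"
proof -
  have "T \<in> borel_measurable borel"
    using T by (intro borel_measurable_continuous_onI linear_continuous_on linear_conv_bounded_linear[THEN iffD1])
      (simp add: orthogonal_transformation)
  then have "(\<integral>\<^sup>+x. f x \<partial>distr lborel borel T) = (\<integral>\<^sup>+x. f (T x) \<partial>lborel)"
    by (simp add: nn_integral_distr)
  then show ?thesis
    by (simp add: lborel_orthogonal_transformation[OF T])
qed

lemma nn_integral_lborel_diagonal: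
  fixes f :: "real^'n \<Rightarrow> ennreal"
  assumes [measurable]: "f \<in> borel_measurable borel" and \<mu>: "\<And>k. \<mu> k > 0"
  shows "(\<integral>\<^sup>+x. f x \<partial>lborel) = ennreal (\<Prod>k\<in>UNIV. \<mu> k) * (\<integral>\<^sup>+x. f (\<chi> k. \<mu> k * x $ k) \<partial>lborel)"
proof -
  have Basis: "(Basis :: (real^'n) set) = range (\<lambda>k. axis k 1)"
    by (auto simp: Basis_vec_def)
  define c where "c j = (\<chi> k. \<mu> k) \<bullet> j" for j :: "real^'n"
  have c: "c (axis k 1) = \<mu> k" for k
    by (simp add: c_def inner_axis)
  have T: "0 + (\<Sum>j\<in>Basis. (c j * (x \<bullet> j)) *\<^sub>R j) = (\<chi> k. \<mu> k * x $ k)" for x :: "real^'n"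
  proof (rule euclidean_eqI)
    fix b :: "real^'n" assume b: "b \<in> Basis"
    then obtain k where "b = axis k 1"
      by (auto simp: Basis)
    moreover have "(\<Sum>j\<in>Basis. (c j * (x \<bullet> j)) *\<^sub>R j) \<bullet> b = c b * (x \<bullet> b)"
      using b by (rule inner_sum_left_Basis)
    ultimately show "(0 + (\<Sum>j\<in>Basis. (c j * (x \<bullet> j)) *\<^sub>R j)) \<bullet> b = (\<chi> k. \<mu> k * x $ k) \<bullet> b"
      by (simp only: add_0 c inner_axis) simp
  qed
  have "inj (\<lambda>k. axis k 1 :: real^'n)"
    by (auto simp: inj_def axis_eq_axis)
  then have "(\<Prod>j\<in>(Basis :: (real^'n) set). \<bar>c j\<bar>) = (\<Prod>k\<in>UNIV. \<bar>\<mu> k\<bar>)"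
    unfolding Basis by (subst prod.reindex) (auto simp: c)
  also have "\<dots> = (\<Prod>k\<in>UNIV. \<mu> k)"
    using \<mu> by (intro prod.cong) (auto simp: abs_of_pos)
  finally have prod: "(\<Prod>j\<in>(Basis :: (real^'n) set). \<bar>c j\<bar>) = (\<Prod>k\<in>UNIV. \<mu> k)" .
  have "c j \<noteq> 0" if "j \<in> Basis" for j
    using that \<mu> by (auto simp: Basis c less_imp_neq[THEN not_sym])
  then have "lborel = density (distr lborel borel (\<lambda>x :: real^'n. \<chi> k. \<mu> k * x $ k)) (\<lambda>_. ennreal (\<Prod>k\<in>UNIV. \<mu> k))"
    using lborel_affine_euclidean[of c 0] unfolding T prod by simp
  then have "(\<integral>\<^sup>+x. f x \<partial>lborel) =
      (\<integral>\<^sup>+x. f x \<partial>density (distr lborel borel (\<lambda>x :: real^'n. \<chi> k. \<mu> k * x $ k)) (\<lambda>_. ennreal (\<Prod>k\<in>UNIV. \<mu> k)))"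
    by simp
  moreover have "(\<lambda>x :: real^'n. \<chi> k. \<mu> k * x $ k) \<in> borel_measurable borel"
    by (intro borel_measurable_continuous_onI continuous_on_vec_lambda continuous_intros)
  ultimately show ?thesis
    by (simp add: nn_integral_density nn_integral_distr nn_integral_cmult)
qed

section \<open>Radial integration of homogeneous functions\<close>

lemma nn_integral_power_FTC:
  assumes "0 \<le> g" "p > 0"
  shows "(\<integral>\<^sup>+t. (if 0 < t \<and> t \<le> g then ennreal (real p * t ^ (p - 1)) else 0) \<partial>lborel) = ennreal (g ^ p)"
proof -
  have "(\<integral>\<^sup>+t. (if 0 < t \<and> t \<le> g then ennreal (real p * t ^ (p - 1)) else 0) \<partial>lborel)
      = (\<integral>\<^sup>+t. ennreal (real p * t ^ (p - 1)) * indicator {0..g} t \<partial>lborel)"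
    by (rule nn_integral_cong_AE, rule AE_mp[OF AE_lborel_singleton[of 0]], rule AE_I2) (auto simp: indicator_def)
  also have "\<dots> = ennreal (g ^ p - 0 ^ p)"
    using assms by (intro nn_integral_FTC_Icc) (auto intro!: derivative_eq_intros simp: One_nat_def)
  finally show ?thesis
    using assms by simp
qed

text \<open>For g < q the interval is empty and the logarithm negative; \<open>ennreal\<close>
  truncates it to 0, so that one formula serves both cases and gauges can be changed without
  comparing g and q.\<close>

lemma nn_integral_inverse_FTC:
  assumes "0 < q" "0 < g" "0 \<le> p"
  shows "(\<integral>\<^sup>+t. (if q < t \<and> t \<le> g then ennreal (p / t) else 0) \<partial>lborel) = ennreal (p * ln (g / q))"
proof (cases "q \<le> g")
  case True
  have "(\<integral>\<^sup>+t. (if q < t \<and> t \<le> g then ennreal (p / t) else 0) \<partial>lborel)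
      = (\<integral>\<^sup>+t. ennreal (p / t) * indicator {q..g} t \<partial>lborel)"
    by (rule nn_integral_cong_AE, rule AE_mp[OF AE_lborel_singleton[of q]], rule AE_I2) (auto simp: indicator_def)
  also have "\<dots> = ennreal (p * ln g - p * ln q)"
    using assms True by (intro nn_integral_FTC_Icc) (auto intro!: derivative_eq_intros)
  finally show ?thesis
    using assms by (simp add: ln_div right_diff_distrib)
next
  case False
  then have "(if q < t \<and> t \<le> g then ennreal (p / t) else 0) = 0" for t
    by auto
  moreover have "p * ln (g / q) \<le> 0"
    using False assms by (intro mult_nonneg_nonpos) (auto simp: ln_le_zero_iff)
  ultimately show ?thesis
    by (simp add: ennreal_neg)
qed

text \<open>Write \<open>g x ^ p\<close> as an integral over \<open>t\<close>, exchange the integrals and rescale \<open>x\<close> by \<open>1/t\<close>.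
  The right-hand side depends on \<open>g\<close> and \<open>q\<close> only through \<open>g / q\<close>, so that one gauge \<open>q\<close> may be
  replaced by another.\<close>
lemma nn_integral_homogeneous:
  fixes q g :: "real^'n \<Rightarrow> real" and h :: "real^'n \<Rightarrow> ennreal"
  defines "p \<equiv> CARD('n)"
  assumes [measurable]: "q \<in> borel_measurable borel" "g \<in> borel_measurable borel" "h \<in> borel_measurable borel"
    and q: "\<And>t x. t > 0 \<Longrightarrow> q (t *\<^sub>R x) = t * q x" and g: "\<And>t x. t > 0 \<Longrightarrow> g (t *\<^sub>R x) = g x"
    and h: "\<And>t x. t > 0 \<Longrightarrow> h (t *\<^sub>R x) = h x"
    and qpos: "\<And>x. x \<noteq> 0 \<Longrightarrow> q x > 0" and gpos: "\<And>x. x \<noteq> 0 \<Longrightarrow> g x > 0"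
  shows "(\<integral>\<^sup>+x. (if q x < 1 then h x * ennreal (g x ^ p) else 0) \<partial>lborel)
    = (\<integral>\<^sup>+x. h x * ennreal (real p * ln (g x / q x)) \<partial>lborel)"
proof -
  have p: "p > 0"
    by (simp add: p_def)
  define \<Phi> where "\<Phi> t x = (if 0 < t \<and> t \<le> g x \<and> q x < 1 then h x * ennreal (real p * t ^ (p - 1)) else 0)" for t x
  define \<Psi> where "\<Psi> t x = (if 0 < t \<and> t \<le> g x \<and> q x < t then h x * ennreal (real p / t) else 0)" for t x
  have nz: "AE x in lborel. x \<noteq> (0 :: real^'n)"
    by (rule AE_lborel_singleton)
  have "(\<integral>\<^sup>+x. (if q x < 1 then h x * ennreal (g x ^ p) else 0) \<partial>lborel) = (\<integral>\<^sup>+x. (\<integral>\<^sup>+t. \<Phi> t x \<partial>lborel) \<partial>lborel)"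
  proof (rule nn_integral_cong_AE, use nz in eventually_elim)
    fix x :: "real^'n" assume "x \<noteq> 0"
    then have "ennreal (g x ^ p) = (\<integral>\<^sup>+t. (if 0 < t \<and> t \<le> g x then ennreal (real p * t ^ (p - 1)) else 0) \<partial>lborel)"
      using gpos p by (intro nn_integral_power_FTC[symmetric]) (auto intro: less_imp_le)
    then have "h x * ennreal (g x ^ p) = (\<integral>\<^sup>+t. h x * (if 0 < t \<and> t \<le> g x then ennreal (real p * t ^ (p - 1)) else 0) \<partial>lborel)"
      by (simp add: nn_integral_cmult)
    then show "(if q x < 1 then h x * ennreal (g x ^ p) else 0) = (\<integral>\<^sup>+t. \<Phi> t x \<partial>lborel)"
      unfolding \<Phi>_def by (auto intro!: nn_integral_cong)
  qed
  also have "\<dots> = (\<integral>\<^sup>+t. (\<integral>\<^sup>+x. \<Phi> t x \<partial>lborel) \<partial>lborel)"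
    unfolding \<Phi>_def by (rule lborel_pair.Fubini') measurable
  also have "\<dots> = (\<integral>\<^sup>+t. (\<integral>\<^sup>+x. \<Psi> t x \<partial>lborel) \<partial>lborel)"
  proof (rule nn_integral_cong)
    fix t :: real
    show "(\<integral>\<^sup>+x. \<Phi> t x \<partial>lborel) = (\<integral>\<^sup>+x. \<Psi> t x \<partial>lborel)"
    proof (cases "t > 0")
      case True
      have "\<Phi> t \<in> borel_measurable borel"
        unfolding \<Phi>_def by measurable
      then have "(\<integral>\<^sup>+x. \<Phi> t x \<partial>lborel) = ennreal ((1 / t) ^ p) * (\<integral>\<^sup>+x. \<Phi> t ((1 / t) *\<^sub>R x) \<partial>lborel)"
        using nn_integral_lborel_scale[of "\<Phi> t" "1 / t"] True by (simp add: p_def)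
      also have "\<dots> = (\<integral>\<^sup>+x. ennreal ((1 / t) ^ p) * \<Phi> t ((1 / t) *\<^sub>R x) \<partial>lborel)"
        unfolding \<Phi>_def by (rule nn_integral_cmult[symmetric]) measurable
      also have "\<dots> = (\<integral>\<^sup>+x. \<Psi> t x \<partial>lborel)"
      proof (rule nn_integral_cong)
        fix x :: "real^'n"
        have "t ^ p = t * t ^ (p - 1)"
          using p by (simp flip: power_Suc)
        then have "(1 / t) ^ p * (real p * t ^ (p - 1)) = real p / t"
          using True by (simp add: field_simps)
        then have e: "ennreal ((1 / t) ^ p) * ennreal (real p * t ^ (p - 1)) = ennreal (real p / t)"
          using True by (simp flip: ennreal_mult)
        have "t * q ((1 / t) *\<^sub>R x) = q x"
          using True q[of "1 / t" x] by simp
        then have c: "q ((1 / t) *\<^sub>R x) < 1 \<longleftrightarrow> q x < t"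
          using True mult_less_cancel_left_pos[of t "q ((1 / t) *\<^sub>R x)" 1] by simp
        have c': "g ((1 / t) *\<^sub>R x) = g x" "h ((1 / t) *\<^sub>R x) = h x"
          using True by (simp_all add: g h)
        show "ennreal ((1 / t) ^ p) * \<Phi> t ((1 / t) *\<^sub>R x) = \<Psi> t x"
          unfolding \<Phi>_def \<Psi>_def c c' using e by (auto simp: mult_ac)
      qed
      finally show ?thesis .
    qed (simp add: \<Phi>_def \<Psi>_def)
  qed
  also have "\<dots> = (\<integral>\<^sup>+x. (\<integral>\<^sup>+t. \<Psi> t x \<partial>lborel) \<partial>lborel)"
    unfolding \<Psi>_def by (rule lborel_pair.Fubini'[symmetric]) measurable
  also have "\<dots> = (\<integral>\<^sup>+x. h x * ennreal (real p * ln (g x / q x)) \<partial>lborel)"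
  proof (rule nn_integral_cong_AE, use nz in eventually_elim)
    fix x :: "real^'n" assume x: "x \<noteq> 0"
    have "(\<integral>\<^sup>+t. \<Psi> t x \<partial>lborel) = (\<integral>\<^sup>+t. h x * (if q x < t \<and> t \<le> g x then ennreal (real p / t) else 0) \<partial>lborel)"
      unfolding \<Psi>_def using qpos[OF x] by (intro nn_integral_cong) auto
    also have "\<dots> = h x * (\<integral>\<^sup>+t. (if q x < t \<and> t \<le> g x then ennreal (real p / t) else 0) \<partial>lborel)"
      by (rule nn_integral_cmult) measurable
    finally show "(\<integral>\<^sup>+t. \<Psi> t x \<partial>lborel) = h x * ennreal (real p * ln (g x / q x))"
      using qpos[OF x] gpos[OF x] by (simp add: nn_integral_inverse_FTC)
  qed
  finally show ?thesis .
qed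

text \<open>Bases are numbered by naturals, coordinates by the type \<open>'n\<close>. An arbitrary
  bijection \<sigma> mediates; sums and products over all indices do not depend on it.\<close>

lemma onb_coordinates:
  assumes b: "onb (b :: nat \<Rightarrow> real^'n)"
  obtains \<sigma> where "bij_betw \<sigma> (UNIV :: 'n set) {1..CARD('n)}"
    "orthogonal_transformation (\<lambda>y :: real^'n. \<Sum>k\<in>UNIV. y $ k *\<^sub>R b (\<sigma> k))"
    "\<And>k y. b (\<sigma> k) \<bullet> (\<Sum>l\<in>UNIV. y $ l *\<^sub>R b (\<sigma> l)) = (y :: real^'n) $ k"
proof -
  obtain \<sigma> where \<sigma>: "bij_betw \<sigma> (UNIV :: 'n set) {1..CARD('n)}"
    using finite_same_card_bij[of "UNIV :: 'n set" "{1..CARD('n)}"] by auto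
  have in_I: "\<sigma> k \<in> {1..CARD('n)}" for k
    using \<sigma> by (auto simp: bij_betw_def)
  have inj: "\<sigma> k = \<sigma> l \<longleftrightarrow> k = l" for k l
    using \<sigma> by (auto simp: bij_betw_def inj_on_def)
  let ?T = "\<lambda>y :: real^'n. \<Sum>k\<in>UNIV. y $ k *\<^sub>R b (\<sigma> k)"
  have coord: "b (\<sigma> k) \<bullet> ?T y = y $ k" for k y
  proof -
    have "b (\<sigma> k) \<bullet> ?T y = (\<Sum>l\<in>UNIV. if l = k then y $ l else 0)"
      unfolding inner_sum_right by (intro sum.cong) (auto simp: onb_inner[OF b in_I in_I] inj)
    then show ?thesis
      by simp
  qed
  have "linear ?T"
    by (intro linearI) (simp_all add: scaleR_left_distrib sum.distrib scaleR_sum_right)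
  moreover have "norm (?T y) = norm y" for y
  proof -
    have "(norm (?T y))\<^sup>2 = (\<Sum>k\<in>UNIV. (b (\<sigma> k) \<bullet> ?T y)\<^sup>2)"
      unfolding onb_norm2[OF b, of "?T y"] by (rule sum.reindex_bij_betw[OF \<sigma>, symmetric])
    also have "\<dots> = (norm y)\<^sup>2"
      by (simp add: coord norm_sq_cart)
    finally show ?thesis
      by simp
  qed
  ultimately show thesis
    using that \<sigma> coord by (simp add: orthogonal_transformation)
qed

text \<open>With T the isometry to the basis \<open>b\<close> and D = diag(lam), the matrix is T
  D^-1 T^-1, so composing with T D leaves T, and only det D enters.\<close>

lemma nn_integral_lborel_spec_mat:
  fixes G :: "real^'n \<Rightarrow> ennreal"
  assumes b: "onb b" and lam: "\<And>j. j \<in> {1..CARD('n)} \<Longrightarrow> lam j > 0" and [measurable]: "G \<in> borel_measurable borel"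
  shows "(\<integral>\<^sup>+x. G (spec_mat b (\<lambda>j. 1 / lam j) *v x) \<partial>lborel)
    = ennreal (\<Prod>j\<in>{1..CARD('n)}. lam j) * (\<integral>\<^sup>+x. G x \<partial>lborel)"
proof -
  obtain \<sigma> where \<sigma>: "bij_betw \<sigma> (UNIV :: 'n set) {1..CARD('n)}"
    and T: "orthogonal_transformation (\<lambda>y :: real^'n. \<Sum>k\<in>UNIV. y $ k *\<^sub>R b (\<sigma> k))"
    and coord: "\<And>k y. b (\<sigma> k) \<bullet> (\<Sum>l\<in>UNIV. y $ l *\<^sub>R b (\<sigma> l)) = (y :: real^'n) $ k"
    by (rule onb_coordinates[OF b]) blast
  define T where "T y = (\<Sum>k\<in>UNIV. y $ k *\<^sub>R b (\<sigma> k))" for y :: "real^'n"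
  note T = T[folded T_def] and coord = coord[folded T_def]
  have \<sigma>I: "\<sigma> k \<in> {1..CARD('n)}" for k
    using \<sigma> by (auto simp: bij_betw_def)
  define \<mu> where "\<mu> k = lam (\<sigma> k)" for k
  have \<mu>: "\<mu> k > 0" for k
    unfolding \<mu>_def by (intro lam \<sigma>I)
  let ?A = "spec_mat b (\<lambda>j. 1 / lam j)"
  have AT: "?A *v T (\<chi> k. \<mu> k * y $ k) = T y" for y
  proof (rule onb_eqI[OF b])
    fix j assume j: "j \<in> {1..CARD('n)}"
    then obtain k where k: "j = \<sigma> k"
      using \<sigma> by (metis bij_betw_imp_surj_on imageE)
    show "b j \<bullet> (?A *v T (\<chi> k. \<mu> k * y $ k)) = b j \<bullet> T y"
      using \<mu>[of k] by (simp add: inner_spec_mat[OF b j]) (simp add: k coord \<mu>_def)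
  qed
  have [measurable]: "T \<in> borel_measurable borel"
    unfolding T_def by (intro borel_measurable_continuous_onI continuous_intros)
  have "(\<integral>\<^sup>+x. G (?A *v x) \<partial>lborel) = (\<integral>\<^sup>+x. G (?A *v T x) \<partial>lborel)"
    by (rule nn_integral_lborel_orthogonal[OF T, symmetric]) measurable
  also have "\<dots> = ennreal (\<Prod>k\<in>UNIV. \<mu> k) * (\<integral>\<^sup>+x. G (?A *v T (\<chi> k. \<mu> k * x $ k)) \<partial>lborel)"
    using \<mu> by (intro nn_integral_lborel_diagonal) measurable
  also have "(\<integral>\<^sup>+x. G (?A *v T (\<chi> k. \<mu> k * x $ k)) \<partial>lborel) = (\<integral>\<^sup>+x. G x \<partial>lborel)"
    unfolding AT by (rule nn_integral_lborel_orthogonal[OF T]) measurable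
  also have "(\<Prod>k\<in>UNIV. \<mu> k) = (\<Prod>j\<in>{1..CARD('n)}. lam j)"
    unfolding \<mu>_def by (rule prod.reindex_bij_betw[OF \<sigma>])
  finally show ?thesis .
qed

text \<open>The orthogonal matrix M with columns from \<open>b\<close> satisfies
  \<open>spec_mat b lam ** M = M ** D\<close>, and its nonzero determinant cancels.\<close>

lemma det_spec_mat:
  assumes b: "onb (b :: nat \<Rightarrow> real^'n)"
  shows "det (spec_mat b lam) = (\<Prod>j\<in>{1..CARD('n)}. lam j)"
proof -
  obtain \<sigma> where \<sigma>: "bij_betw \<sigma> (UNIV :: 'n set) {1..CARD('n)}"
    and T: "orthogonal_transformation (\<lambda>y :: real^'n. \<Sum>k\<in>UNIV. y $ k *\<^sub>R b (\<sigma> k))"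
    and coord: "\<And>k y. b (\<sigma> k) \<bullet> (\<Sum>l\<in>UNIV. y $ l *\<^sub>R b (\<sigma> l)) = (y :: real^'n) $ k"
    by (rule onb_coordinates[OF b]) blast
  define M :: "real^'n^'n" where "M = (\<chi> i k. b (\<sigma> k) $ i)"
  define D :: "real^'n^'n" where "D = (\<chi> i k. if i = k then lam (\<sigma> i) else 0)"
  have Mv: "M *v y = (\<Sum>k\<in>UNIV. y $ k *\<^sub>R b (\<sigma> k))" for y
    by (simp add: M_def vec_eq_iff matrix_vector_mult_def mult.commute)
  have Dv: "(D *v y) $ k = lam (\<sigma> k) * y $ k" for y k
    by (simp add: D_def matrix_vector_mult_def if_distrib[of "\<lambda>a. a * _"] cong: if_cong)
  have "spec_mat b lam ** M = M ** D"
    unfolding matrix_eq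
  proof
    fix y
    have "spec_mat b lam *v (M *v y) = M *v (D *v y)"
    proof (rule onb_eqI[OF b])
      fix j assume j: "j \<in> {1..CARD('n)}"
      then obtain k where k: "j = \<sigma> k"
        using \<sigma> by (metis bij_betw_imp_surj_on imageE)
      have "b j \<bullet> (M *v z) = z $ k" for z
        by (simp only: k Mv coord)
      then show "b j \<bullet> (spec_mat b lam *v (M *v y)) = b j \<bullet> (M *v (D *v y))"
        by (simp only: inner_spec_mat[OF b j] Dv) (simp only: k)
    qed
    then show "spec_mat b lam ** M *v y = M ** D *v y"
      by (simp add: matrix_vector_mul_assoc)
  qed
  then have "det (spec_mat b lam) * det M = det M * det D"
    by (simp flip: det_mul)
  moreover have "det M \<noteq> 0"
  proof -
    have "(*v) M = (\<lambda>y. \<Sum>k\<in>UNIV. y $ k *\<^sub>R b (\<sigma> k))"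
      by (simp add: fun_eq_iff Mv)
    then have "orthogonal_transformation ((*v) M)"
      using T by (simp only:)
    then have "\<bar>det M\<bar> = 1"
      by (metis abs_1 abs_minus_cancel det_orthogonal_matrix matrix_of_matrix_vector_mul orthogonal_transformation_matrix)
    then show ?thesis
      by auto
  qed
  ultimately have "det (spec_mat b lam) = det D"
    by simp
  also have "\<dots> = (\<Prod>k\<in>UNIV. D $ k $ k)"
    by (rule det_diagonal) (simp add: D_def)
  also have "\<dots> = (\<Prod>k\<in>UNIV. lam (\<sigma> k))"
    by (simp add: D_def)
  also have "\<dots> = (\<Prod>j\<in>{1..CARD('n)}. lam j)"
    by (rule prod.reindex_bij_betw[OF \<sigma>])
  finally show ?thesis .
qed

section \<open>The uniform law on the sphere and the standardised angular Gaussian law\<close>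

lemma nn_integral_lborel_cong_nonzero:
  fixes f g :: "real^'n \<Rightarrow> ennreal"
  assumes "\<And>x. x \<noteq> 0 \<Longrightarrow> f x = g x"
  shows "(\<integral>\<^sup>+x. f x \<partial>lborel) = (\<integral>\<^sup>+x. g x \<partial>lborel)"
proof (rule nn_integral_cong_AE)
  have "AE x in lborel. x \<noteq> (0 :: real^'n)"
    by (rule AE_lborel_singleton)
  then show "AE x in lborel. f x = g x"
    by eventually_elim (rule assms)
qed

lemma sets_sphere_measure [measurable_cong]: "sets (sphere_measure :: (real^'n) measure) = sets borel"
  by (simp add: sphere_measure_def)

lemma nn_integral_sphere_measure:
  fixes f :: "real^'n \<Rightarrow> ennreal"
  assumes [measurable]: "f \<in> borel_measurable borel"
  shows "(\<integral>\<^sup>+u. f u \<partial>sphere_measure)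
    = ennreal (real CARD('n)) * (\<integral>\<^sup>+x. (if norm x < 1 then f (x /\<^sub>R norm x) else 0) \<partial>lborel)"
proof -
  have "(\<integral>\<^sup>+u. f u \<partial>sphere_measure)
     = (\<integral>\<^sup>+x. ennreal (real CARD('n)) * indicator (ball 0 1) x * f (x /\<^sub>R norm x) \<partial>lborel)"
  proof -
    have [measurable]: "(\<lambda>x :: real^'n. indicator (ball 0 1) x :: ennreal) \<in> borel_measurable borel"
      by (intro borel_measurable_indicator) simp
    show ?thesis
      unfolding sphere_measure_def by (subst nn_integral_distr; (subst nn_integral_density)?; measurable)
  qed
  also have "\<dots> = (\<integral>\<^sup>+x. ennreal (real CARD('n)) * (if norm x < 1 then f (x /\<^sub>R norm x) else 0) \<partial>lborel)"
    by (intro nn_integral_cong) (simp add: indicator_def)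
  finally show ?thesis
    by (simp add: nn_integral_cmult)
qed

text \<open>The reciprocal of the area of the unit sphere, which is the angular Gaussian density at
  V = I.\<close>

definition sphere_const :: "'n::finite itself \<Rightarrow> real" where
  "sphere_const _ = Gamma (real CARD('n) / 2) / (2 * pi powr (real CARD('n) / 2))"

definition uniform_sphere :: "(real^'n) measure" where
  "uniform_sphere = density sphere_measure (\<lambda>_. ennreal (sphere_const TYPE('n)))"

lemma sphere_const_pos: "sphere_const TYPE('n::finite) > 0"
  unfolding sphere_const_def by (intro divide_pos_pos Gamma_real_pos mult_pos_pos) auto

lemma sets_uniform_sphere [measurable_cong]: "sets (uniform_sphere :: (real^'n) measure) = sets borel"
  by (simp add: uniform_sphere_def sphere_measure_def)

lemma space_uniform_sphere [simp]: "space (uniform_sphere :: (real^'n) measure) = UNIV"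
  by (simp add: uniform_sphere_def sphere_measure_def)

lemma nn_integral_uniform_sphere:
  fixes f :: "real^'n \<Rightarrow> ennreal"
  assumes [measurable]: "f \<in> borel_measurable borel"
  shows "(\<integral>\<^sup>+u. f u \<partial>uniform_sphere) = ennreal (sphere_const TYPE('n) * real CARD('n)) *
    (\<integral>\<^sup>+x. (if norm x < 1 then f (x /\<^sub>R norm x) else 0) \<partial>lborel)"
proof -
  have "(\<integral>\<^sup>+u. f u \<partial>uniform_sphere) = ennreal (sphere_const TYPE('n)) * (\<integral>\<^sup>+u. f u \<partial>sphere_measure)"
    unfolding uniform_sphere_def by (simp add: nn_integral_density nn_integral_cmult)
  then show ?thesis
    using sphere_const_pos[where 'n = 'n]
    by (simp add: nn_integral_sphere_measure ennreal_mult less_imp_le mult.assoc)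
qed

text \<open>The area is p times the volume pi^(p/2) / Gamma (p/2 + 1) of the unit ball, and Gamma
  (p/2 + 1) = p/2 Gamma (p/2).\<close>

lemma prob_space_uniform_sphere: "prob_space (uniform_sphere :: (real^'n) measure)"
proof
  let ?p = "real CARD('n)"
  have "emeasure (uniform_sphere :: (real^'n) measure) UNIV = (\<integral>\<^sup>+u. 1 \<partial>(uniform_sphere :: (real^'n) measure))"
    by simp
  also have "\<dots> = ennreal (sphere_const TYPE('n) * ?p) * (\<integral>\<^sup>+x. (if norm (x :: real^'n) < 1 then 1 else 0) \<partial>lborel)"
    by (rule nn_integral_uniform_sphere) simp
  also have "(\<integral>\<^sup>+x. (if norm (x :: real^'n) < 1 then 1 else 0) \<partial>lborel) = (\<integral>\<^sup>+x. indicator (ball (0 :: real^'n) 1) x \<partial>lborel)"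
    by (intro nn_integral_cong) (simp add: indicator_def)
  also have "\<dots> = ennreal (unit_ball_vol ?p)"
    by (simp add: emeasure_ball)
  also have "ennreal (sphere_const TYPE('n) * ?p) * ennreal (unit_ball_vol ?p) = ennreal (sphere_const TYPE('n) * ?p * unit_ball_vol ?p)"
    using sphere_const_pos[where 'n = 'n] by (intro ennreal_mult[symmetric]) (auto intro: less_imp_le)
  also have "sphere_const TYPE('n) * ?p * unit_ball_vol ?p = 1"
  proof -
    have "Gamma (?p / 2 + 1) = ?p / 2 * Gamma (?p / 2)"
    proof (rule Gamma_plus1)
      show "?p / 2 \<notin> \<int>\<^sub>\<le>\<^sub>0"
      proof
        assume "?p / 2 \<in> \<int>\<^sub>\<le>\<^sub>0"
        then obtain m where "?p / 2 = of_int m" "m \<le> 0"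
          by (rule nonpos_Ints_cases)
        moreover from this have "real_of_int m \<le> 0"
          by simp
        moreover have "?p > 0"
          by simp
        ultimately show False
          by linarith
      qed
    qed
    then have eq: "sphere_const TYPE('n) * ?p * unit_ball_vol ?p
        = Gamma (?p / 2) / (2 * pi powr (?p / 2)) * ?p * (pi powr (?p / 2) / (?p / 2 * Gamma (?p / 2)))"
      by (simp only: sphere_const_def unit_ball_vol_def)
    have "Gamma (?p / 2) > 0"
      by (rule Gamma_real_pos) simp
    then have "Gamma (?p / 2) \<noteq> 0"
      by linarith
    moreover have "pi powr (?p / 2) \<noteq> 0"
      by simp
    ultimately show ?thesis
      unfolding eq by (simp add: divide_simps)
  qed
  finally show "emeasure (uniform_sphere :: (real^'n) measure) (space uniform_sphere) = 1"
    by simp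
qed

lemma uniform_sphere_orthogonal:
  fixes T :: "real^'n \<Rightarrow> real^'n"
  assumes T: "orthogonal_transformation T"
  shows "distr uniform_sphere borel T = uniform_sphere"
proof (rule measure_eqI)
  fix S :: "(real^'n) set" assume "S \<in> sets (distr uniform_sphere borel T)"
  then have [measurable]: "S \<in> sets borel"
    by simp
  have lin: "linear T" and nT: "\<And>x. norm (T x) = norm x"
    using T by (auto simp: orthogonal_transformation)
  have [measurable]: "T \<in> borel_measurable borel"
    using lin by (intro borel_measurable_continuous_onI linear_continuous_on linear_conv_bounded_linear[THEN iffD1])
  have "emeasure (distr uniform_sphere borel T) S = (\<integral>\<^sup>+u. indicator S u \<partial>distr uniform_sphere borel T)"
    by simp
  also have "\<dots> = (\<integral>\<^sup>+u. indicator S (T u) \<partial>uniform_sphere)"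
    by (subst nn_integral_distr) auto
  also have "\<dots> = ennreal (sphere_const TYPE('n) * real CARD('n)) *
      (\<integral>\<^sup>+x. (if norm x < 1 then indicator S (T (x /\<^sub>R norm x)) else 0) \<partial>lborel)"
    by (rule nn_integral_uniform_sphere) measurable
  also have "(\<integral>\<^sup>+x. (if norm x < 1 then indicator S (T (x /\<^sub>R norm x)) else 0) \<partial>lborel)
    = (\<integral>\<^sup>+x. (if norm (T x) < 1 then indicator S (T x /\<^sub>R norm (T x)) else 0) \<partial>lborel)"
  proof (rule nn_integral_cong)
    fix x
    have "T (x /\<^sub>R norm x) = T x /\<^sub>R norm (T x)"
      by (simp add: nT linear_scale[OF lin])
    then show "(if norm x < 1 then indicator S (T (x /\<^sub>R norm x)) else 0 :: ennreal)
      = (if norm (T x) < 1 then indicator S (T x /\<^sub>R norm (T x)) else 0)"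
      by (simp add: nT)
  qed
  also have "\<dots> = (\<integral>\<^sup>+x. (if norm x < 1 then indicator S (x /\<^sub>R norm x) else 0) \<partial>lborel)"
    by (rule nn_integral_lborel_orthogonal[OF T]) measurable
  also have "ennreal (sphere_const TYPE('n) * real CARD('n)) * \<dots> = (\<integral>\<^sup>+u. indicator S u \<partial>uniform_sphere)"
    by (rule nn_integral_uniform_sphere[symmetric]) measurable
  finally show "emeasure (distr uniform_sphere borel T) S = emeasure uniform_sphere S"
    by (simp add: sets_uniform_sphere)
qed (simp add: sets_uniform_sphere)

text \<open>The radial projection sends the origin to 0, so unit length can fail, but only on the
  image of a Lebesgue null set.\<close>

lemma AE_uniform_sphere_unit: "AE u in (uniform_sphere :: (real^'n) measure). norm u = 1"
proof -
  have "emeasure uniform_sphere {u :: real^'n. norm u \<noteq> 1} = (\<integral>\<^sup>+u. indicator {u :: real^'n. norm u \<noteq> 1} u \<partial>uniform_sphere)"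
    by (subst nn_integral_indicator) (auto simp: sets_uniform_sphere)
  also have "\<dots> = ennreal (sphere_const TYPE('n) * real CARD('n)) *
      (\<integral>\<^sup>+x. (if norm x < 1 then indicator {u :: real^'n. norm u \<noteq> 1} (x /\<^sub>R norm x) else 0) \<partial>lborel)"
    by (rule nn_integral_uniform_sphere) measurable
  also have "(\<integral>\<^sup>+x. (if norm x < 1 then indicator {u :: real^'n. norm u \<noteq> 1} (x /\<^sub>R norm x) else 0) \<partial>lborel)
    = (\<integral>\<^sup>+x. 0 \<partial>(lborel :: (real^'n) measure))"
    by (rule nn_integral_lborel_cong_nonzero) (simp add: indicator_def)
  finally show ?thesis
    by (intro AE_I[of _ _ "{u. norm u \<noteq> 1}"]) (auto simp: sets_uniform_sphere)
qed

lemma sets_ang_gauss [measurable_cong]: "sets (ang_gauss V :: (real^'n) measure) = sets borel"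
  by (simp add: ang_gauss_def sphere_measure_def)

lemma space_ang_gauss [simp]: "space (ang_gauss V :: (real^'n) measure) = UNIV"
  by (simp add: ang_gauss_def sphere_measure_def)

text \<open>The density at x / |x| is a multiple of g(x)^p with g = |x| / |A x|. Replacing the gauge
  |x| by |A x| turns g into 1, because g / |x| = 1 / |A x|. The substitution by \<open>A\<close>
  then yields det A^-1 = sqrt (det V), which cancels the normalisation of the density.\<close>

lemma ang_gauss_standardized:
  fixes b :: "nat \<Rightarrow> real^'n"
  assumes b: "onb b" and lam: "\<And>j. j \<in> {1..CARD('n)} \<Longrightarrow> lam j > 0"
  defines "A \<equiv> spec_mat b (\<lambda>j. 1 / sqrt (lam j))"
  shows "distr (ang_gauss (spec_mat b lam)) borel (\<lambda>u. (A *v u) /\<^sub>R norm (A *v u)) = uniform_sphere"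
proof (rule measure_eqI)
  let ?V = "spec_mat b lam" and ?p = "real CARD('n)"
  let ?R = "\<lambda>x :: real^'n. x /\<^sub>R norm x"
  fix S :: "(real^'n) set" assume "S \<in> sets (distr (ang_gauss ?V) borel (\<lambda>u. ?R (A *v u)))"
  then have [measurable]: "S \<in> sets borel"
    by simp
  define P where "P = (\<Prod>j\<in>{1..CARD('n)}. sqrt (lam j))"
  have P: "P > 0"
    unfolding P_def using lam by (intro prod_pos) auto
  have "det ?V = P\<^sup>2"
    unfolding det_spec_mat[OF b] P_def prod_power_distrib using lam by (intro prod.cong) (auto simp: less_imp_le)
  then have detV: "sqrt (det ?V) = P"
    using P by simp
  have inv: "matrix_inv ?V = spec_mat b (\<lambda>j. 1 / lam j)"
    using lam by (intro matrix_inv_spec_mat[OF b]) force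
  have "A ** A = matrix_inv ?V"
    unfolding inv A_def spec_mat_mult[OF b] using lam by (intro spec_mat_cong) (simp add: less_imp_le)
  then have quad: "u \<bullet> (matrix_inv ?V *v u) = (norm (A *v u))\<^sup>2" for u
  proof -
    have "matrix_inv ?V *v u = A *v (A *v u)"
      by (simp add: matrix_vector_mul_assoc \<open>A ** A = matrix_inv ?V\<close>)
    moreover have "sym_mat A"
      unfolding A_def by (rule sym_spec_mat)
    ultimately show ?thesis
      unfolding power2_norm_eq_inner by (simp only: sym_mat_inner)
  qed
  have Anz: "A *v x \<noteq> 0" if "x \<noteq> 0" for x
  proof -
    have "posdef A"
      unfolding A_def posdef_spec_mat[OF b] using lam by auto
    then have "x \<bullet> (A *v x) > 0"
      using that by (simp add: posdef_def)
    then show ?thesis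
      by auto
  qed
  define h where "h x = (indicator S (?R (A *v x)) :: ennreal)" for x
  have [measurable]: "h \<in> borel_measurable borel"
    unfolding h_def by measurable
  have h_scale: "h (t *\<^sub>R x) = h x" if "t > 0" for t x
  proof -
    have "inverse t * a * t = a" for a
      using that by simp
    then show ?thesis
      using that unfolding h_def matrix_vector_mult_scaleR norm_scaleR inverse_mult_distrib scaleR_scaleR
      by (simp only: abs_of_pos)
  qed
  have [measurable]: "ang_gauss_dens ?V \<in> borel_measurable borel"
    unfolding ang_gauss_dens_def by measurable
  define g where "g x = norm x / norm (A *v x)" for x :: "real^'n"
  have dens: "ang_gauss_dens ?V (?R x) = sphere_const TYPE('n) / P * g x ^ CARD('n)" if x: "x \<noteq> 0" for x
  proof -
    have "norm (A *v ?R x) = norm (A *v x) / norm x"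
      by (simp add: matrix_vector_mult_scaleR divide_inverse mult.commute)
    then have "((?R x) \<bullet> (matrix_inv ?V *v ?R x)) powr (- ?p / 2) = ((1 / g x)\<^sup>2) powr (- ?p / 2)"
      unfolding quad g_def by simp
    also have "\<dots> = ((1 / g x) powr 2) powr (- ?p / 2)"
      using x Anz[OF x] by (simp add: g_def)
    also have "\<dots> = (1 / g x) powr (- ?p)"
      by (simp add: powr_powr)
    also have "\<dots> = g x ^ CARD('n)"
      using x Anz[OF x] by (simp add: g_def powr_minus_divide powr_realpow power_divide)
    finally show ?thesis
      unfolding ang_gauss_dens_def detV sphere_const_def by simp
  qed
  have "emeasure (distr (ang_gauss ?V) borel (\<lambda>u. ?R (A *v u))) S = (\<integral>\<^sup>+u. indicator S u \<partial>distr (ang_gauss ?V) borel (\<lambda>u. ?R (A *v u)))"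
    by simp
  also have "\<dots> = (\<integral>\<^sup>+u. h u \<partial>ang_gauss ?V)"
    unfolding h_def by (subst nn_integral_distr) auto
  also have "\<dots> = (\<integral>\<^sup>+u. ennreal (ang_gauss_dens ?V u) * h u \<partial>sphere_measure)"
    unfolding ang_gauss_def by (subst nn_integral_density) auto
  also have "\<dots> = ennreal ?p * (\<integral>\<^sup>+x. (if norm x < 1 then ennreal (ang_gauss_dens ?V (?R x)) * h (?R x) else 0) \<partial>lborel)"
    by (rule nn_integral_sphere_measure) measurable
  also have "(\<integral>\<^sup>+x. (if norm x < 1 then ennreal (ang_gauss_dens ?V (?R x)) * h (?R x) else 0) \<partial>lborel)
     = (\<integral>\<^sup>+x. ennreal (sphere_const TYPE('n) / P) * (if norm x < 1 then h x * ennreal (g x ^ CARD('n)) else 0) \<partial>lborel)"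
  proof (rule nn_integral_lborel_cong_nonzero)
    fix x :: "real^'n" assume x: "x \<noteq> 0"
    have "h (?R x) = h x"
      using x by (intro h_scale) simp
    moreover have "0 \<le> sphere_const TYPE('n) / P" "0 \<le> g x ^ CARD('n)"
      using P sphere_const_pos[where 'n = 'n] by (auto simp: g_def intro: divide_nonneg_pos less_imp_le)
    then have "ennreal (ang_gauss_dens ?V (?R x)) = ennreal (sphere_const TYPE('n) / P) * ennreal (g x ^ CARD('n))"
      unfolding dens[OF x] by (rule ennreal_mult)
    ultimately show "(if norm x < 1 then ennreal (ang_gauss_dens ?V (?R x)) * h (?R x) else 0)
       = ennreal (sphere_const TYPE('n) / P) * (if norm x < 1 then h x * ennreal (g x ^ CARD('n)) else 0)"
      by (simp add: mult_ac)
  qed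
  also have "\<dots> = ennreal (sphere_const TYPE('n) / P) * (\<integral>\<^sup>+x. (if norm x < 1 then h x * ennreal (g x ^ CARD('n)) else 0) \<partial>lborel)"
    unfolding g_def by (rule nn_integral_cmult) measurable
  \<comment> \<open>Here the gauge is \<open>norm x\<close> with the function \<open>g\<close>;
    below it is \<open>norm (A *v x)\<close> with the constant 1. Both lead to the same logarithmic
    integral.\<close>
  also have "(\<integral>\<^sup>+x. (if norm x < 1 then h x * ennreal (g x ^ CARD('n)) else 0) \<partial>lborel)
    = (\<integral>\<^sup>+x. h x * ennreal (?p * ln (g x / norm x)) \<partial>lborel)"
    by (rule nn_integral_homogeneous)
       (use Anz in \<open>auto simp: g_def matrix_vector_mult_scaleR h_scale\<close>)
  also have "\<dots> = (\<integral>\<^sup>+x. h x * ennreal (?p * ln (1 / norm (A *v x))) \<partial>lborel)"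
    by (rule nn_integral_lborel_cong_nonzero) (simp add: g_def)
  also have "\<dots> = (\<integral>\<^sup>+x. (if norm (A *v x) < 1 then h x * ennreal (1 ^ CARD('n)) else 0) \<partial>lborel)"
    by (rule nn_integral_homogeneous[symmetric]) (use Anz in \<open>auto simp: matrix_vector_mult_scaleR h_scale\<close>)
  also have "\<dots> = (\<integral>\<^sup>+x. (if norm (A *v x) < 1 then indicator S (?R (A *v x)) else 0) \<partial>lborel)"
    by (rule nn_integral_cong) (simp add: h_def)
  also have "\<dots> = ennreal P * (\<integral>\<^sup>+x. (if norm x < 1 then indicator S (?R x) else 0) \<partial>lborel)"
    unfolding A_def P_def
    by (rule nn_integral_lborel_spec_mat[OF b, where G = "\<lambda>x. if norm x < 1 then indicator S (?R x) else 0"])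
       (use lam in auto)
  also have "ennreal ?p * (ennreal (sphere_const TYPE('n) / P) * (ennreal P * (\<integral>\<^sup>+x. (if norm x < 1 then indicator S (?R x) else 0) \<partial>lborel)))
     = ennreal (sphere_const TYPE('n) * ?p) * (\<integral>\<^sup>+x. (if norm x < 1 then indicator S (?R x) else 0) \<partial>lborel)"
  proof -
    have "ennreal ?p * (ennreal (sphere_const TYPE('n) / P) * ennreal P) = ennreal (sphere_const TYPE('n) * ?p)"
      using P sphere_const_pos[where 'n = 'n] by (simp add: less_imp_le mult.commute flip: ennreal_mult)
    then show ?thesis
      by (simp flip: mult.assoc)
  qed
  also have "\<dots> = (\<integral>\<^sup>+u. indicator S u \<partial>uniform_sphere)"
    by (rule nn_integral_uniform_sphere[symmetric]) measurable
  finally show "emeasure (distr (ang_gauss ?V) borel (\<lambda>u. ?R (A *v u))) S = emeasure uniform_sphere S"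
    by (simp add: sets_uniform_sphere)
qed (simp add: sets_uniform_sphere)

text \<open>The total mass is read off the standardised image.\<close>

lemma prob_space_ang_gauss:
  assumes b: "onb (b :: nat \<Rightarrow> real^'n)" and lam: "\<And>j. j \<in> {1..CARD('n)} \<Longrightarrow> lam j > 0"
  shows "prob_space (ang_gauss (spec_mat b lam))"
proof -
  interpret prob_space "uniform_sphere :: (real^'n) measure"
    by (rule prob_space_uniform_sphere)
  have "prob_space (distr (ang_gauss (spec_mat b lam)) borel
      (\<lambda>u. (spec_mat b (\<lambda>j. 1 / sqrt (lam j)) *v u) /\<^sub>R norm (spec_mat b (\<lambda>j. 1 / sqrt (lam j)) *v u)))"
    using ang_gauss_standardized[OF b, of lam] lam prob_space_axioms by simp
  then show ?thesis
    by (rule prob_space_distrD[rotated]) measurable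
qed

section \<open>Fourth moments and concentration\<close>

text \<open>An orthogonal map taking \<open>x\<close> to |x| e0 preserves the law, and the fourth
  power is homogeneous.\<close>

lemma uniform_sphere_fourth_power:
  fixes x e0 :: "real^'n"
  assumes e0: "norm e0 = 1"
  shows "(\<integral>u. (x \<bullet> u) ^ 4 \<partial>uniform_sphere) = (x \<bullet> x)\<^sup>2 * (\<integral>u. (e0 \<bullet> u) ^ 4 \<partial>uniform_sphere)"
proof -
  obtain T where T: "orthogonal_transformation T" "T x = norm x *\<^sub>R e0"
    using orthogonal_transformation_exists[of x "norm x *\<^sub>R e0"] e0 by auto
  have [measurable]: "T \<in> borel_measurable borel"
    using T(1) by (intro borel_measurable_continuous_onI linear_continuous_on linear_conv_bounded_linear[THEN iffD1])
      (simp add: orthogonal_transformation)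
  have "(\<integral>u. (e0 \<bullet> u) ^ 4 \<partial>uniform_sphere) = (\<integral>u. (e0 \<bullet> u) ^ 4 \<partial>distr uniform_sphere borel T)"
    by (simp add: uniform_sphere_orthogonal[OF T(1)])
  also have "\<dots> = (\<integral>u. (e0 \<bullet> T u) ^ 4 \<partial>uniform_sphere)"
    by (rule integral_distr) measurable
  finally have "(x \<bullet> x)\<^sup>2 * (\<integral>u. (e0 \<bullet> u) ^ 4 \<partial>uniform_sphere) = (\<integral>u. (x \<bullet> x)\<^sup>2 * (e0 \<bullet> T u) ^ 4 \<partial>uniform_sphere)"
    by simp
  also have "\<dots> = (\<integral>u. (x \<bullet> u) ^ 4 \<partial>uniform_sphere)"
  proof (rule Bochner_Integration.integral_cong)
    fix u
    have "x \<bullet> u = T x \<bullet> T u"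
      using T(1) by (simp add: orthogonal_transformation_def)
    then have "x \<bullet> u = norm x * (e0 \<bullet> T u)"
      by (simp add: T(2))
    moreover have "(x \<bullet> x)\<^sup>2 = norm x ^ 4"
      by (simp add: dot_square_norm flip: power_mult)
    ultimately show "(x \<bullet> x)\<^sup>2 * (e0 \<bullet> T u) ^ 4 = (x \<bullet> u) ^ 4"
      by (simp add: power_mult_distrib)
  qed simp
  finally show ?thesis ..
qed

text \<open>Summing over 8 sign patterns weighted by the product of signs isolates abcd, whose
  coefficient in a fourth power is 4! = 24; hence 192.\<close>

lemma fourth_power_polarization:
  fixes a b c d :: real
  shows "192 * (a * b * c * d) = (a + b + c + d) ^ 4 - (a + b + c - d) ^ 4 - (a + b - c + d) ^ 4 + (a + b - c - d) ^ 4
    - (a - b + c + d) ^ 4 + (a - b + c - d) ^ 4 + (a - b - c + d) ^ 4 - (a - b - c - d) ^ 4"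
  by algebra

text \<open>In the same signed sum for |x|^4 only the three pairings of a, b, c, d survive, each
  with 8 from the square times 8 patterns.\<close>

lemma norm_fourth_polarization:
  fixes a b c d :: "'a::real_inner"
  defines "Q \<equiv> \<lambda>x :: 'a. (x \<bullet> x)\<^sup>2"
  shows "Q (a + b + c + d) - Q (a + b + c - d) - Q (a + b - c + d) + Q (a + b - c - d)
    - Q (a - b + c + d) + Q (a - b + c - d) + Q (a - b - c + d) - Q (a - b - c - d)
    = 64 * ((a \<bullet> b) * (c \<bullet> d) + (a \<bullet> c) * (b \<bullet> d) + (a \<bullet> d) * (b \<bullet> c))"
proof -
  define s where "s = a \<bullet> a + b \<bullet> b + c \<bullet> c + d \<bullet> d"
  have sq: "(a + \<beta> *\<^sub>R b + \<gamma> *\<^sub>R c + \<delta> *\<^sub>R d) \<bullet> (a + \<beta> *\<^sub>R b + \<gamma> *\<^sub>R c + \<delta> *\<^sub>R d)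
    = s + 2 * (\<beta> * (a \<bullet> b) + \<gamma> * (a \<bullet> c) + \<delta> * (a \<bullet> d) + \<beta> * \<gamma> * (b \<bullet> c) + \<beta> * \<delta> * (b \<bullet> d) + \<gamma> * \<delta> * (c \<bullet> d))"
    if "\<beta> * \<beta> = 1" "\<gamma> * \<gamma> = 1" "\<delta> * \<delta> = 1" for \<beta> \<gamma> \<delta>
  proof -
    have *: "\<beta> * (\<beta> * z) = z" "\<gamma> * (\<gamma> * z) = z" "\<delta> * (\<delta> * z) = z" for z
      using that by (simp_all flip: mult.assoc)
    show ?thesis
      by (simp add: s_def inner_add_left inner_add_right * inner_commute algebra_simps)
  qed
  show ?thesis
    unfolding Q_def
    using sq[of 1 1 1] sq[of 1 1 "-1"] sq[of 1 "-1" 1] sq[of 1 "-1" "-1"]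
      sq[of "-1" 1 1] sq[of "-1" 1 "-1"] sq[of "-1" "-1" 1] sq[of "-1" "-1" "-1"]
    by simp (simp add: power2_eq_square algebra_simps)
qed

lemma abs_inner_unit: "norm u \<le> 1 \<Longrightarrow> \<bar>a \<bullet> u\<bar> \<le> norm (a :: 'a::real_inner)"
  using abs_inner_le[of a "norm a" u 1] by simp

text \<open>Polarisation reduces to fourth powers of one linear form, which rotation invariance
  determines up to a constant \<kappa>. Contracting both pairs of indices against |u|^4 = 1 gives
  \<kappa>/3 (p^2 + 2 p) = 1.\<close>

lemma uniform_sphere_fourth_moment:
  fixes a b c d :: "real^'n"
  shows "(\<integral>u. (a \<bullet> u) * (b \<bullet> u) * (c \<bullet> u) * (d \<bullet> u) \<partial>uniform_sphere) = iso4 a b c d"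
proof -
  interpret prob_space "uniform_sphere :: (real^'n) measure"
    by (rule prob_space_uniform_sphere)
  let ?p = "real CARD('n)"
  define m where "m a b c d = (\<integral>u. (a \<bullet> u) * (b \<bullet> u) * (c \<bullet> u) * (d \<bullet> u) \<partial>uniform_sphere)" for a b c d :: "real^'n"
  have int: "integrable uniform_sphere (\<lambda>u. (a \<bullet> u) * (b \<bullet> u) * (c \<bullet> u) * (d \<bullet> u))" for a b c d :: "real^'n"
  proof (rule integrable_const_bound[of _ "norm a * norm b * norm c * norm d"])
    show "AE u in uniform_sphere. norm ((a \<bullet> u) * (b \<bullet> u) * (c \<bullet> u) * (d \<bullet> u)) \<le> norm a * norm b * norm c * norm d"
      using AE_uniform_sphere_unit
      by eventually_elim (auto simp only: real_norm_def intro!: abs_mult_le abs_inner_unit)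
  qed measurable
  have int4: "integrable uniform_sphere (\<lambda>u. (x \<bullet> u) ^ 4)" for x :: "real^'n"
    using int[of x x x x] by (simp add: power4_eq_xxxx)
  define e0 :: "real^'n" where "e0 = axis undefined 1"
  define \<kappa> where "\<kappa> = (\<integral>u. (e0 \<bullet> u) ^ 4 \<partial>uniform_sphere)"
  have F: "(\<integral>u. (x \<bullet> u) ^ 4 \<partial>uniform_sphere) = (x \<bullet> x)\<^sup>2 * \<kappa>" for x :: "real^'n"
    unfolding \<kappa>_def by (rule uniform_sphere_fourth_power) (simp add: e0_def)
  have m: "m a b c d = \<kappa> / 3 * ((a \<bullet> b) * (c \<bullet> d) + (a \<bullet> c) * (b \<bullet> d) + (a \<bullet> d) * (b \<bullet> c))" for a b c d
  proof -
    have "192 * m a b c d = (\<integral>u. 192 * ((a \<bullet> u) * (b \<bullet> u) * (c \<bullet> u) * (d \<bullet> u)) \<partial>uniform_sphere)"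
      by (simp add: m_def)
    also have "\<dots> = (\<integral>u. ((a + b + c + d) \<bullet> u) ^ 4 - ((a + b + c - d) \<bullet> u) ^ 4 - ((a + b - c + d) \<bullet> u) ^ 4
        + ((a + b - c - d) \<bullet> u) ^ 4 - ((a - b + c + d) \<bullet> u) ^ 4 + ((a - b + c - d) \<bullet> u) ^ 4
        + ((a - b - c + d) \<bullet> u) ^ 4 - ((a - b - c - d) \<bullet> u) ^ 4 \<partial>uniform_sphere)"
      by (simp only: fourth_power_polarization inner_add_left inner_diff_left)
    also have "\<dots> = \<kappa> * (((a + b + c + d) \<bullet> (a + b + c + d))\<^sup>2 - ((a + b + c - d) \<bullet> (a + b + c - d))\<^sup>2
        - ((a + b - c + d) \<bullet> (a + b - c + d))\<^sup>2 + ((a + b - c - d) \<bullet> (a + b - c - d))\<^sup>2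
        - ((a - b + c + d) \<bullet> (a - b + c + d))\<^sup>2 + ((a - b + c - d) \<bullet> (a - b + c - d))\<^sup>2
        + ((a - b - c + d) \<bullet> (a - b - c + d))\<^sup>2 - ((a - b - c - d) \<bullet> (a - b - c - d))\<^sup>2)"
      by (simp only: Bochner_Integration.integral_add Bochner_Integration.integral_diff int4 F
          Bochner_Integration.integrable_add Bochner_Integration.integrable_diff ring_distribs mult.commute[of \<kappa>])
    finally have *: "192 * m a b c d = \<kappa> * (64 * ((a \<bullet> b) * (c \<bullet> d) + (a \<bullet> c) * (b \<bullet> d) + (a \<bullet> d) * (b \<bullet> c)))"
      unfolding norm_fourth_polarization .
    have "x = k / 3 * y" if "192 * x = k * (64 * y)" for x y k :: real
      using that by simp
    from this[OF *] show ?thesis .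
  qed
  have "(1 :: real) = (\<integral>u. 1 \<partial>(uniform_sphere :: (real^'n) measure))"
    using prob_space by simp
  also have "\<dots> = (\<integral>u. (\<Sum>k\<in>UNIV. \<Sum>l\<in>UNIV. (axis k 1 \<bullet> u) * (axis k 1 \<bullet> u) * (axis l 1 \<bullet> u) * (axis l 1 \<bullet> u)) \<partial>(uniform_sphere :: (real^'n) measure))"
  proof (rule integral_cong_AE)
    show "AE u in (uniform_sphere :: (real^'n) measure). 1 = (\<Sum>k\<in>UNIV. \<Sum>l\<in>UNIV. (axis k 1 \<bullet> u) * (axis k 1 \<bullet> u) * (axis l 1 \<bullet> u) * (axis l 1 \<bullet> u))"
      using AE_uniform_sphere_unit
    proof eventually_elim
      fix u :: "real^'n" assume "norm u = 1"
      then have "(\<Sum>k\<in>UNIV. u $ k * u $ k) = 1"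
        by (simp add: norm_eq_1 inner_vec_def)
      then show "1 = (\<Sum>k\<in>UNIV. \<Sum>l\<in>UNIV. (axis k 1 \<bullet> u) * (axis k 1 \<bullet> u) * (axis l 1 \<bullet> u) * (axis l 1 \<bullet> u))"
        by (simp add: inner_axis' mult.assoc flip: sum_distrib_left sum_distrib_right)
    qed
  qed measurable
  also have "\<dots> = (\<Sum>k\<in>(UNIV :: 'n set). \<Sum>l\<in>(UNIV :: 'n set). m (axis k 1) (axis k 1) (axis l 1) (axis l 1))"
    unfolding m_def by (simp add: Bochner_Integration.integral_sum Bochner_Integration.integrable_sum int)
  also have "\<dots> = (\<Sum>k\<in>(UNIV :: 'n set). \<Sum>l\<in>(UNIV :: 'n set). \<kappa> / 3 + (if k = l then 2 * \<kappa> / 3 else 0))"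
    by (intro sum.cong refl) (simp add: m inner_axis_axis)
  also have "\<dots> = \<kappa> / 3 * (?p * (?p + 2))"
    by (simp add: sum.distrib) (simp add: algebra_simps)
  finally have "\<kappa> / 3 * (?p * (?p + 2)) = 1" ..
  then have "\<kappa> / 3 = 1 / (?p * (?p + 2))"
    by (simp add: eq_divide_eq)
  then show ?thesis
    using m[of a b c d] by (simp add: m_def iso4_def)
qed

section \<open>Concentration of the empirical fourth moments\<close>

lemma linear_le_of_axes:
  fixes L :: "real^'n \<Rightarrow> real"
  assumes L: "linear L" and B: "\<And>k. \<bar>L (axis k 1)\<bar> \<le> B"
  shows "\<bar>L a\<bar> \<le> real CARD('n) * B * norm a"
proof -
  have "L a = L (\<Sum>k\<in>UNIV. a $ k *\<^sub>R axis k 1)"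
    by (simp add: basis_expansion flip: scalar_mult_eq_scaleR)
  also have "\<dots> = (\<Sum>k\<in>UNIV. a $ k * L (axis k 1))"
    by (simp add: linear_sum[OF L] linear_scale[OF L])
  also have "\<bar>\<dots>\<bar> \<le> (\<Sum>k\<in>(UNIV :: 'n set). norm a * B)"
    by (intro order_trans[OF sum_abs] sum_mono abs_mult_le B component_le_norm_cart)
  finally show ?thesis
    by (simp add: mult_ac)
qed

text \<open>The error is symmetric and linear in each argument, so it is expanded in coordinates one
  argument at a time, each time at the cost of a factor p.\<close>

lemma near_iso4_of_axes:
  fixes w :: "nat \<Rightarrow> real^'n"
  assumes "\<And>k l m q. \<bar>avg n (\<lambda>i. (axis k 1 \<bullet> w i) * (axis l 1 \<bullet> w i) * (axis m 1 \<bullet> w i) * (axis q 1 \<bullet> w i))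
      - iso4 (axis k 1) (axis l 1) (axis m 1) (axis q 1)\<bar> \<le> \<delta>"
  shows "near_iso4 (real CARD('n) ^ 4 * \<delta>) n w"
proof -
  let ?p = "real CARD('n)"
  define G where "G a b c d = avg n (\<lambda>i. (a \<bullet> w i) * (b \<bullet> w i) * (c \<bullet> w i) * (d \<bullet> w i)) - iso4 a b c d" for a b c d
  have lin: "linear (\<lambda>a. G a b c d)" for b c d
    by (rule linearI)
       (simp_all add: G_def iso4_def inner_add_left ring_distribs avg_add avg_mult_left add_divide_distrib mult.assoc)
  have swap: "G a b c d = G b a c d" "G a b c d = G c b a d" "G a b c d = G d b c a" for a b c d
    by (simp_all add: G_def iso4_def mult_ac inner_commute add_ac)
  have 1: "\<bar>G a (axis l 1) (axis m 1) (axis q 1)\<bar> \<le> ?p * \<delta> * norm a" for a l m q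
    by (rule linear_le_of_axes[OF lin]) (use assms in \<open>simp add: G_def\<close>)
  have 2: "\<bar>G a b (axis m 1) (axis q 1)\<bar> \<le> ?p * (?p * \<delta> * norm a) * norm b" for a b m q
    by (subst swap(1), rule linear_le_of_axes[OF lin], subst swap(1), rule 1)
  have 3: "\<bar>G a b c (axis q 1)\<bar> \<le> ?p * (?p * (?p * \<delta> * norm a) * norm b) * norm c" for a b c q
    by (subst swap(2), rule linear_le_of_axes[OF lin], subst swap(2), rule 2)
  have 4: "\<bar>G a b c d\<bar> \<le> ?p * (?p * (?p * (?p * \<delta> * norm a) * norm b) * norm c) * norm d" for a b c d
    by (subst swap(3), rule linear_le_of_axes[OF lin], subst swap(3), rule 3)
  show ?thesis
    unfolding near_iso4_def
  proof (intro allI)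
    fix a b c d
    show "\<bar>avg n (\<lambda>i. (a \<bullet> w i) * (b \<bullet> w i) * (c \<bullet> w i) * (d \<bullet> w i)) - iso4 a b c d\<bar>
      \<le> ?p ^ 4 * \<delta> * (norm a * norm b * norm c * norm d)"
      using 4[of a b c d] by (simp add: G_def power4_eq_xxxx mult_ac)
  qed
qed

lemma indep_vars_PiM_components:
  assumes M: "\<And>i. i \<in> I \<Longrightarrow> prob_space (M i)" and I: "I \<noteq> {}"
  shows "prob_space.indep_vars (PiM I M) M (\<lambda>i \<omega>. \<omega> i) I"
proof -
  interpret prob_space "PiM I M"
    by (rule prob_space_PiM) (rule M)
  have "distr (PiM I M) (PiM I M) (\<lambda>x. \<lambda>i\<in>I. x i) = distr (PiM I M) (PiM I M) (\<lambda>x. x)"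
    by (rule distr_cong) (auto simp: space_PiM restrict_PiE_iff PiE_restrict)
  also have "\<dots> = PiM I M"
    by simp
  also have "\<dots> = PiM I (\<lambda>i. distr (PiM I M) (M i) (\<lambda>\<omega>. \<omega> i))"
    by (rule PiM_cong) (simp_all add: distr_PiM_component M)
  finally show ?thesis
    by (subst indep_vars_iff_distr_eq_PiM'[OF I]) simp_all
qed

text \<open>Hoeffding's inequality is applied to each of the p^4 products of four coordinates at
  deviation K sqrt n. The union bound puts p^4 into the probability; passing from axes to all
  vectors puts p^4 into the accuracy.\<close>

lemma sample_law_concentration:
  fixes b :: "nat \<Rightarrow> real^'n" and K :: real
  assumes b: "onb b" and lam: "\<And>j. j \<in> {1..CARD('n)} \<Longrightarrow> lam j > 0" and n: "n > 0" and K: "K \<ge> 0"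
  defines "w \<equiv> \<lambda>u. (spec_mat b (\<lambda>j. 1 / sqrt (lam j)) *v u) /\<^sub>R norm (spec_mat b (\<lambda>j. 1 / sqrt (lam j)) *v u)"
  obtains A where "A \<in> sets (sample_law n (spec_mat b lam))"
    "emeasure (sample_law n (spec_mat b lam)) A \<le> ennreal (2 * real CARD('n) ^ 4 * exp (- (K\<^sup>2 / 2)))"
    "\<And>U. U \<in> space (sample_law n (spec_mat b lam)) - A \<Longrightarrow>
       near_iso4 (real CARD('n) ^ 4 * (K / sqrt (real n))) n (\<lambda>i. w (U i)) \<and> (\<forall>i<n. norm (w (U i)) = 1)"
proof -
  let ?V = "spec_mat b lam" and ?p = "real CARD('n)"
  interpret G: prob_space "ang_gauss ?V"
    by (rule prob_space_ang_gauss[OF b lam])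
  let ?M = "sample_law n ?V"
  interpret M: prob_space ?M
    unfolding sample_law_def by (rule prob_space_PiM) (rule G.prob_space_axioms)
  have w [measurable]: "w \<in> borel_measurable borel"
    unfolding w_def by measurable
  have law: "distr (ang_gauss ?V) borel w = uniform_sphere"
    unfolding w_def using ang_gauss_standardized[OF b, of lam] lam by blast
  have comp [measurable]: "(\<lambda>\<omega>. w (\<omega> i)) \<in> borel_measurable ?M" if "i < n" for i
    unfolding sample_law_def using that by (intro measurable_compose[OF measurable_component_singleton]) auto
  have distr: "distr ?M (ang_gauss ?V) (\<lambda>\<omega>. \<omega> i) = ang_gauss ?V" if "i < n" for i
    unfolding sample_law_def using that by (intro distr_PiM_component G.prob_space_axioms) auto
  have wn: "norm (w u) \<le> 1" for u
  proof -
    have "norm (x /\<^sub>R norm x) \<le> 1" for x :: "real^'n"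
      by (cases "x = 0") auto
    then show ?thesis
      unfolding w_def .
  qed
  define F where "F k l m q u = (axis k 1 \<bullet> w u) * (axis l 1 \<bullet> w u) * (axis m 1 \<bullet> w u) * (axis q 1 \<bullet> w u)"
    for k l m q :: 'n and u
  have [measurable]: "F k l m q \<in> borel_measurable borel" for k l m q
    unfolding F_def by measurable
  have F1: "\<bar>F k l m q u\<bar> \<le> 1" for k l m q u
  proof -
    have "\<bar>axis k 1 \<bullet> w u\<bar> \<le> 1" for k :: 'n
      using abs_inner_unit[OF wn, of "axis k 1" u] by simp
    then have "\<bar>F k l m q u\<bar> \<le> 1 * 1 * 1 * 1"
      unfolding F_def by (intro abs_mult_le)
    then show ?thesis
      by simp
  qed
  define bad where "bad k l m q = {U \<in> space ?M. \<bar>(\<Sum>i<n. F k l m q (U i)) - (\<Sum>i<n. M.expectation (\<lambda>U. F k l m q (U i)))\<bar> \<ge> K * sqrt (real n)}" for k l m q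
  have exp: "M.expectation (\<lambda>U. F k l m q (U i)) = iso4 (axis k 1) (axis l 1) (axis m 1) (axis q 1)" if i: "i < n" for k l m q i
  proof -
    have "M.expectation (\<lambda>U. F k l m q (U i)) = (\<integral>u. F k l m q u \<partial>distr ?M (ang_gauss ?V) (\<lambda>\<omega>. \<omega> i))"
      unfolding sample_law_def using i by (subst integral_distr) auto
    also have "\<dots> = (\<integral>u. (axis k 1 \<bullet> u) * (axis l 1 \<bullet> u) * (axis m 1 \<bullet> u) * (axis q 1 \<bullet> u) \<partial>distr (ang_gauss ?V) borel w)"
      unfolding distr[OF i] F_def by (subst integral_distr) auto
    finally show ?thesis
      unfolding law uniform_sphere_fourth_moment .
  qed
  have bad: "bad k l m q \<in> sets ?M" "emeasure ?M (bad k l m q) \<le> ennreal (2 * exp (- (K\<^sup>2 / 2)))" for k l m q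
  proof -
    have indep: "M.indep_vars (\<lambda>_. borel) (\<lambda>i U. F k l m q (U i)) {..<n}"
    proof (rule M.indep_vars_compose2[where X = "\<lambda>i U. U i" and M' = "\<lambda>_. ang_gauss ?V"])
      show "M.indep_vars (\<lambda>_. ang_gauss ?V) (\<lambda>i U. U i) {..<n}"
        unfolding sample_law_def using n by (intro indep_vars_PiM_components G.prob_space_axioms) auto
    qed measurable
    interpret H: Hoeffding_ineq ?M "{..<n}" "\<lambda>i U. F k l m q (U i)" "\<lambda>_. -1" "\<lambda>_. 1"
        "\<Sum>i<n. M.expectation (\<lambda>U. F k l m q (U i))"
      using indep F1 by unfold_locales (auto simp: abs_le_iff minus_le_iff)
    show "bad k l m q \<in> sets ?M"
      unfolding bad_def by measurable
    \<comment> \<open>The variables lie in an interval of length 2, so the exponent is -2 K^2 n / (4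
      n).\<close>
    have "M.prob (bad k l m q) \<le> 2 * exp (- 2 * (K * sqrt (real n))\<^sup>2 / (\<Sum>i<n. (1 - (- 1 :: real))\<^sup>2))"
      unfolding bad_def using K n by (intro H.Hoeffding_ineq_abs_ge) auto
    also have "- 2 * (K * sqrt (real n))\<^sup>2 / (\<Sum>i<n. (1 - (- 1 :: real))\<^sup>2) = - (K\<^sup>2 / 2)"
      using n by (simp add: power_mult_distrib)
    finally show "emeasure ?M (bad k l m q) \<le> ennreal (2 * exp (- (K\<^sup>2 / 2)))"
      by (simp add: M.emeasure_eq_measure)
  qed
  have "AE u in ang_gauss ?V. norm (w u) = 1"
  proof (rule AE_distrD[of w _ borel])
    show "AE u in distr (ang_gauss ?V) borel w. norm u = 1"
      unfolding law by (rule AE_uniform_sphere_unit)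
  qed measurable
  then have "AE U in ?M. norm (w (U i)) = 1" if "i < n" for i
    unfolding sample_law_def using that by (intro AE_PiM_component G.prob_space_axioms) auto
  then have "AE U in ?M. \<forall>i\<in>{..<n}. norm (w (U i)) = 1"
    by (intro AE_finite_allI) auto
  \<comment> \<open>The null set where some direction fails to be a unit vector joins the bad event,
    because the deterministic part is pointwise.\<close>
  then obtain N where N: "N \<in> null_sets ?M" "{U \<in> space ?M. \<not> (\<forall>i\<in>{..<n}. norm (w (U i)) = 1)} \<subseteq> N"
    by (auto elim!: AE_E)
  define Q where "Q = (UNIV :: ('n \<times> 'n \<times> 'n \<times> 'n) set)"
  define A where "A = (\<Union>(k, l, m, q)\<in>Q. bad k l m q) \<union> N"
  have "(\<Union>(k, l, m, q)\<in>Q. bad k l m q) \<in> sets ?M"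
    using bad(1) by (auto simp: Q_def)
  then have A: "A \<in> sets ?M"
    unfolding A_def using N(1) by auto
  have "emeasure ?M A = emeasure ?M (\<Union>(k, l, m, q)\<in>Q. bad k l m q)"
    unfolding A_def by (rule emeasure_Un_null_set) (use N bad(1) in \<open>auto simp: Q_def\<close>)
  also have "\<dots> \<le> (\<Sum>x\<in>Q. emeasure ?M (case x of (k, l, m, q) \<Rightarrow> bad k l m q))"
    by (rule emeasure_subadditive_finite) (use bad(1) in \<open>auto simp: Q_def\<close>)
  also have "\<dots> \<le> (\<Sum>x\<in>Q. ennreal (2 * exp (- (K\<^sup>2 / 2))))"
    by (intro sum_mono) (use bad(2) in auto)
  also have "\<dots> = ennreal (2 * ?p ^ 4 * exp (- (K\<^sup>2 / 2)))"
  proof -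
    have "card Q = CARD('n) ^ 4"
      by (simp add: Q_def power4_eq_xxxx)
    then show ?thesis
      by (simp add: ennreal_of_nat_eq_real_of_nat mult_ac flip: ennreal_mult)
  qed
  finally have "emeasure ?M A \<le> ennreal (2 * ?p ^ 4 * exp (- (K\<^sup>2 / 2)))" .
  moreover have "near_iso4 (?p ^ 4 * (K / sqrt (real n))) n (\<lambda>i. w (U i)) \<and> (\<forall>i<n. norm (w (U i)) = 1)"
    if U: "U \<in> space ?M - A" for U
  proof
    show "\<forall>i<n. norm (w (U i)) = 1"
      using U N(2) by (auto simp: A_def)
    show "near_iso4 (?p ^ 4 * (K / sqrt (real n))) n (\<lambda>i. w (U i))"
    proof (rule near_iso4_of_axes)
      fix k l m q :: 'n
      let ?x = "\<Sum>i<n. F k l m q (U i)" and ?\<mu> = "iso4 (axis k 1) (axis l 1) (axis m 1) (axis q 1) :: real"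
      have "U \<notin> bad k l m q"
        using U by (auto simp: A_def Q_def)
      then have "\<bar>?x - real n * ?\<mu>\<bar> \<le> K * sqrt (real n)"
        using U by (simp add: bad_def exp)
      then have "\<bar>?x - real n * ?\<mu>\<bar> / real n \<le> K * sqrt (real n) / real n"
        by (rule divide_right_mono) simp
      moreover have "\<bar>?x - real n * ?\<mu>\<bar> / real n = \<bar>?x / real n - ?\<mu>\<bar>"
      proof -
        have "?x / real n - ?\<mu> = (?x - real n * ?\<mu>) / real n"
          using n by (simp add: diff_divide_distrib)
        then show ?thesis
          by simp
      qed
      moreover have "K * sqrt (real n) / real n = K / sqrt (real n)"
        using n by (simp add: real_divide_square_eq divide_simps)
      ultimately show "\<bar>avg n (\<lambda>i. (axis k 1 \<bullet> w (U i)) * (axis l 1 \<bullet> w (U i)) * (axis m 1 \<bullet> w (U i)) * (axis q 1 \<bullet> w (U i))) - ?\<mu>\<bar>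
          \<le> K / sqrt (real n)"
        by (simp add: avg_def F_def)
    qed
  qed
  ultimately show thesis
    using that A by blast
qed

section \<open>Choice of constants and conclusion\<close>

lemma eventually_div_sqrt_le:
  assumes "d > 0"
  shows "\<forall>\<^sub>F n in sequentially. c / sqrt (real n) \<le> d"
proof -
  have "filterlim (\<lambda>n. sqrt (real n)) at_top sequentially"
    by (rule filterlim_compose[OF sqrt_at_top filterlim_real_sequentially])
  then have "((\<lambda>n. c / sqrt (real n)) \<longlongrightarrow> 0) sequentially"
    by (rule real_tendsto_divide_at_top[OF tendsto_const])
  then have "\<forall>\<^sub>F n in sequentially. c / sqrt (real n) < d"
    using assms by (rule order_tendstoD)
  then show ?thesis
    by eventually_elim simp
qed

text \<open>\<open>lamh\<close> and \<open>thh\<close> are arbitrary selections of eigenvalues and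
  eigenvectors. They are tied to the estimator only where \<open>tyler_ok\<close> holds, which the
  proof establishes on the event of near isotropy.\<close>

theorem theorem3:
  fixes t0 :: "real^'p"
    and lam :: "nat \<Rightarrow> nat \<Rightarrow> real"
    and th :: "nat \<Rightarrow> nat \<Rightarrow> real^'p"
    and V0 :: "nat \<Rightarrow> real^'p^'p"
    and lamh :: "nat \<Rightarrow> (nat \<Rightarrow> real^'p) \<Rightarrow> nat \<Rightarrow> real"
    and thh :: "nat \<Rightarrow> (nat \<Rightarrow> real^'p) \<Rightarrow> nat \<Rightarrow> real^'p"
    and \<eta> :: real
  assumes p2: "CARD('p) \<ge> 2"
    and t0: "norm t0 = 1"
    and orth: "\<And>n j. j \<in> {2..CARD('p)} \<Longrightarrow> th n j \<bullet> t0 = 0"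
    and onorm: "\<And>n j k. j \<in> {2..CARD('p)} \<Longrightarrow> k \<in> {2..CARD('p)} \<Longrightarrow>
                  th n j \<bullet> th n k = (if j = k then 1 else 0)"
    and spans: "\<And>n. span (th n ` {2..CARD('p)}) = {x. x \<bullet> t0 = 0}"
    and V0_def: "\<And>n. V0 n = lam n 1 *\<^sub>R outer t0 t0
                   + (\<Sum>j\<in>{2..CARD('p)}. lam n j *\<^sub>R outer (th n j) (th n j))"
    and V0_shape: "\<And>n. shape (V0 n)"
    and gap1: "\<And>n. lam n 1 > lam n 2"
    and mono: "\<And>n j. j \<in> {2..<CARD('p)} \<Longrightarrow> lam n j \<ge> lam n (Suc j)"
    and pos: "\<And>n. lam n CARD('p) > 0"
    and eta: "\<eta> > 0"
    and gap: "\<forall>\<^sub>F n in sequentially. lam n 1 / lam n 2 \<ge> 1 + \<eta>"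
    and spec: "\<And>n U. tyler_ok n U \<Longrightarrow>
                 (\<forall>j\<in>{1..<CARD('p)}. lamh n U j \<ge> lamh n U (Suc j))
               \<and> (\<forall>j\<in>{1..CARD('p)}. \<forall>k\<in>{1..CARD('p)}.
                     thh n U j \<bullet> thh n U k = (if j = k then 1 else 0))
               \<and> tyler n U = (\<Sum>j\<in>{1..CARD('p)}. lamh n U j *\<^sub>R outer (thh n U j) (thh n U j))"
  shows "oP1 (\<lambda>n. sample_law n (V0 n))
           (\<lambda>n U. T_n t0 n U (V_tilde t0 (lamh n U) (thh n U))
                   - L_n t0 n (tyler n U) (lamh n U 1))"
  unfolding oP1_def
proof (intro allI impI)
  fix \<epsilon> \<delta> :: real assume \<epsilon>: "\<epsilon> > 0" and \<delta>: "\<delta> > 0"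
  let ?X = "\<lambda>n U. T_n t0 n U (V_tilde t0 (lamh n U) (thh n U)) - L_n t0 n (tyler n U) (lamh n U 1)"
  let ?I = "{1..CARD('p)}"
  define p where "p = real CARD('p)"
  define b where "b n j = (if j = 1 then t0 else th n j)" for n j
  have I: "?I = insert 1 {2..CARD('p)}"
    by auto
  have b1: "b n 1 = t0" for n
    by (simp add: b_def)
  have b: "onb (b n)" for n
  proof -
    have "t0 \<bullet> t0 = 1"
      using t0 by (simp add: norm_eq_1)
    moreover have "t0 \<bullet> th n j = 0" "th n j \<bullet> t0 = 0" if "j \<in> {2..CARD('p)}" for j
      using orth[OF that, of n] by (simp_all add: inner_commute)
    ultimately show ?thesis
      unfolding onb_def I using onorm[of _ _ n] by (auto simp: b_def)
  qed
  have V0b: "V0 n = spec_mat (b n) (lam n)" for n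
    unfolding V0_def spec_mat_def I by (simp add: b_def)
  have lam2pos: "lam n j > 0" if "j \<in> {2..CARD('p)}" for n j
    using decreasing_chain[of 2 "CARD('p)" "lam n" j "CARD('p)"] mono[of _ n] pos[of n] that by force
  have lampos: "lam n j > 0" if "j \<in> ?I" for n j
    using lam2pos[of j n] lam2pos[of 2 n] gap1[of n] p2 that by (cases "j = 1") auto
  have lam2: "lam n j \<le> lam n 2" if "j \<in> {2..CARD('p)}" for n j
    using decreasing_chain[of 2 "CARD('p)" "lam n" 2 j] mono[of _ n] that by auto
  obtain K where K: "K \<ge> 0" "2 * p ^ 4 * exp (- (K\<^sup>2 / 2)) < \<delta>"
  proof -
    \<comment> \<open>K^2 / 2 has to exceed ln (2 p^4 / \<delta>) = - ln c; the 1 makes this strict,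
      and truncation at 0 keeps the square root real.\<close>
    define c m where "c = \<delta> / (2 * p ^ 4)" and "m = max 0 (1 - ln c)"
    have p: "p > 0"
      by (simp add: p_def)
    then have c: "c > 0"
      using \<delta> by (simp add: c_def)
    have "exp (- m) \<le> exp (ln c - 1)"
      by (simp add: m_def)
    also have "\<dots> < exp (ln c)"
      by simp
    finally have "exp (- m) < c"
      using c by simp
    then have "2 * p ^ 4 * exp (- m) < \<delta>"
      using p by (simp add: c_def field_simps)
    moreover have "(sqrt (2 * m))\<^sup>2 / 2 = m"
      by (simp add: m_def)
    ultimately show thesis
      using that[of "sqrt (2 * m)"] by (simp add: m_def)
  qed
  define \<kappa> where "\<kappa> = 6 * (2 + \<eta>) / \<eta>"
  define K2 where "K2 = \<kappa>\<^sup>2 + 80 * p ^ 4 * \<kappa>\<^sup>2 + 72 * p ^ 3 * \<kappa>"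
  \<comment> \<open>R / sqrt n is the radius p^3 (p + 2) \<delta> of the fixed-point argument for
    the accuracy \<delta> = p^4 K / sqrt n; \<open>C\<close> collects the constants in front of n
    r^3.\<close>
  define R where "R = p ^ 3 * (p + 2) * (p ^ 4 * K)"
  define C where "C = p\<^sup>2 * (p + 2) * (K2 * (K2 + 4 * \<kappa>))"
  define r where "r n = R / sqrt (real n)" for n
  have small: "\<forall>\<^sub>F n in sequentially. c * r n \<le> d" if "d > 0" for c d
    using eventually_div_sqrt_le[OF that, of "c * R"] by (simp add: r_def)
  have "\<forall>\<^sub>F n in sequentially. n > 0 \<and> 24 * p\<^sup>2 * (p + 2) * r n \<le> 1 \<and> 1 * r n \<le> 1/2 \<and> 4 * (1 + \<eta>) * r n \<le> \<eta>
      \<and> 8 * p\<^sup>2 * \<kappa> * r n \<le> 1 \<and> C * R\<^sup>2 * r n \<le> \<epsilon> \<and> lam n 1 / lam n 2 \<ge> 1 + \<eta>"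
    by (intro eventually_conj small gap eventually_gt_at_top) (use eta \<epsilon> in auto)
  then show "\<forall>\<^sub>F n in sequentially. \<exists>A\<in>sets (sample_law n (V0 n)).
      {\<omega>\<in>space (sample_law n (V0 n)). \<bar>?X n \<omega>\<bar> > \<epsilon>} \<subseteq> A \<and> emeasure (sample_law n (V0 n)) A < ennreal \<delta>"
  proof eventually_elim
    case (elim n)
    let ?A = "spec_mat (b n) (\<lambda>j. sqrt (lam n j))" and ?Ai = "spec_mat (b n) (\<lambda>j. 1 / sqrt (lam n j))"
    have n: "n > 0"
      using elim by simp
    have "lam n 2 > 0"
      using lam2pos p2 by auto
    then have gapn: "lam n 1 \<ge> (1 + \<eta>) * lam n 2"
      using elim by (simp add: pos_le_divide_eq)
    have AAi: "?A *v (?Ai *v x) = x" for x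
    proof -
      have nz: "sqrt (lam n j) \<noteq> 0" if "j \<in> ?I" for j
        using lampos[OF that, of n] by simp
      have "?A ** ?Ai = mat 1"
        unfolding spec_mat_mult[OF b] by (rule spec_mat_one[OF b]) (use nz in simp)
      then show ?thesis
        by (simp add: matrix_vector_mul_assoc)
    qed
    obtain A where A: "A \<in> sets (sample_law n (spec_mat (b n) (lam n)))"
      "emeasure (sample_law n (spec_mat (b n) (lam n))) A \<le> ennreal (2 * real CARD('p) ^ 4 * exp (- (K\<^sup>2 / 2)))"
      and good: "\<And>U. U \<in> space (sample_law n (spec_mat (b n) (lam n))) - A \<Longrightarrow>
       near_iso4 (real CARD('p) ^ 4 * (K / sqrt (real n))) n (\<lambda>i. (?Ai *v U i) /\<^sub>R norm (?Ai *v U i))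
       \<and> (\<forall>i<n. norm ((?Ai *v U i) /\<^sub>R norm (?Ai *v U i)) = 1)"
      using sample_law_concentration[OF b, of "lam n" n K] lampos n K(1) by blast
    have "\<bar>?X n U\<bar> \<le> \<epsilon>" if U: "U \<in> space (sample_law n (V0 n)) - A" for U
    proof -
      let ?w = "\<lambda>i. (?Ai *v U i) /\<^sub>R norm (?Ai *v U i)"
      have iso: "near_iso4 (p ^ 4 * (K / sqrt (real n))) n ?w" and unit: "\<And>i. i < n \<Longrightarrow> norm (?w i) = 1"
        using good U by (auto simp: V0b p_def)
      have t: "norm (?Ai *v U i) > 0" if "i < n" for i
        using unit[OF that] by auto
      have Ui: "U i = norm (?Ai *v U i) *\<^sub>R (?A *v ?w i)" if "i < n" for i
        using t[OF that] by (simp add: matrix_vector_mult_scaleR AAi)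
      have rn: "p ^ 3 * (p + 2) * (p ^ 4 * (K / sqrt (real n))) = r n"
        by (simp add: r_def R_def)
      have sp: "(\<forall>j\<in>{1..<CARD('p)}. lamh n U (Suc j) \<le> lamh n U j) \<and> onb (thh n U)
          \<and> tyler n U = spec_mat (thh n U) (lamh n U)" if "tyler_ok n U"
        using spec[OF that] by (auto simp: onb_def spec_mat_def)
      have "24 * p\<^sup>2 * (p + 2) * r n \<le> 1" "r n \<le> 1/2" "4 * (1 + \<eta>) * r n \<le> \<eta>" "8 * p\<^sup>2 * (\<kappa> * r n) \<le> 1"
        using elim by (simp_all add: mult.assoc)
      note sm = this[unfolded rn[symmetric] \<kappa>_def, unfolded p_def]
      have "\<bar>?X n U\<bar> \<le> real n * (p\<^sup>2 * (p + 2)) * (K2 * (K2 + 4 * \<kappa>) * r n ^ 3)"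
        unfolding K2_def \<kappa>_def rn[symmetric] unfolding p_def
        by (rule T_n_L_n_near_isotropic[OF b b1 _ p2 _ gapn eta refl iso[unfolded p_def] unit n Ui t sm])
           (use lampos lam2 sp in auto)
      also have "\<dots> = C * (real n * (r n)\<^sup>2) * r n"
        by (simp add: C_def power2_eq_square power3_eq_cube mult_ac)
      \<comment> \<open>n r_n^2 is constant, so one factor r_n of order 1 / sqrt n remains and falls
        below \<epsilon> / (C R^2).\<close>
      also have "real n * (r n)\<^sup>2 = R\<^sup>2"
        using n by (simp add: r_def power_divide)
      finally show ?thesis
        using elim by linarith
    qed
    then have "{\<omega>\<in>space (sample_law n (V0 n)). \<bar>?X n \<omega>\<bar> > \<epsilon>} \<subseteq> A"
      by force
    moreover have "emeasure (sample_law n (V0 n)) A < ennreal \<delta>"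
      using A(2) K(2) \<delta> unfolding V0b p_def by (elim le_less_trans) (simp add: ennreal_less_iff)
    ultimately show ?case
      using A(1) unfolding V0b[symmetric] by blast
  qed
qed

end
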